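(* Let $g \geq 1$ and $r \geq 1$ be integers, let $a$ be an arbitrary nonzero constant and $b$ an arbitrary constant. Let $T_r$ be the Chebyshev polynomial of the first kind of degree $r$, and let $$ L_{2r} = \left( a\, T_r\!\left(\frac{d}{dx}\right) - x^2 \frac{d^2}{dx^2} - 3x \frac{d}{dx} + x^2 + b \right)^2 - a\, r^2 g(g+1)\, T_r\!\left(\frac{d}{dx}\right). $$ (i) Suppose $r > 1$. Then $L_{2r}$ has order $2r$, and there exist constants $a_0, a_1, \ldots, a_{2g}$ and an ordinary scalar differential operator $M_{(2g+1)r}$ of order $(2g+1)r$ with polynomial coefficients such that $$ [L_{2r}, M_{(2g+1)r}] = 0, \qquad M_{(2g+1)r}^2 = L_{2r}^{2g+1} + a_{2g} L_{2r}^{2g} + \ldots + a_1 L_{2r} + a_0, $$ and $L_{2r}, M_{(2g+1)r}$ are commuting operators of rank $r$ and genus $g$; that is, the hyperelliptic spectral curve $\mu^2 = \lambda^{2g+1} + a_{2g}\lambda^{2g} + \ldots + a_1 \lambda + a_0$ has genus $g$, and the common eigenfunctions form an $r$-dimensional space over a generic point of it. The coefficients of $M_{(2g+1)r}$ are expressed polynomially in terms of the coefficients of $L_{2r}$ and their derivatives. If moreover $r > 3$ and $a = 1/2^{r-1}$, then the commuting operators $L_{2r}$ and $M_{(2g+1)r}$ have the standard canonical form. (ii) Suppose $r = 1$. Then the corresponding pair of operators is a commuting pair of rank $2$ and genus $g$: for the operator $$ L_2 = \left( a\, \frac{d}{dx} - x^2 \frac{d^2}{dx^2} - 3x \frac{d}{dx}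 + x^2 + b \right)^2 - a\, g(g+1)\, \frac{d}{dx} $$ (that is, $L_{2r}$ with $r=1$) there exist constants $a_0, \ldots, a_{2g}$ and an ordinary scalar differential operator $M$ with $[L_2, M] = 0$ and $M^2 = L_2^{2g+1} + a_{2g} L_2^{2g} + \ldots + a_1 L_2 + a_0$, and the pair $L_2, M$ has rank $2$ and genus $g$.
   Context: All operators are ordinary scalar differential operators $\sum_i u_i(x) \frac{d^i}{dx^i}$ in one variable $x$. The Chebyshev polynomials of the first kind are defined by $T_0(z) = 1$, $T_1(z) = z$, $T_r(z) = 2 z T_{r-1}(z) - T_{r-2}(z)$. The notation $T_r(\frac{d}{dx})$ means the constant-coefficient differential operator obtained by substituting $\frac{d}{dx}$ for $z$ in $T_r(z)$. Powers of operators are with respect to composition, and $[L,M] = LM - ML$. Spectral curve and genus: any pair of commuting ordinary scalar differential operators $L, M$ satisfies a polynomial relation $Q(L,M)=0$ given by its spectral curve $\Gamma: Q(\lambda,\mu)=0$, where $L\psi=\lambda\psi$, $M\psi=\mu\psi$ for common eigenfunctions $\psi$; $\Gamma$ is irreducible and is completed at infinity with a unique point. When $M^2 = L^{2g+1} + a_{2g} L^{2g} + \ldots + a_1 L + a_0$ with constants $a_i$, the spectral curve is the hyperelliptic curve $\mu^2 = \lambda^{2g+1} + a_{2g}\lambda^{2g} + \ldots + a_1\lambda + a_0$. The genus of the commuting pair is the genus of its spectral curve $\Gamma$. Rank: the rank of the commuting pair $L, M$ is the dimension, at a generic point $(\lambda,\mu) \in \Gamma$, of the space of common eigenfunctions $\psi(x)$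 satisfying $L\psi = \lambda\psi$, $M\psi = \mu\psi$ (the dimension of the vector bundle of common eigenfunctions over $\Gamma$). Standard canonical form: commuting operators $L = \sum_{i=0}^n u_i(x) \frac{d^i}{dx^i}$ and $M = \sum_{i=0}^m v_i(x)\frac{d^i}{dx^i}$ (of orders $n$ and $m$) have the standard canonical form if $u_n(x) = v_m(x) = 1$ and $u_{n-1}(x) = 0$.
   Formalization: "Genus" means the arithmetic genus of the spectral curve completed by one smooth point at infinity (the usual genus when the curve is smooth); with geometric genus the claim fails for special a, b, e.g. g=r=1, a=4/9, b=-23/36, where the curve is a singular cubic. *)

theory Defs
  imports
    "HOL-Complex_Analysis.Complex_Analysis"
    "HOL-Computational_Algebra.Polynomial"
    "HOL-Library.Function_Algebras"
begin

section \<open>The ring of ordinary differential operators with polynomial coefficients\<close>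

text \<open>
  The polynomial \<open>op_poly P\<close> is the symbol of \<open>P\<close>: its coefficient at index \<open>i\<close> is the
  polynomial \<open>u\<^sub>i(x)\<close> standing to the left of the \<open>i\<close>-th power of \<open>d/dx\<close>.
\<close>

datatype diffop = Diffop (op_poly: "complex poly poly")

definition op_coeff :: "diffop \<Rightarrow> nat \<Rightarrow> complex poly" where
  "op_coeff P i = coeff (op_poly P) i"

definition op_order :: "diffop \<Rightarrow> nat" where
  "op_order P = degree (op_poly P)"

definition op_lead :: "diffop \<Rightarrow> complex poly" where
  "op_lead P = op_coeff P (op_order P)"

text \<open>Composition with \<open>d/dx\<close> on the left:
  \<open>(d/dx) v (d/dx)^j = v' (d/dx)^j + v (d/dx)^(j+1)\<close>.\<close>

definition deriv_comp :: "complex poly poly \<Rightarrow> complex poly poly" where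
  "deriv_comp q = map_poly pderiv q + pCons 0 q"

definition symbol_comp :: "complex poly poly \<Rightarrow> complex poly poly \<Rightarrow> complex poly poly" where
  "symbol_comp p q = (\<Sum>i\<le>degree p. smult (coeff p i) ((deriv_comp ^^ i) q))"

lemma coeff_deriv_comp:
  "coeff (deriv_comp q) n = pderiv (coeff q n) + (case n of 0 \<Rightarrow> 0 | Suc m \<Rightarrow> coeff q m)"
  by (simp add: deriv_comp_def coeff_map_poly coeff_pCons)

lemma deriv_comp_0 [simp]: "deriv_comp 0 = 0"
  by (simp add: deriv_comp_def)

lemma deriv_comp_add: "deriv_comp (p + q) = deriv_comp p + deriv_comp q"
  by (rule poly_eqI) (simp add: coeff_deriv_comp pderiv_add split: nat.split)

lemma deriv_comp_smult:
  "deriv_comp (smult u q) = smult (pderiv u) q + smult u (deriv_comp q)"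
  by (rule poly_eqI)
    (simp add: coeff_deriv_comp pderiv_mult algebra_simps split: nat.split)

lemma deriv_comp_pow_0 [simp]: "(deriv_comp ^^ n) 0 = 0"
  by (induction n) auto

lemma deriv_comp_pow_add: "(deriv_comp ^^ n) (p + q) = (deriv_comp ^^ n) p + (deriv_comp ^^ n) q"
  by (induction n) (auto simp: deriv_comp_add)

lemma symbol_comp_0_left [simp]: "symbol_comp 0 q = 0"
  by (simp add: symbol_comp_def)

lemma symbol_comp_altdef:
  assumes "degree p \<le> n"
  shows "symbol_comp p q = (\<Sum>i\<le>n. smult (coeff p i) ((deriv_comp ^^ i) q))"
  unfolding symbol_comp_def
  by (rule sum.mono_neutral_left) (use assms in \<open>auto simp: coeff_eq_0\<close>)

lemma symbol_comp_pCons: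
  "symbol_comp (pCons u p) q = smult u q + symbol_comp p (deriv_comp q)"
proof -
  have "symbol_comp (pCons u p) q =
      (\<Sum>i\<le>Suc (degree p). smult (coeff (pCons u p) i) ((deriv_comp ^^ i) q))"
    by (rule symbol_comp_altdef) (rule degree_pCons_le)
  also have "\<dots> = smult u q + (\<Sum>i\<le>degree p. smult (coeff p i) ((deriv_comp ^^ i) (deriv_comp q)))"
    by (subst sum.atMost_Suc_shift) (simp add: funpow_swap1)
  finally show ?thesis
    by (simp add: symbol_comp_def)
qed

lemma symbol_comp_add_left: "symbol_comp (p + p') q = symbol_comp p q + symbol_comp p' q"
proof -
  define n where "n = max (degree p) (degree p')"
  have "degree p \<le> n" "degree p' \<le> n" "degree (p + p') \<le> n"
    by (auto simp: n_def degree_add_le)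
  thus ?thesis
    by (simp add: symbol_comp_altdef[of _ n] smult_add_left sum.distrib)
qed

lemma symbol_comp_add_right: "symbol_comp p (q + q') = symbol_comp p q + symbol_comp p q'"
  by (simp add: symbol_comp_def deriv_comp_pow_add smult_add_right sum.distrib)

lemma symbol_comp_0_right [simp]: "symbol_comp p 0 = 0"
  by (simp add: symbol_comp_def)

lemma symbol_comp_smult_left: "symbol_comp (smult u p) q = smult u (symbol_comp p q)"
proof -
  have "degree (smult u p) \<le> degree p"
    by (rule degree_smult_le)
  thus ?thesis
    by (intro poly_eqI)
      (simp add: symbol_comp_altdef[of _ "degree p"] coeff_sum sum_distrib_left mult_ac)
qed

lemma symbol_comp_deriv_comp:
  "symbol_comp (deriv_comp q) s = deriv_comp (symbol_comp q s)"
proof (induction q arbitrary: s)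
  case 0
  show ?case by simp
next
  case (pCons v q)
  have eq: "deriv_comp (pCons v q) = pCons 0 (pCons v q) + pCons (pderiv v) (map_poly pderiv q)"
    unfolding deriv_comp_def by (subst map_poly_pCons) (simp_all add: add_ac)
  have IH: "deriv_comp (symbol_comp q (deriv_comp s)) =
      symbol_comp (map_poly pderiv q) (deriv_comp s) + symbol_comp (pCons 0 q) (deriv_comp s)"
    using pCons.IH[of "deriv_comp s"]
    by (simp add: deriv_comp_def[of q] symbol_comp_add_left)
  show ?case
    by (simp add: eq symbol_comp_add_left symbol_comp_pCons deriv_comp_add deriv_comp_smult IH
        add_ac)
qed

lemma symbol_comp_assoc: "symbol_comp (symbol_comp p q) s = symbol_comp p (symbol_comp q s)"
  by (induction p arbitrary: q)
    (simp_all add: symbol_comp_pCons symbol_comp_add_left symbol_comp_smult_left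
      symbol_comp_deriv_comp)

lemma symbol_comp_1_left: "symbol_comp 1 q = q"
  by (simp add: symbol_comp_def)

lemma symbol_comp_1_right: "symbol_comp p 1 = p"
proof -
  have "(deriv_comp ^^ i) 1 = monom 1 i" for i
    by (induction i) (auto simp: deriv_comp_def monom_Suc map_poly_monom)
  thus ?thesis
    by (simp add: symbol_comp_def smult_monom poly_as_sum_of_monoms)
qed

instantiation diffop :: ring_1
begin

definition zero_diffop :: diffop where "0 = Diffop 0"
definition one_diffop :: diffop where "1 = Diffop 1"
definition plus_diffop :: "diffop \<Rightarrow> diffop \<Rightarrow> diffop" where
  "P + Q = Diffop (op_poly P + op_poly Q)"
definition minus_diffop :: "diffop \<Rightarrow> diffop \<Rightarrow> diffop" where
  "P - Q = Diffop (op_poly P - op_poly Q)"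
definition uminus_diffop :: "diffop \<Rightarrow> diffop" where
  "- P = Diffop (- op_poly P)"
definition times_diffop :: "diffop \<Rightarrow> diffop \<Rightarrow> diffop" where
  "P * Q = Diffop (symbol_comp (op_poly P) (op_poly Q))"

instance
  by standard
    (simp_all add: zero_diffop_def one_diffop_def plus_diffop_def minus_diffop_def
      uminus_diffop_def times_diffop_def symbol_comp_assoc symbol_comp_1_left
      symbol_comp_1_right symbol_comp_add_left symbol_comp_add_right diffop.expand)

end

definition op_mult :: "complex poly \<Rightarrow> diffop" where
  "op_mult u = Diffop [:u:]"

definition op_const :: "complex \<Rightarrow> diffop" where
  "op_const c = op_mult [:c:]"

definition op_x :: diffop where
  "op_x = op_mult [:0, 1:]"

definition op_d :: diffop where
  "op_d = Diffop [:0, 1:]"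

definition commutator :: "diffop \<Rightarrow> diffop \<Rightarrow> diffop" where
  "commutator P Q = P * Q - Q * P"

definition poly_at_op :: "complex poly \<Rightarrow> diffop \<Rightarrow> diffop" where
  "poly_at_op p P = (\<Sum>i\<le>degree p. op_const (coeff p i) * P ^ i)"

text \<open>A bivariate polynomial \<open>Q(\<lambda>,\<mu>)\<close> is a polynomial in \<open>\<mu>\<close> (outer) whose coefficients are
  polynomials in \<open>\<lambda>\<close> (inner). The order of the factors in the second definition is immaterial
  for commuting operators, the only case in which it is used.\<close>

definition poly2_eval :: "complex poly poly \<Rightarrow> complex \<Rightarrow> complex \<Rightarrow> complex" where
  "poly2_eval Q l m = poly (poly Q [:m:]) l"

definition poly2_at_ops :: "complex poly poly \<Rightarrow> diffop \<Rightarrow> diffop \<Rightarrow> diffop" where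
  "poly2_at_ops Q L M = (\<Sum>j\<le>degree Q. poly_at_op (coeff Q j) L * M ^ j)"


section \<open>Action on holomorphic functions\<close>

definition op_apply :: "diffop \<Rightarrow> (complex \<Rightarrow> complex) \<Rightarrow> complex \<Rightarrow> complex" where
  "op_apply P f x = (\<Sum>i\<le>op_order P. poly (op_coeff P i) x * (deriv ^^ i) f x)"

text \<open>The abstract product in \<open>diffop\<close> is indeed composition of operators.\<close>

lemma op_apply_altdef:
  assumes "degree p \<le> n"
  shows "op_apply (Diffop p) f x = (\<Sum>i\<le>n. poly (coeff p i) x * (deriv ^^ i) f x)"
  unfolding op_apply_def op_order_def op_coeff_def diffop.sel
  by (rule sum.mono_neutral_left) (use assms in \<open>auto simp: coeff_eq_0\<close>)

lemma op_apply_add: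
  "op_apply (Diffop (p + q)) f x = op_apply (Diffop p) f x + op_apply (Diffop q) f x"
proof -
  define n where "n = max (degree p) (degree q)"
  have "degree p \<le> n" "degree q \<le> n" "degree (p + q) \<le> n"
    by (auto simp: n_def degree_add_le)
  thus ?thesis
    by (simp add: op_apply_altdef[of _ n] sum.distrib algebra_simps)
qed

lemma op_apply_smult:
  "op_apply (Diffop (smult u p)) f x = poly u x * op_apply (Diffop p) f x"
  by (simp add: op_apply_altdef[of _ "degree p"] degree_smult_le sum_distrib_left mult_ac)

lemma op_apply_pCons:
  "op_apply (Diffop (pCons u p)) f x = poly u x * f x + op_apply (Diffop p) (deriv f) x"
proof -
  have "op_apply (Diffop (pCons u p)) f x =
      (\<Sum>i\<le>Suc (degree p). poly (coeff (pCons u p) i) x * (deriv ^^ i) f x)"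
    by (rule op_apply_altdef) (rule degree_pCons_le)
  also have "\<dots> = poly u x * f x + (\<Sum>i\<le>degree p. poly (coeff p i) x * (deriv ^^ i) (deriv f) x)"
    by (subst sum.atMost_Suc_shift) (simp add: funpow_swap1)
  finally show ?thesis
    by (simp add: op_apply_altdef[OF order_refl])
qed

lemma op_apply_0 [simp]: "op_apply (Diffop 0) f x = 0"
  by (simp add: op_apply_def op_order_def op_coeff_def)

lemma holomorphic_on_op_apply:
  assumes "open U" "f holomorphic_on U"
  shows "op_apply P f holomorphic_on U"
proof -
  have "(deriv ^^ i) f holomorphic_on U" for i
    using assms by (intro holomorphic_higher_deriv) auto
  thus ?thesis
    unfolding op_apply_def
    by (intro holomorphic_on_sum holomorphic_on_mult)
      (auto intro: holomorphic_intros)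
qed

lemma op_apply_deriv_comp:
  assumes U: "open U" and f: "f holomorphic_on U" and x: "x \<in> U"
  shows "op_apply (Diffop (deriv_comp q)) f x = deriv (op_apply (Diffop q) f) x"
  using f
proof (induction q arbitrary: f)
  case 0
  have "op_apply (Diffop 0) f = (\<lambda>_. 0)"
    by (rule ext) simp
  thus ?case by simp
next
  case (pCons v q)
  have hol': "deriv f holomorphic_on U"
    using pCons.prems U by (rule holomorphic_deriv)
  have eq: "deriv_comp (pCons v q) = pCons 0 (pCons v q) + pCons (pderiv v) (map_poly pderiv q)"
    unfolding deriv_comp_def by (subst map_poly_pCons) (simp_all add: add_ac)
  have IH: "deriv (op_apply (Diffop q) (deriv f)) x =
      op_apply (Diffop (map_poly pderiv q)) (deriv f) x + op_apply (Diffop q) (deriv (deriv f)) x"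
    using pCons.IH[OF hol'] by (simp add: deriv_comp_def op_apply_add op_apply_pCons)
  have fun_eq: "op_apply (Diffop (pCons v q)) f =
      (\<lambda>x. poly v x * f x + op_apply (Diffop q) (deriv f) x)"
    by (rule ext) (rule op_apply_pCons)
  have d1: "f field_differentiable at x"
    using pCons.prems U x by (meson holomorphic_on_imp_differentiable_at)
  have d2: "op_apply (Diffop q) (deriv f) field_differentiable at x"
    using holomorphic_on_op_apply[OF U hol'] U x by (meson holomorphic_on_imp_differentiable_at)
  have "((\<lambda>x. poly v x * f x + op_apply (Diffop q) (deriv f) x) has_field_derivative
      (poly (pderiv v) x * f x + deriv f x * poly v x + deriv (op_apply (Diffop q) (deriv f)) x))
      (at x)"
    by (intro DERIV_add DERIV_mult poly_DERIV)
      (use d1 d2 in \<open>auto simp: DERIV_deriv_iff_field_differentiable\<close>)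
  hence "deriv (op_apply (Diffop (pCons v q)) f) x =
      poly (pderiv v) x * f x + deriv f x * poly v x + deriv (op_apply (Diffop q) (deriv f)) x"
    unfolding fun_eq by (rule DERIV_imp_deriv)
  moreover have "op_apply (Diffop (deriv_comp (pCons v q))) f x =
      poly v x * deriv f x + op_apply (Diffop q) (deriv (deriv f)) x +
      (poly (pderiv v) x * f x + op_apply (Diffop (map_poly pderiv q)) (deriv f) x)"
    by (simp add: eq op_apply_add op_apply_pCons)
  ultimately show ?case
    using IH by (simp add: algebra_simps)
qed

theorem op_apply_mult:
  assumes U: "open U" and f: "f holomorphic_on U" and x: "x \<in> U"
  shows "op_apply (P * Q) f x = op_apply P (op_apply Q f) x"
proof -
  have "op_apply (Diffop (symbol_comp p q)) f x = op_apply (Diffop p) g x"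
    if "g holomorphic_on U" "\<forall>y\<in>U. g y = op_apply (Diffop q) f y" for p q g
    using that
  proof (induction p arbitrary: q g)
    case 0
    show ?case by simp
  next
    case (pCons u p)
    have "deriv g y = op_apply (Diffop (deriv_comp q)) f y" if y: "y \<in> U" for y
    proof -
      have "eventually (\<lambda>z. g z = op_apply (Diffop q) f z) (nhds y)"
        using U y pCons.prems(2) eventually_nhds by blast
      hence "deriv g y = deriv (op_apply (Diffop q) f) y"
        by (intro deriv_cong_ev) auto
      thus ?thesis
        using op_apply_deriv_comp[OF U f y] by simp
    qed
    moreover have "deriv g holomorphic_on U"
      using pCons.prems(1) U by (rule holomorphic_deriv)
    ultimately have "op_apply (Diffop (symbol_comp p (deriv_comp q))) f x =
        op_apply (Diffop p) (deriv g) x"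
      by (intro pCons.IH) auto
    thus ?case
      using pCons.prems(2) x
      by (simp add: symbol_comp_pCons op_apply_add op_apply_smult op_apply_pCons)
  qed
  from this[of "op_apply Q f" "op_poly Q" "op_poly P"] show ?thesis
    using holomorphic_on_op_apply[OF U f] by (simp add: times_diffop_def)
qed


section \<open>Spectral curve, rank and genus\<close>

interpretation cfun: vector_space "\<lambda>(c::complex) (f :: 'a \<Rightarrow> complex) x. c * f x"
  by standard (auto simp: fun_eq_iff algebra_simps)

text \<open>The affine spectral curve is the common zero set of all polynomial relations \<open>Q(L,M) = 0\<close>.\<close>

definition spectral_curve :: "diffop \<Rightarrow> diffop \<Rightarrow> (complex \<times> complex) set" where
  "spectral_curve L M =
     {(l, m). \<forall>Q. poly2_at_ops Q L M = 0 \<longrightarrow> poly2_eval Q l m = 0}"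

text \<open>Functions on \<open>D\<close> are normalised to vanish outside \<open>D\<close>, so that equality of functions
  is equality on \<open>D\<close>.\<close>

definition common_eigenfunctions ::
  "complex set \<Rightarrow> diffop \<Rightarrow> diffop \<Rightarrow> complex \<Rightarrow> complex \<Rightarrow> (complex \<Rightarrow> complex) set" where
  "common_eigenfunctions D L M l m =
     {f. f holomorphic_on D \<and> (\<forall>x. x \<notin> D \<longrightarrow> f x = 0) \<and>
         (\<forall>x\<in>D. op_apply L f x = l * f x \<and> op_apply M f x = m * f x)}"

text \<open>
  Eigenfunctions are considered on discs that avoid the zeros of the leading coefficients,
  where the eigenvalue equations have no singular points. A generic point of the (irreducible)
  spectral curve is any point outside some finite subset.
\<close>

definition has_rank :: "diffop \<Rightarrow> diffop \<Rightarrow> nat \<Rightarrow> bool" where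
  "has_rank L M k \<longleftrightarrow>
     (\<exists>S. finite S \<and>
       (\<forall>x\<^sub>0 e. e > 0 \<and> (\<forall>x\<in>ball x\<^sub>0 e. poly (op_lead L) x \<noteq> 0 \<and> poly (op_lead M) x \<noteq> 0) \<longrightarrow>
         (\<forall>(l, m) \<in> spectral_curve L M - S.
           cfun.dim (common_eigenfunctions (ball x\<^sub>0 e) L M l m) = k)))"

text \<open>
  Let \<open>C\<close> be an irreducible affine plane curve, completed at infinity by a single smooth point.
  A regular function \<open>f\<close> on \<open>C\<close> has its only pole at infinity, so the order of this pole is the
  degree of \<open>f\<close> as a map to the projective line, i.e. the cardinality of its generic fibre
  (zero for constant \<open>f\<close>). Thus \<open>functions_pole_le C n\<close> is the space of global sections of the line
  bundle given by \<open>n\<close> times the point at infinity.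
\<close>

definition functions_pole_le :: "(complex \<times> complex) set \<Rightarrow> nat \<Rightarrow> (complex \<times> complex \<Rightarrow> complex) set" where
  "functions_pole_le C n =
     {f. (\<exists>Q. \<forall>l m. f (l, m) = (if (l, m) \<in> C then poly2_eval Q l m else 0)) \<and>
         (\<exists>d\<le>n. \<exists>S. finite S \<and>
            (\<forall>c. c \<notin> S \<longrightarrow> finite {p \<in> C. f p = c} \<and> card {p \<in> C. f p = c} = d))}"

text \<open>
  The genus is the arithmetic genus of the completed curve, read off from its Hilbert polynomial
  \<open>n + 1 - p\<close>; for a smooth curve this is the usual genus. The geometric genus would not do: the
  spectral curves considered here are singular for special values of the parameters.
\<close>

definition has_genus :: "(complex \<times> complex) set \<Rightarrow> nat \<Rightarrow> bool" where
  "has_genus C p \<longleftrightarrow> (\<forall>\<^sub>F n in sequentially. cfun.dim (functions_pole_le C n) + p = n + 1)"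


section \<open>Further notions\<close>

definition standard_canonical_form :: "diffop \<Rightarrow> diffop \<Rightarrow> bool" where
  "standard_canonical_form L M \<longleftrightarrow>
     op_lead L = 1 \<and> op_lead M = 1 \<and> op_coeff L (op_order L - 1) = 0"

text \<open>Differential polynomials, with constant coefficients, in the elements of \<open>U\<close>.\<close>

inductive_set diff_polys :: "complex poly set \<Rightarrow> complex poly set"
  for U :: "complex poly set" where
  const: "[:c:] \<in> diff_polys U"
| deriv: "u \<in> U \<Longrightarrow> (pderiv ^^ k) u \<in> diff_polys U"
| add: "p \<in> diff_polys U \<Longrightarrow> q \<in> diff_polys U \<Longrightarrow> p + q \<in> diff_polys U"
| mult: "p \<in> diff_polys U \<Longrightarrow> q \<in> diff_polys U \<Longrightarrow> p * q \<in> diff_polys U"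

fun cheb :: "nat \<Rightarrow> complex poly" where
  "cheb 0 = 1"
| "cheb (Suc 0) = [:0, 1:]"
| "cheb (Suc (Suc n)) = 2 * [:0, 1:] * cheb (Suc n) - cheb n"

definition cheb_op :: "nat \<Rightarrow> nat \<Rightarrow> complex \<Rightarrow> complex \<Rightarrow> diffop" where
  "cheb_op g r a b =
     (op_const a * poly_at_op (cheb r) op_d - op_x ^ 2 * op_d ^ 2 - 3 * op_x * op_d
        + op_x ^ 2 + op_const b) ^ 2
     - op_const (a * of_nat (r ^ 2 * g * (g + 1))) * poly_at_op (cheb r) op_d"

end

theory Submission
  imports Defs
    "HOL-Computational_Algebra.Fundamental_Theorem_Algebra"
begin

text \<open>
  Put \<open>y = d/dx\<close> and \<open>d/dy = -x\<close>, and write \<open>y = cosh t\<close>. Then \<open>T\<^sub>r(y) = cosh (r t)\<close> and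
  \<open>x\<^sup>2 (d/dx)\<^sup>2 + 3 x d/dx + 1 - x\<^sup>2\<close> becomes \<open>(d/dt)\<^sup>2\<close>, so that with \<open>s = r t\<close> the operator
  \<open>L / r\<^sup>4\<close> becomes \<open>((d/ds)\<^sup>2 + V)\<^sup>2 + W\<close>, where \<open>V = \<alpha> cosh s + \<beta>\<close> and
  \<open>W = \<alpha> g (g + 1) cosh s\<close>. For a function \<open>q\<close> let \<open>P\<^sub>q = q ((d/ds)\<^sup>2 + V) - q' d/ds + q''/2\<close>. If a
  polynomial \<open>Q = \<Sum> q\<^sub>j z\<^sup>j\<close> of degree \<open>g\<close> in \<open>z\<close> with constant leading coefficient solves
  \<open>Q''''' + 4 V Q''' + 6 V' Q'' + 2 (2 z - 2 W + V'') Q' - 2 W' Q = 0\<close>, then \<open>M = \<Sum> P\<^bsub>q\<^sub>j\<^esub> L\<^sup>j\<close> commutes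
  with \<open>L\<close> and \<open>M\<^sup>2\<close> is a polynomial in \<open>L\<close> with constant coefficients. On polynomials in \<open>cosh s\<close>
  the part of this equation that does not involve \<open>z\<close> is triangular, and its diagonal entry vanishes
  exactly in degree \<open>g\<close>; hence \<open>q\<^sub>0\<close> of degree \<open>g\<close> exists, each \<open>q\<^sub>j\<close> is determined by its predecessor
  and has one degree less, and the process ends with a constant \<open>q\<^sub>g\<close>.

  The rank is half the order of \<open>L\<close>: the trace of \<open>M\<close> on the kernel of \<open>L - l\<close> is a polynomial in
  \<open>l\<close> whose square is a constant multiple of \<open>F(l)\<close>, where \<open>M\<^sup>2 = F(L)\<close>; since the degree of \<open>F\<close> is
  odd, the trace vanishes and the two eigenvalues of \<open>M\<close> have equal multiplicity.
\<close>

subsection \<open>Orders and leading coefficients\<close>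

lemma op_poly_simps [simp]:
  "op_poly 0 = 0" "op_poly 1 = 1" "op_poly (P + Q) = op_poly P + op_poly Q"
  "op_poly (P - Q) = op_poly P - op_poly Q" "op_poly (- P) = - op_poly P"
  "op_poly (P * Q) = symbol_comp (op_poly P) (op_poly Q)"
  by (simp_all add: zero_diffop_def one_diffop_def plus_diffop_def minus_diffop_def
      uminus_diffop_def times_diffop_def)

lemma op_poly_eq_0_iff [simp]: "op_poly P = 0 \<longleftrightarrow> P = 0"
  by (metis diffop.expand op_poly_simps(1))

lemma op_coeff_simps [simp]:
  "op_coeff 0 i = 0" "op_coeff (P + Q) i = op_coeff P i + op_coeff Q i"
  "op_coeff (P - Q) i = op_coeff P i - op_coeff Q i" "op_coeff (- P) i = - op_coeff P i"
  by (simp_all add: op_coeff_def)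

lemma op_poly_const [simp]: "op_poly (op_const c) = [:[:c:]:]"
  by (simp add: op_const_def op_mult_def)

lemma degree_deriv_comp:
  assumes "q \<noteq> 0"
  shows "degree (deriv_comp q) = Suc (degree q)" "lead_coeff (deriv_comp q) = lead_coeff q"
proof -
  have c: "coeff (deriv_comp q) (Suc (degree q)) = lead_coeff q"
    by (simp add: coeff_deriv_comp coeff_eq_0)
  show "degree (deriv_comp q) = Suc (degree q)"
  proof (rule antisym)
    show "degree (deriv_comp q) \<le> Suc (degree q)"
      by (rule degree_le) (auto simp: coeff_deriv_comp coeff_eq_0 split: nat.split)
    show "degree (deriv_comp q) \<ge> Suc (degree q)"
      using c assms by (intro le_degree) auto
  qed
  thus "lead_coeff (deriv_comp q) = lead_coeff q" using c by simp
qed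

lemma degree_deriv_comp_pow:
  assumes "q \<noteq> 0"
  shows "(deriv_comp ^^ n) q \<noteq> 0 \<and> degree ((deriv_comp ^^ n) q) = n + degree q \<and>
    lead_coeff ((deriv_comp ^^ n) q) = lead_coeff q"
proof (induction n)
  case (Suc n)
  thus ?case
    using degree_deriv_comp[of "(deriv_comp ^^ n) q"] assms by (auto simp: leading_coeff_0_iff)
qed (use assms in auto)

text \<open>Each application of \<open>deriv_comp\<close> raises the degree by one and keeps the
  leading coefficient, so only the summand with \<open>i = degree p\<close> reaches the top degree.
  Nothing cancels there because \<open>complex poly\<close> is a domain.\<close>

lemma degree_symbol_comp:
  assumes "p \<noteq> 0" "q \<noteq> 0"
  shows "degree (symbol_comp p q) = degree p + degree q"
    and "lead_coeff (symbol_comp p q) = lead_coeff p * lead_coeff q"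
proof -
  note d = degree_deriv_comp_pow[OF assms(2)]
  have z: "coeff ((deriv_comp ^^ i) q) j = 0" if "j > i + degree q" for i j
    using d[of i] that by (simp add: coeff_eq_0)
  have "coeff (symbol_comp p q) (degree p + degree q) =
      (\<Sum>i\<le>degree p. if i = degree p then lead_coeff p * lead_coeff q else 0)"
    unfolding symbol_comp_def coeff_sum
    using d[of "degree p"] by (intro sum.cong) (auto simp: z)
  hence c: "coeff (symbol_comp p q) (degree p + degree q) = lead_coeff p * lead_coeff q"
    by simp
  show "degree (symbol_comp p q) = degree p + degree q"
  proof (rule antisym)
    show "degree (symbol_comp p q) \<le> degree p + degree q"
      by (rule degree_le) (auto simp: symbol_comp_def coeff_sum z)
    show "degree (symbol_comp p q) \<ge> degree p + degree q"
      using c assms by (intro le_degree) auto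
  qed
  thus "lead_coeff (symbol_comp p q) = lead_coeff p * lead_coeff q" using c by simp
qed

lemma op_order_0 [simp]: "op_order 0 = 0"
  by (simp add: op_order_def)

lemma op_lead_eq_0_iff [simp]: "op_lead P = 0 \<longleftrightarrow> P = 0"
  by (simp add: op_lead_def op_coeff_def op_order_def)

lemma op_lead_0 [simp]: "op_lead 0 = 0"
  by simp

lemma op_order_mult: "P \<noteq> 0 \<Longrightarrow> Q \<noteq> 0 \<Longrightarrow> op_order (P * Q) = op_order P + op_order Q"
  by (simp add: op_order_def degree_symbol_comp)

lemma op_lead_mult: "op_lead (P * Q) = op_lead P * op_lead Q"
proof (cases "P = 0 \<or> Q = 0")
  case False
  thus ?thesis
    using degree_symbol_comp[of "op_poly P" "op_poly Q"] by (simp add: op_lead_def op_coeff_def op_order_def)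
qed (auto simp: op_lead_def)

instance diffop :: ring_1_no_zero_divisors
proof
  fix P Q :: diffop
  assume "P \<noteq> 0" "Q \<noteq> 0"
  thus "P * Q \<noteq> 0" using op_lead_mult[of P Q] by (metis mult_eq_0_iff op_lead_eq_0_iff)
qed

lemma op_lead_1 [simp]: "op_lead 1 = 1"
  by (simp add: op_lead_def op_coeff_def op_order_def)

lemma op_order_1 [simp]: "op_order 1 = 0"
  by (simp add: op_order_def)

lemma op_order_power: "P \<noteq> 0 \<Longrightarrow> op_order (P ^ n) = n * op_order P"
  by (induction n) (simp_all add: op_order_mult)

lemma op_lead_power: "op_lead (P ^ n) = op_lead P ^ n"
  by (induction n) (simp_all add: op_lead_mult)

lemma op_order_add_less:
  assumes "op_order Q < op_order P"
  shows "op_order (P + Q) = op_order P" "op_lead (P + Q) = op_lead P"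
  using assms
  by (simp_all add: op_order_def op_lead_def op_coeff_def degree_add_eq_left coeff_eq_0)

lemma op_order_uminus [simp]: "op_order (- P) = op_order P"
  by (simp add: op_order_def)

lemma op_lead_uminus [simp]: "op_lead (- P) = - op_lead P"
  by (simp add: op_lead_def op_order_def)

lemma op_order_diff_less:
  assumes "op_order Q < op_order P"
  shows "op_order (P - Q) = op_order P" "op_lead (P - Q) = op_lead P"
  using op_order_add_less[of "- Q" P] assms by simp_all

lemma op_order_add_le: "op_order P \<le> n \<Longrightarrow> op_order Q \<le> n \<Longrightarrow> op_order (P + Q) \<le> n"
  by (simp add: op_order_def degree_add_le)

subsection \<open>Scalars and polynomials in an operator\<close>

lemma op_const_mult_left: "op_const c * P = Diffop (smult [:c:] (op_poly P))"
  by (rule diffop.expand) (simp add: symbol_comp_pCons)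

text \<open>Constants are annihilated by \<open>pderiv\<close>, so \<open>deriv_comp\<close> is
  linear over them; hence they are central.\<close>

lemma op_const_commute: "P * op_const c = op_const c * P"
proof -
  have "(deriv_comp ^^ i) (smult [:c:] q) = smult [:c:] ((deriv_comp ^^ i) q)" for i q
    by (induction i) (simp_all add: deriv_comp_smult pderiv_pCons)
  hence "symbol_comp p (smult [:c:] q) = smult [:c:] (symbol_comp p q)" for p q
    unfolding symbol_comp_def by (intro poly_eqI) (simp add: coeff_sum sum_distrib_left mult_ac)
  from this[of _ 1] show ?thesis
    by (intro diffop.expand) (simp add: op_const_mult_left symbol_comp_1_right)
qed

lemma op_const_left_commute: "P * (op_const c * Q) = op_const c * (P * Q)"
  by (metis mult.assoc op_const_commute)

lemma op_const_0 [simp]: "op_const 0 = 0"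
  and op_const_1 [simp]: "op_const 1 = 1"
  by (rule diffop.expand; simp add: one_pCons)+

lemma op_const_add: "op_const (c + d) = op_const c + op_const d"
  and op_const_uminus: "op_const (- c) = - op_const c"
  and op_const_mult: "op_const (c * d) = op_const c * op_const d"
  by (rule diffop.expand; simp add: symbol_comp_pCons)+

lemma op_const_of_nat: "op_const (of_nat n) = of_nat n"
  by (induction n) (simp_all add: op_const_add)

lemma op_const_numeral: "op_const (numeral n) = numeral n"
  using op_const_of_nat[of "numeral n"] by simp

lemma op_const_eq_0_iff [simp]: "op_const c = 0 \<longleftrightarrow> c = 0"
  by (metis op_poly_const op_poly_eq_0_iff pCons_eq_0_iff)

lemma op_const_power_mult: "(op_const c * P) ^ n = op_const (c ^ n) * P ^ n"
  by (induction n) (simp_all add: op_const_mult mult.assoc op_const_left_commute[of P])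

lemma op_order_const [simp]: "op_order (op_const c) = 0"
  by (simp add: op_order_def)

lemma op_lead_const [simp]: "op_lead (op_const c) = [:c:]"
  by (simp add: op_lead_def op_coeff_def op_order_def)

lemma op_coeff_const_mult [simp]: "op_coeff (op_const c * P) i = smult c (op_coeff P i)"
  by (simp add: op_const_mult_left op_coeff_def)

lemma poly_at_op_altdef:
  "degree p \<le> n \<Longrightarrow> poly_at_op p P = (\<Sum>i\<le>n. op_const (coeff p i) * P ^ i)"
  unfolding poly_at_op_def by (rule sum.mono_neutral_left) (auto simp: coeff_eq_0)

lemma poly_at_op_0 [simp]: "poly_at_op 0 P = 0"
  by (simp add: poly_at_op_def)

lemma poly_at_op_pCons: "poly_at_op (pCons c p) P = op_const c + P * poly_at_op p P"
proof -
  have "poly_at_op (pCons c p) P = (\<Sum>i\<le>Suc (degree p). op_const (coeff (pCons c p) i) * P ^ i)"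
    by (rule poly_at_op_altdef) (rule degree_pCons_le)
  thus ?thesis
    by (subst (asm) sum.atMost_Suc_shift)
       (simp add: poly_at_op_def sum_distrib_left op_const_left_commute)
qed

lemma poly_at_op_const [simp]: "poly_at_op [:c:] P = op_const c"
  by (simp add: poly_at_op_pCons)

lemma poly_at_op_1 [simp]: "poly_at_op 1 P = 1"
  by (simp add: one_pCons)

lemma poly_at_op_add: "poly_at_op (p + q) P = poly_at_op p P + poly_at_op q P"
proof (induction p q rule: poly_induct2)
  case (pCons a p b q)
  thus ?case by (simp add: poly_at_op_pCons op_const_add algebra_simps)
qed simp

lemma poly_at_op_uminus: "poly_at_op (- p) P = - poly_at_op p P"
  using poly_at_op_add[of p "- p" P] by (simp add: eq_neg_iff_add_eq_0 add.commute)

lemma poly_at_op_diff: "poly_at_op (p - q) P = poly_at_op p P - poly_at_op q P"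
  using poly_at_op_add[of p "- q" P] by (simp add: poly_at_op_uminus)

lemma poly_at_op_smult: "poly_at_op (smult c p) P = op_const c * poly_at_op p P"
  by (induction p) (simp_all add: poly_at_op_pCons op_const_mult op_const_left_commute distrib_left)

lemma poly_at_op_mult: "poly_at_op (p * q) P = poly_at_op p P * poly_at_op q P"
  by (induction p)
     (simp_all add: poly_at_op_pCons poly_at_op_add poly_at_op_smult distrib_right mult.assoc)

lemma poly_at_op_power: "poly_at_op (p ^ n) P = poly_at_op p P ^ n"
  by (induction n) (simp_all add: poly_at_op_mult)

lemma op_order_poly_at_op:
  assumes "op_order P > 0" "p \<noteq> 0"
  shows "op_order (poly_at_op p P) = degree p * op_order P"
    and "op_lead (poly_at_op p P) = smult (lead_coeff p) (op_lead P ^ degree p)"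
proof -
  have P: "P \<noteq> 0" using assms(1) by auto
  have "op_order (poly_at_op p P) = degree p * op_order P \<and>
     op_lead (poly_at_op p P) = smult (lead_coeff p) (op_lead P ^ degree p)"
    using assms(2)
  proof (induction p)
    case (pCons c p)
    show ?case
    proof (cases "p = 0")
      case False
      hence *: "op_order (poly_at_op p P) = degree p * op_order P"
        "op_lead (poly_at_op p P) = smult (lead_coeff p) (op_lead P ^ degree p)"
        using pCons by auto
      hence nz: "poly_at_op p P \<noteq> 0"
        using False P by (metis leading_coeff_0_iff op_lead_eq_0_iff power_not_zero smult_eq_0_iff)
      have "op_order (P * poly_at_op p P) > 0"
        using assms(1) by (simp add: op_order_mult P nz)
      hence "op_order (P * poly_at_op p P + op_const c) = op_order (P * poly_at_op p P) \<and>
         op_lead (P * poly_at_op p P + op_const c) = op_lead (P * poly_at_op p P)"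
        using op_order_add_less[of "op_const c" "P * poly_at_op p P"] by simp
      thus ?thesis
        using False by (simp add: poly_at_op_pCons add.commute[of "op_const c"] op_order_mult P nz op_lead_mult *)
    qed (use pCons in auto)
  qed simp
  thus "op_order (poly_at_op p P) = degree p * op_order P"
    and "op_lead (poly_at_op p P) = smult (lead_coeff p) (op_lead P ^ degree p)" by auto
qed

lemma op_order_d [simp]: "op_order op_d = 1"
  and op_lead_d [simp]: "op_lead op_d = 1"
  by (simp_all add: op_order_def op_lead_def op_coeff_def op_d_def)

lemma op_d_op_x: "op_d * op_x = op_x * op_d + 1"
  by (rule diffop.expand) (simp add: op_d_def op_x_def op_mult_def symbol_comp_pCons deriv_comp_def one_pCons pderiv_pCons map_poly_pCons)

lemma op_d_power: "op_d ^ j = Diffop (monom 1 j)"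
proof (induction j)
  case (Suc j)
  thus ?case by (intro diffop.expand)
      (simp add: symbol_comp_pCons op_d_def deriv_comp_def map_poly_monom monom_Suc)
qed (simp add: one_diffop_def)

subsection \<open>A square root of a polynomial in \<open>L\<close>\<close>

text \<open>The commutation rules of \<open>x = cosh s\<close>, \<open>K = sinh s d/ds\<close> and
  \<open>H = (d/ds)\<^sup>2 + \<alpha> x + \<beta>\<close>, with \<open>\<delta> = d/dx\<close>. Neither \<open>sinh s\<close> nor \<open>d/ds\<close> alone occurs, because
  in the application to \<open>x = T\<^sub>r(y)\<close> they have no polynomial coefficients.\<close>

locale cosh_operators =
  fixes \<delta> :: "'b::comm_ring_1 \<Rightarrow> 'b" and x \<alpha> \<beta> :: 'b and f :: "'b \<Rightarrow> 'a::ring_1" and H K :: 'a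
  assumes \<delta>_add [simp]: "\<delta> (p + q) = \<delta> p + \<delta> q"
    and \<delta>_mult [simp]: "\<delta> (p * q) = \<delta> p * q + p * \<delta> q"
    and \<delta>_x [simp]: "\<delta> x = 1" and \<delta>_\<alpha> [simp]: "\<delta> \<alpha> = 0" and \<delta>_\<beta> [simp]: "\<delta> \<beta> = 0"
    and f_add: "f (p + q) = f p + f q"
    and f_mult: "f (p * q) = f p * f q"
    and f_1 [simp]: "f 1 = 1"
    and K_f: "K * f p = f p * K + f ((x\<^sup>2 - 1) * \<delta> p)"
    and H_f: "H * f p = f p * H + 2 * f (\<delta> p) * K + f ((x\<^sup>2 - 1) * \<delta> (\<delta> p) + x * \<delta> p)"
    and H_K: "H * K = K * H + 2 * f x * H + K - f (2 * x * (\<alpha> * x + \<beta>) + \<alpha> * (x\<^sup>2 - 1))"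
    and K_K: "K * K = f (x\<^sup>2 - 1) * H + f x * K - f ((x\<^sup>2 - 1) * (\<alpha> * x + \<beta>))"
begin

lemma \<delta>_0 [simp]: "\<delta> 0 = 0"
  using \<delta>_add[of 0 0] by simp

lemma \<delta>_1 [simp]: "\<delta> 1 = 0"
  using \<delta>_mult[of 1 1] by simp

lemma \<delta>_uminus [simp]: "\<delta> (- p) = - \<delta> p"
  using \<delta>_add[of p "- p"] by (simp add: eq_neg_iff_add_eq_0 add.commute)

lemma \<delta>_diff [simp]: "\<delta> (p - q) = \<delta> p - \<delta> q"
  using \<delta>_add[of p "- q"] by simp

lemma \<delta>_numeral [simp]: "\<delta> (numeral n) = 0"
proof -
  have "\<delta> (of_nat n) = 0" for n by (induction n) auto
  from this[of "numeral n"] show ?thesis by simp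
qed

lemma \<delta>_power2 [simp]: "\<delta> (p\<^sup>2) = 2 * p * \<delta> p"
  by (simp add: power2_eq_square algebra_simps)

lemma f_0 [simp]: "f 0 = 0"
  using f_add[of 0 0] by simp

lemma f_uminus: "f (- p) = - f p"
  using f_add[of p "- p"] by (simp add: eq_neg_iff_add_eq_0 add.commute)

lemma f_diff: "f (p - q) = f p - f q"
  using f_add[of p "- q"] by (simp add: f_uminus)

lemma f_numeral: "f (numeral n) = numeral n"
proof -
  have "f (of_nat n) = of_nat n" for n by (induction n) (auto simp: f_add)
  from this[of "numeral n"] show ?thesis by simp
qed

section \<open>Normal forms in the algebra generated by \<open>f\<close>, \<open>K\<close> and
  \<open>H\<close>\<close>

abbreviation s2 :: 'b where "s2 \<equiv> x\<^sup>2 - 1"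
abbreviation v :: 'b where "v \<equiv> \<alpha> * x + \<beta>"
text \<open>With \<open>x = cosh s\<close>, \<open>\<tau> u\<close> is the
  \<open>s\<close>-derivative of \<open>sinh s\<close> times \<open>u\<close>, and
  \<open>\<theta> u\<close> is the second \<open>s\<close>-derivative of \<open>u\<close>. Both are
  again functions of \<open>x\<close>, although a single \<open>s\<close>-derivative of
  \<open>u\<close> is not.\<close>

definition \<tau> :: "'b \<Rightarrow> 'b" where "\<tau> u = s2 * \<delta> u + x * u"
definition \<theta> :: "'b \<Rightarrow> 'b" where "\<theta> u = \<tau> (\<delta> u)"

text \<open>The commutator and product formulas below can be written over these six monomials with
  coefficients from \<open>f\<close> on the left. Each then reduces, by \<open>nf_cong\<close>, to
  six identities in a commutative ring.\<close>

definition nf :: "'b \<Rightarrow> 'b \<Rightarrow> 'b \<Rightarrow> 'b \<Rightarrow> 'b \<Rightarrow> 'b \<Rightarrow> 'a" where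
  "nf a b c d e k = f a + f b * K + f c * H + f d * (K * H) + f e * (H * H) + f k * (K * (H * H))"

lemma f_commute: "f p * f q = f q * f p"
  by (metis f_mult mult.commute)

lemma f_left_commute: "f p * (f q * z) = f q * (f p * z)"
  by (metis f_commute mult.assoc)

lemma f_numeral_commute: "f p * numeral n = numeral n * f p"
  by (metis f_commute f_numeral)

lemma f_numeral_left_commute: "f p * (numeral n * z) = numeral n * (f p * z)"
  by (metis f_numeral_commute mult.assoc)

lemmas f_simps = f_numeral_commute f_numeral_left_commute f_add f_diff f_mult f_uminus f_numeral power2_eq_square f_commute f_left_commute

lemma nf_add: "nf a b c d e k + nf a' b' c' d' e' k' = nf (a+a') (b+b') (c+c') (d+d') (e+e') (k+k')"
  by (simp add: nf_def f_add algebra_simps)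

lemma nf_diff: "nf a b c d e k - nf a' b' c' d' e' k' = nf (a-a') (b-b') (c-c') (d-d') (e-e') (k-k')"
  by (simp add: nf_def f_diff algebra_simps)

lemma f_nf: "f p * nf a b c d e k = nf (p*a) (p*b) (p*c) (p*d) (p*e) (p*k)"
  by (simp add: nf_def f_mult distrib_left mult.assoc)

lemma H_f': "H * (f p * z) = f p * (H * z) + f (2 * \<delta> p) * (K * z) + f (\<theta> p) * z"
  by (simp add: mult.assoc[symmetric] H_f \<theta>_def \<tau>_def f_mult f_numeral distrib_right)

lemma K_f': "K * (f p * z) = f p * (K * z) + f (s2 * \<delta> p) * z"
  by (simp add: mult.assoc[symmetric] K_f distrib_right)

lemma K_K': "K * (K * z) = f s2 * (H * z) + f x * (K * z) - f (s2 * v) * z"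
  using arg_cong[OF K_K, of "\<lambda>y. y * z"] by (simp add: mult.assoc distrib_right left_diff_distrib)

lemma H_K': "H * (K * z) = K * (H * z) + f (2 * x) * (H * z) + K * z - f (2 * x * v + \<alpha> * s2) * z"
  using arg_cong[OF H_K, of "\<lambda>y. y * z"]
  by (simp add: mult.assoc distrib_right left_diff_distrib f_mult[of 2] f_numeral)

text \<open>The last slot is zero because \<open>K * (K * (H * H))\<close> would produce a cube of
  \<open>H\<close>, for which there is no slot. \<open>H_nf\<close> has two zero slots for the same
  reason.\<close>

lemma K_nf: "K * nf a b c d e 0 =
  nf (s2 * \<delta> a - b * s2 * v) (a + s2 * \<delta> b + b * x) (s2 * \<delta> c + b * s2 - d * s2 * v)
    (c + s2 * \<delta> d + d * x) (s2 * \<delta> e + d * s2) e"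
proof -
  have "K * nf a b c d e 0 = (f a * K + f (s2 * \<delta> a))
    + (f b * (f s2 * H + f x * K - f (s2 * v)) + f (s2 * \<delta> b) * K)
    + (f c * (K * H) + f (s2 * \<delta> c) * H)
    + (f d * (f s2 * (H * H) + f x * (K * H) - f (s2 * v) * H) + f (s2 * \<delta> d) * (K * H))
    + (f e * (K * (H * H)) + f (s2 * \<delta> e) * (H * H))"
    unfolding nf_def by (simp add: distrib_left K_f' K_K' K_f K_K)
  thus ?thesis
    unfolding nf_def by (simp add: f_simps algebra_simps)
qed

lemma H_nf: "H * nf a b c d 0 0 =
  nf (\<theta> a - 2 * \<delta> b * s2 * v - b * (2 * x * v + \<alpha> * s2)) (2 * \<delta> a + \<theta> b + 2 * \<delta> b * x + b)
    (a + \<theta> c + 2 * \<delta> b * s2 + 2 * b * x - 2 * \<delta> d * s2 * v - d * (2 * x * v + \<alpha> * s2))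
    (b + 2 * \<delta> c + \<theta> d + 2 * \<delta> d * x + d) (c + 2 * \<delta> d * s2 + 2 * d * x) d"
proof -
  have Hf: "H * f p = f p * H + f (2 * \<delta> p) * K + f (\<theta> p)" for p
    using H_f'[of p 1] by simp
  have HK: "H * K = K * H + f (2 * x) * H + K - f (2 * x * v + \<alpha> * s2)"
    using H_K'[of 1] by simp
  have "H * nf a b c d 0 0 = (f a * H + f (2 * \<delta> a) * K + f (\<theta> a))
    + (f b * (K * H + f (2 * x) * H + K - f (2 * x * v + \<alpha> * s2)) +
       f (2 * \<delta> b) * (f s2 * H + f x * K - f (s2 * v)) + f (\<theta> b) * K)
    + (f c * (H * H) + f (2 * \<delta> c) * (K * H) + f (\<theta> c) * H)
    + (f d * (K * (H * H) + f (2 * x) * (H * H) + K * H - f (2 * x * v + \<alpha> * s2) * H) +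
       f (2 * \<delta> d) * (f s2 * (H * H) + f x * (K * H) - f (s2 * v) * H) + f (\<theta> d) * (K * H))"
    unfolding nf_def by (simp only: distrib_left H_f' Hf HK H_K' K_K' K_K f_0 mult_zero_right mult_zero_left add_0_right)
  thus ?thesis
    unfolding nf_def by (simp add: f_simps algebra_simps)
qed

lemma nf_H: "nf a b c d 0 0 * H = nf 0 0 a b c d"
  by (simp add: nf_def distrib_right mult.assoc)

section \<open>The operators \<open>P q\<close> and their commutators with \<open>L\<close>\<close>

definition w :: "'b \<Rightarrow> 'b" where "w \<gamma> = \<alpha> * \<gamma> * x"

text \<open>\<open>P q\<close> is \<open>2 (q H - q' d/ds + q''/2)\<close>, primes denoting derivatives with respect to \<open>s\<close>.\<close>

definition P :: "'b \<Rightarrow> 'a" where "P q = nf (\<theta> q) (- 2 * \<delta> q) (2 * q) 0 0 0"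

text \<open>For \<open>p = sinh s * u\<close> this is \<open>2 p d/ds + p'\<close>, with the
  derivative taken in \<open>s\<close>. Up to right multiplication by \<open>L\<close>, such terms
  are all that the commutator of \<open>L\<close> with \<open>P q\<close> leaves.\<close>

definition R :: "'b \<Rightarrow> 'a" where "R u = nf (\<tau> u) (2 * u) 0 0 0 0"

text \<open>In terms of \<open>s\<close> this is \<open>q'''' + 4 V q'' + 2 V' q'\<close>. It is the
  coefficient of 1 in the normal form of the commutator of \<open>H\<close> and
  \<open>P q\<close>.\<close>

definition h :: "'b \<Rightarrow> 'b" where
  "h q = \<theta> (\<theta> q) + 4 * v * \<theta> q + 2 * \<alpha> * s2 * \<delta> q"

text \<open>Multiplied by \<open>sinh s\<close>, this is the part of the fifth-order equation that
  does not involve \<open>z\<close>, with \<open>W = w \<gamma>\<close>; the part with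
  \<open>z\<close> is \<open>4 z q'\<close>. Having divided by \<open>sinh s\<close>, one works with
  functions of \<open>x\<close> alone.\<close>

definition \<epsilon> :: "'b \<Rightarrow> 'b \<Rightarrow> 'b" where
  "\<epsilon> \<gamma> q = \<delta> (h q) - 4 * w \<gamma> * \<delta> q - 2 * q * \<alpha> * \<gamma>"

lemma \<tau>_add: "\<tau> (p + q) = \<tau> p + \<tau> q"
  by (simp add: \<tau>_def algebra_simps)

lemma \<epsilon>_add: "\<epsilon> \<gamma> (p + q) = \<epsilon> \<gamma> p + \<epsilon> \<gamma> q"
  by (simp add: \<epsilon>_def h_def \<theta>_def \<tau>_add algebra_simps)

lemma \<epsilon>_0 [simp]: "\<epsilon> \<gamma> 0 = 0"
  using \<epsilon>_add[of \<gamma> 0 0] by simp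

lemma \<epsilon>_uminus: "\<epsilon> \<gamma> (- p) = - \<epsilon> \<gamma> p"
  using \<epsilon>_add[of \<gamma> p "- p"] by (simp add: eq_neg_iff_add_eq_0 add.commute)

definition L :: "'b \<Rightarrow> 'a" where "L \<gamma> = H * H + f (w \<gamma>)"

text \<open>The symmetric bilinear first integral of the equation
  \<open>\<epsilon> \<gamma> q = 0\<close>, as \<open>\<delta>_G\<close> shows. It arises as the
  term free of \<open>L\<close> in the symmetrized product of \<open>P p\<close> and
  \<open>P q\<close>.\<close>

definition G :: "'b \<Rightarrow> 'b \<Rightarrow> 'b \<Rightarrow> 'b" where
  "G \<gamma> p q = - 8 * w \<gamma> * p * q - 8 * v * s2 * \<delta> p * \<delta> q + 2 * \<theta> p * \<theta> q
     - 2 * s2 * (\<delta> p * \<delta> (\<theta> q) + \<delta> q * \<delta> (\<theta> p))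
     + 2 * p * (2 * \<alpha> * s2 * \<delta> q + 4 * v * \<theta> q + \<theta> (\<theta> q))
     + 2 * q * (2 * \<alpha> * s2 * \<delta> p + 4 * v * \<theta> p + \<theta> (\<theta> p))"

lemma nf_cong: "a = a' \<Longrightarrow> b = b' \<Longrightarrow> c = c' \<Longrightarrow> d = d' \<Longrightarrow> e = e' \<Longrightarrow> k = k' \<Longrightarrow>
  nf a b c d e k = nf a' b' c' d' e' k'"
  by simp

lemma H_commutator_P:
  "H * P q - P q * H = nf (h q) 0 (- 2 * \<theta> q) (4 * \<delta> q) 0 0"
  unfolding P_def H_nf nf_H nf_diff
  by (rule nf_cong) (simp_all add: h_def \<theta>_def \<tau>_def power2_eq_square algebra_simps)

text \<open>The factor \<open>L \<gamma>\<close> is split off on the right so that the commutator of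
  \<open>L\<close> with the sum of the \<open>P (q j) * L ^ j\<close> telescopes, provided that
  \<open>\<epsilon>\<close> of each coefficient cancels \<open>4 * \<delta>\<close> of its
  predecessor.\<close>

lemma L_commutator_P:
  assumes [simp]: "\<delta> \<gamma> = 0"
  shows "L \<gamma> * P q - P q * L \<gamma> = R (4 * \<delta> q) * L \<gamma> + R (\<epsilon> \<gamma> q)"
proof -
  have fN: "nf a b c 0 0 0 * f p = nf (a * p + b * (s2 * \<delta> p) + c * \<theta> p) (b * p + c * (2 * \<delta> p)) (c * p) 0 0 0" for a b c p
  proof -
    have "nf a b c 0 0 0 * f p = f a * f p + f b * (f p * K + f (s2 * \<delta> p)) + f c * (f p * H + f (2 * \<delta> p) * K + f (\<theta> p))"
      using H_f'[of p 1] by (simp add: nf_def distrib_right mult.assoc K_f)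
    thus ?thesis unfolding nf_def by (simp add: f_simps algebra_simps)
  qed
  \<comment> \<open>The commutator of \<open>H * H\<close> with \<open>P q\<close> is
    \<open>H * D + D * H\<close>, and both products fit the normal form. Expanding
    \<open>H * H * P q\<close> itself would require a cube of \<open>H\<close>.\<close>
  define D where "D = nf (h q) 0 (- 2 * \<theta> q) (4 * \<delta> q) 0 0"
  have HP: "H * P q = P q * H + D"
    using H_commutator_P[of q] by (simp add: D_def algebra_simps)
  have "H * H * P q = H * (P q * H) + H * D"
    by (simp add: HP mult.assoc distrib_left)
  also have "H * (P q * H) = P q * H * H + D * H"
    by (simp add: HP mult.assoc[symmetric] distrib_right)
  finally have "L \<gamma> * P q - P q * L \<gamma> = D * H + H * D + (f (w \<gamma>) * P q - P q * f (w \<gamma>))"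
    by (simp add: L_def algebra_simps)
  moreover have "R (4 * \<delta> q) * L \<gamma> = R (4 * \<delta> q) * H * H + R (4 * \<delta> q) * f (w \<gamma>)"
    by (simp add: L_def algebra_simps)
  ultimately show ?thesis
    unfolding D_def H_nf nf_H P_def R_def f_nf fN nf_diff nf_add
    apply (elim ssubst)
    unfolding nf_H nf_add
    apply (rule nf_cong)
    apply (simp_all add: \<epsilon>_def h_def w_def \<theta>_def \<tau>_def power2_eq_square algebra_simps)
    done
qed

text \<open>In the product of \<open>P p\<close> and \<open>P q\<close> the coefficients of
  \<open>K\<close>, \<open>H\<close>, \<open>K * H\<close> and \<open>K * (H * H)\<close> are
  antisymmetric in \<open>p\<close> and \<open>q\<close>, so symmetrization leaves only 1 and
  \<open>H * H\<close>, which combine to \<open>L\<close>.\<close>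

lemma P_P_symmetrized:
  "P p * P q + P q * P p = 8 * f (p * q) * L \<gamma> + f (G \<gamma> p q)"
proof -
  have PP: "P p * P q = f (\<theta> p) * P q + f (- 2 * \<delta> p) * (K * P q) + f (2 * p) * (H * P q)" for p q
    unfolding P_def[of p] by (simp add: nf_def distrib_right mult.assoc)
  have "8 * f (p * q) * L \<gamma> + f (G \<gamma> p q) = nf (8 * p * q * w \<gamma> + G \<gamma> p q) 0 0 0 (8 * p * q) 0"
    by (simp add: nf_def L_def f_simps algebra_simps)
  thus ?thesis
    unfolding PP[of p q] PP[of q p]
    unfolding P_def K_nf H_nf f_nf nf_diff nf_add
    apply (elim ssubst)
    apply (rule nf_cong)
    apply (simp_all add: G_def w_def \<theta>_def \<tau>_def power2_eq_square algebra_simps)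
    done
qed

lemma \<delta>_G:
  assumes [simp]: "\<delta> \<gamma> = 0"
  shows "\<delta> (G \<gamma> p q) = 2 * p * \<epsilon> \<gamma> q + 2 * q * \<epsilon> \<gamma> p"
  by (simp add: G_def \<epsilon>_def h_def w_def \<theta>_def \<tau>_def power2_eq_square algebra_simps)

lemma R_uminus: "R (- u) = - R u"
  using nf_diff[of 0 0 0 0 0 0 "\<tau> u" "2 * u" 0 0 0 0] by (simp add: R_def nf_def \<tau>_def f_uminus algebra_simps)

lemma R_0: "R 0 = 0"
  by (simp add: R_def nf_def \<tau>_def)

lemma G_0: "G \<gamma> 0 q = 0" "G \<gamma> p 0 = 0"
  by (simp_all add: G_def \<tau>_def \<theta>_def)

lemma \<delta>_sum: "\<delta> (sum F A) = (\<Sum>a\<in>A. \<delta> (F a))"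
  by (induction A rule: infinite_finite_induct) auto

lemma f_sum: "f (sum F A) = (\<Sum>a\<in>A. f (F a))"
  by (induction A rule: infinite_finite_induct) (auto simp: f_add)

section \<open>The operator \<open>M\<close> built from the coefficients \<open>q j\<close> of a
  solution of the fifth-order equation\<close>

context
  fixes \<gamma> :: 'b and q :: "nat \<Rightarrow> 'b" and g :: nat
  assumes \<gamma> [simp]: "\<delta> \<gamma> = 0"
    and q_0: "\<epsilon> \<gamma> (q 0) = 0"
    and q_Suc: "\<And>j. \<epsilon> \<gamma> (q (Suc j)) = - 4 * \<delta> (q j)"
    and q_g: "\<delta> (q g) = 0"
    and q_gt: "\<And>j. j > g \<Longrightarrow> q j = 0"
begin

definition M :: 'a where "M = (\<Sum>j\<le>g. P (q j) * L \<gamma> ^ j)"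

text \<open>The coefficient of \<open>L ^ k\<close> in \<open>2 * (M * M)\<close>. The first sum is
  shifted by one because \<open>8 * f (p * q)\<close> carries a factor \<open>L\<close> in
  \<open>P_P_symmetrized\<close>.\<close>

definition \<phi> :: "nat \<Rightarrow> 'b" where
  "\<phi> k = (case k of 0 \<Rightarrow> 0 | Suc m \<Rightarrow> 8 * (\<Sum>i\<le>m. q i * q (m - i))) + (\<Sum>i\<le>k. G \<gamma> (q i) (q (k - i)))"

lemma L_M_commute: "L \<gamma> * M = M * L \<gamma>"
proof -
  let ?L = "L \<gamma>"
  have "?L * M - M * ?L = (\<Sum>j\<le>g. (?L * P (q j) - P (q j) * ?L) * ?L ^ j)"
    by (simp add: M_def sum_distrib_left sum_distrib_right sum_subtractf left_diff_distrib
          mult.assoc power_commutes)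
  \<comment> \<open>By the recursion the remainder \<open>R (\<epsilon> \<gamma> (q j))\<close>
    cancels the first term of the preceding summand. What survives is the last term, which vanishes
    with \<open>\<delta> (q g)\<close>.\<close>
  also have "\<dots> = (\<Sum>j\<le>g. R (4 * \<delta> (q j)) * ?L ^ Suc j - (case j of 0 \<Rightarrow> 0 | Suc i \<Rightarrow> R (4 * \<delta> (q i)) * ?L ^ j))"
    by (intro sum.cong refl, subst L_commutator_P)
       (auto simp: q_0 q_Suc R_0 R_uminus distrib_right mult.assoc split: nat.split)
  also have "\<dots> = R (4 * \<delta> (q g)) * ?L ^ Suc g"
    by (induction g) simp_all
  finally show ?thesis
    by (simp add: q_g R_0)
qed

text \<open>The recursion turns the derivative of the \<open>G\<close> part into
  \<open>- 16 * T\<close>, while the shifted products contribute \<open>8 * (2 * T)\<close>.\<close>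

lemma \<delta>_\<phi>: "\<delta> (\<phi> k) = 0"
proof (cases k)
  case 0
  thus ?thesis by (simp add: \<phi>_def \<delta>_G q_0)
next
  case (Suc m)
  define T where "T = (\<Sum>i\<le>m. q i * \<delta> (q (m - i)))"
  have T': "T = (\<Sum>i\<le>m. \<delta> (q i) * q (m - i))"
    unfolding T_def by (rule sum.reindex_bij_witness[of _ "\<lambda>i. m - i" "\<lambda>i. m - i"]) (auto simp: mult.commute)
  have "(\<Sum>i\<le>Suc m. q i * \<epsilon> \<gamma> (q (Suc m - i))) = - 4 * T"
    by (simp add: q_0 T_def sum_distrib_left Suc_diff_le q_Suc sum_negf algebra_simps)
  moreover have "(\<Sum>i\<le>Suc m. q (Suc m - i) * \<epsilon> \<gamma> (q i)) = (\<Sum>i\<le>Suc m. q i * \<epsilon> \<gamma> (q (Suc m - i)))"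
    by (rule sum.reindex_bij_witness[of _ "\<lambda>i. Suc m - i" "\<lambda>i. Suc m - i"]) auto
  ultimately have "\<delta> (\<Sum>i\<le>Suc m. G \<gamma> (q i) (q (Suc m - i))) = - 16 * T"
    by (simp only: \<delta>_sum \<delta>_G \<gamma> mult.assoc sum.distrib sum_distrib_left[symmetric]) simp
  moreover have "\<delta> (\<Sum>i\<le>m. q i * q (m - i)) = 2 * T"
    by (simp add: \<delta>_sum sum.distrib T_def[symmetric] T'[symmetric])
  ultimately show ?thesis
    by (simp add: \<phi>_def Suc)
qed

text \<open>Of two indices with sum \<open>2 * g + 1\<close> one exceeds \<open>g\<close>, so all
  \<open>G\<close> terms vanish; among the products with index sum \<open>2 * g\<close> only the
  square of \<open>q g\<close> survives.\<close>

lemma \<phi>_lead: "\<phi> (2 * g + 1) = 8 * (q g)\<^sup>2"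
proof -
  have "q i = 0 \<or> q (2 * g + 1 - i) = 0" for i
    using q_gt[of i] q_gt[of "2 * g + 1 - i"] by (cases "i \<le> g") auto
  hence "G \<gamma> (q i) (q (2 * g + 1 - i)) = 0" for i
    using G_0 by metis
  moreover have "q i * q (2 * g - i) = (if i = g then (q g)\<^sup>2 else 0)" for i
    using q_gt[of i] q_gt[of "2 * g - i"]
    by (cases i g rule: linorder_cases) (auto simp: power2_eq_square mult_2)
  ultimately show ?thesis
    by (simp add: \<phi>_def)
qed

lemma M_square: "2 * (M * M) = (\<Sum>k\<le>2 * g + 1. f (\<phi> k) * L \<gamma> ^ k)"
proof -
  let ?L = "L \<gamma>"
  have comm: "?L ^ i * M = M * ?L ^ i" for i
    by (induction i) (simp_all add: mult.assoc L_M_commute, simp add: mult.assoc[symmetric] L_M_commute)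
  define t where "t i j = P (q i) * P (q j) * ?L ^ (i + j)" for i j
  \<comment> \<open>A power of \<open>L\<close> need not commute with a single
    \<open>P (q i)\<close>, so it is moved past the whole of \<open>M\<close> before the remaining
    \<open>M\<close> is expanded.\<close>
  have "M * M = (\<Sum>i\<le>g. P (q i) * M * ?L ^ i)"
    unfolding M_def[of ] sum_distrib_right
    by (intro sum.cong refl) (simp add: mult.assoc comm[unfolded M_def])
  also have "\<dots> = (\<Sum>i\<le>g. \<Sum>j\<le>g. t i j)"
    by (simp add: M_def t_def sum_distrib_left sum_distrib_right mult.assoc power_add[symmetric] add.commute)
  finally have MM: "M * M = (\<Sum>i\<le>g. \<Sum>j\<le>g. t i j)" .
  have "2 * (M * M) = M * M + M * M" by (simp add: mult_2)
  also have "\<dots> = (\<Sum>i\<le>g. \<Sum>j\<le>g. t i j + t j i)"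
    using sum.swap[of t "{..g}" "{..g}"] by (simp add: MM sum.distrib)
  also have "\<dots> = (\<Sum>i\<le>g. \<Sum>j\<le>g. 8 * f (q i * q j) * ?L ^ Suc (i + j) + f (G \<gamma> (q i) (q j)) * ?L ^ (i + j))"
  proof (intro sum.cong refl)
    fix i j
    have "t i j + t j i = (P (q i) * P (q j) + P (q j) * P (q i)) * ?L ^ (i + j)"
      by (simp add: t_def distrib_right add.commute)
    also have "\<dots> = 8 * f (q i * q j) * ?L ^ Suc (i + j) + f (G \<gamma> (q i) (q j)) * ?L ^ (i + j)"
      unfolding P_P_symmetrized[of _ _ \<gamma>] by (simp add: distrib_right mult.assoc)
    finally show "t i j + t j i = \<dots>" .
  qed
  finally have *: "2 * (M * M) = (\<Sum>i\<le>g. \<Sum>j\<le>g. 8 * f (q i * q j) * ?L ^ Suc (i + j) + f (G \<gamma> (q i) (q j)) * ?L ^ (i + j))" .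
  \<comment> \<open>The square of index pairs lies inside a triangle and the additional pairs
    contribute zero, so the double sum can be ordered by the exponent of \<open>L\<close>.\<close>
  have regroup: "(\<Sum>i\<le>g. \<Sum>j\<le>g. F i j) = (\<Sum>k\<le>n. \<Sum>i\<le>k. F i (k - i))"
    if "\<And>i j. i > g \<or> j > g \<Longrightarrow> F i j = 0" "n \<ge> 2 * g" for F :: "nat \<Rightarrow> nat \<Rightarrow> 'a" and n
  proof -
    have "(\<Sum>k\<le>n. \<Sum>i\<le>k. F i (k - i)) = (\<Sum>(i, j)\<in>{(i, j). i + j \<le> n}. F i j)"
      by (rule sum.triangle_reindex_eq[symmetric])
    also have "\<dots> = (\<Sum>(i, j)\<in>{..g} \<times> {..g}. F i j)"
    proof (rule sum.mono_neutral_right)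
      show "finite {(i, j). i + j \<le> n}"
        by (rule finite_subset[of _ "{..n} \<times> {..n}"]) auto
    qed (use that in auto, (meson leI that(1))+)
    finally show ?thesis by (simp add: sum.cartesian_product)
  qed
  have "(\<Sum>i\<le>g. \<Sum>j\<le>g. 8 * f (q i * q j) * ?L ^ Suc (i + j)) = (\<Sum>k\<le>2*g. \<Sum>i\<le>k. 8 * f (q i * q (k - i)) * ?L ^ Suc k)"
    by (subst regroup[of _ "2 * g"]) (auto simp: q_gt)
  also have "\<dots> = (\<Sum>k\<le>2*g. f (8 * (\<Sum>i\<le>k. q i * q (k - i))) * ?L ^ Suc k)"
    by (simp add: f_mult[of 8] f_numeral f_sum sum_distrib_left sum_distrib_right mult.assoc)
  also have "\<dots> = (\<Sum>k\<le>2*g+1. f (case k of 0 \<Rightarrow> 0 | Suc m \<Rightarrow> 8 * (\<Sum>i\<le>m. q i * q (m - i))) * ?L ^ k)"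
    by (simp add: sum.atMost_Suc_shift del: sum.atMost_Suc)
  finally have 1: "(\<Sum>i\<le>g. \<Sum>j\<le>g. 8 * f (q i * q j) * ?L ^ Suc (i + j)) = \<dots>" .
  have "(\<Sum>i\<le>g. \<Sum>j\<le>g. f (G \<gamma> (q i) (q j)) * ?L ^ (i + j)) = (\<Sum>k\<le>2*g+1. \<Sum>i\<le>k. f (G \<gamma> (q i) (q (k - i))) * ?L ^ k)"
    by (subst regroup[of _ "2 * g + 1"]) (auto simp: q_gt G_0)
  hence 2: "(\<Sum>i\<le>g. \<Sum>j\<le>g. f (G \<gamma> (q i) (q j)) * ?L ^ (i + j)) = (\<Sum>k\<le>2*g+1. f (\<Sum>i\<le>k. G \<gamma> (q i) (q (k - i))) * ?L ^ k)"
    by (simp only: f_sum sum_distrib_right)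
  show ?thesis
    unfolding * sum.distrib 1 2 unfolding sum.distrib[symmetric] \<phi>_def f_add distrib_right ..
qed

end

end

section \<open>Polynomial solutions of the fifth-order equation\<close>

locale cosh_poly_operators = cosh_operators pderiv "[:0, 1:]" "[:a:]" "[:b:]" f H K
  for a b :: complex and f :: "complex poly \<Rightarrow> 'a::ring_1" and H K
begin

lemma coeff_\<theta>: "coeff (\<theta> p) k = of_nat (k\<^sup>2) * coeff p k - of_nat ((k + 2) * (k + 1)) * coeff p (k + 2)"
  by (cases k; cases "k - 1")
     (auto simp: \<theta>_def \<tau>_def power2_eq_square left_diff_distrib coeff_pderiv algebra_simps)

text \<open>In \<open>h\<close> only the terms with the potential raise the degree, by one, and the
  outer derivative lowers it again. So \<open>\<epsilon>\<close> is triangular on monomials, and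
  this is its diagonal entry.\<close>

lemma coeff_\<epsilon>:
  assumes "degree p \<le> k"
  shows "coeff (\<epsilon> [:c:] p) k = 2 * a * (2 * of_nat k + 1) * (of_nat (k * (k + 1)) - c) * coeff p k"
proof -
  have 0: "coeff p i = 0" if "i > k" for i
    using assms that by (simp add: coeff_eq_0)
  have "coeff (h p) (Suc k) = 2 * a * of_nat (k * (2 * k + 1)) * coeff p k"
    by (cases k) (simp_all add: h_def coeff_\<theta> 0 left_diff_distrib distrib_right mult.assoc[of 4] mult.assoc[of 2] power2_eq_square
        mult.assoc[of "[:a:]"] coeff_pderiv algebra_simps numeral_poly)
  thus ?thesis
    by (cases k) (auto simp: \<epsilon>_def w_def coeff_pderiv 0 numeral_poly algebra_simps)
qed

context
  fixes g :: nat and \<kappa> :: complex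
  assumes a: "a \<noteq> 0" and \<kappa>: "\<kappa> = of_nat (g * (g + 1))"
begin

abbreviation \<gamma>\<^sub>g :: "complex poly" where "\<gamma>\<^sub>g \<equiv> [:\<kappa>:]"
abbreviation \<epsilon>\<^sub>g :: "complex poly \<Rightarrow> complex poly" where "\<epsilon>\<^sub>g \<equiv> \<epsilon> \<gamma>\<^sub>g"

definition eigenval :: "nat \<Rightarrow> complex" where
  "eigenval k = 2 * a * (2 * of_nat k + 1) * (of_nat (k * (k + 1)) - \<kappa>)"

lemma coeff_\<epsilon>\<^sub>g: "degree p \<le> k \<Longrightarrow> coeff (\<epsilon>\<^sub>g p) k = eigenval k * coeff p k"
  unfolding eigenval_def by (rule coeff_\<epsilon>)

lemma eigenval_g: "eigenval g = 0"
  unfolding eigenval_def unfolding \<kappa> by simp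

lemma eigenval_nonzero: "k < g \<Longrightarrow> eigenval k \<noteq> 0"
proof -
  assume "k < g"
  hence "k * (k + 1) < g * (g + 1)" by (intro mult_strict_mono) auto
  hence "of_nat (k * (k + 1)) \<noteq> (of_nat (g * (g + 1)) :: complex)"
    by (simp only: of_nat_eq_iff)
  moreover have "2 * of_nat k + 1 \<noteq> (0 :: complex)"
    by (metis add.commute of_nat_Suc of_nat_mult of_nat_neq_0 of_nat_numeral)
  ultimately show ?thesis using a unfolding eigenval_def unfolding \<kappa> by (simp del: of_nat_mult of_nat_add)
qed

text \<open>Back substitution: the monomial \<open>m\<close> removes the coefficient at
  \<open>n\<close>, and the rest is handled by induction. The division is possible because the
  diagonal entries below \<open>g\<close> are nonzero.\<close>

lemma \<epsilon>_surj:
  assumes "n \<le> g" "\<forall>i\<ge>n. coeff p i = 0"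
  shows "\<exists>q. (\<forall>i\<ge>n. coeff q i = 0) \<and> \<epsilon>\<^sub>g q = p"
  using assms
proof (induction n arbitrary: p)
  case 0
  hence "p = 0" by (auto intro: poly_eqI)
  thus ?case by (intro exI[of _ 0]) simp
next
  case (Suc n)
  define m where "m = monom (coeff p n / eigenval n) n"
  have "coeff (p - \<epsilon>\<^sub>g m) i = 0" if "i \<ge> n" for i
  proof -
    have "degree m \<le> i" using that degree_monom_le[of _ n] unfolding m_def by (meson le_trans)
    thus ?thesis using Suc.prems that eigenval_nonzero[of n]
      by (cases "i = n") (auto simp: coeff_\<epsilon>\<^sub>g m_def)
  qed
  with Suc.prems obtain q where "\<forall>i\<ge>n. coeff q i = 0" "\<epsilon>\<^sub>g q = p - \<epsilon>\<^sub>g m"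
    using Suc.IH[of "p - \<epsilon>\<^sub>g m"] by (auto)
  thus ?case
    by (intro exI[of _ "q + m"]) (auto simp: m_def \<epsilon>_add)
qed

lemma \<epsilon>_sequence:
  "\<exists>q c. \<epsilon>\<^sub>g (q 0) = 0 \<and> (\<forall>j. \<epsilon>\<^sub>g (q (Suc j)) = - 4 * pderiv (q j)) \<and> (\<forall>j>g. q j = 0) \<and>
     q g = [:c:] \<and> c \<noteq> 0"
proof -
  \<comment> \<open>The invariant of the choice: the \<open>j\<close>-th member has degree exactly
    \<open>g - j\<close>, or is zero beyond \<open>g\<close>. Exactness of the degree is what makes
    the final constant nonzero.\<close>
  define A where "A j p \<longleftrightarrow> (if j \<le> g then coeff p (g - j) \<noteq> 0 \<and> (\<forall>i>g-j. coeff p i = 0) else p = 0) \<and>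
      (j = 0 \<longrightarrow> \<epsilon>\<^sub>g p = 0)" for j and p :: "complex poly"
  have "\<exists>q. \<forall>j. A j (q j) \<and> \<epsilon>\<^sub>g (q (Suc j)) = - 4 * pderiv (q j)"
  proof (rule dependent_nat_choice)
    \<comment> \<open>The diagonal entry at \<open>g\<close> is zero, so the image of
      \<open>monom 1 g\<close> has degree below \<open>g\<close> and can be compensated by a
      polynomial of smaller degree.\<close>
    have "coeff (\<epsilon>\<^sub>g (monom 1 g)) i = 0" if "i \<ge> g" for i
    proof -
      have "degree (monom 1 g :: complex poly) \<le> i" using that degree_monom_le[of _ g] by (meson le_trans)
      thus ?thesis using that
        using eigenval_g by (subst coeff_\<epsilon>\<^sub>g) auto
    qed
    then obtain q where q: "\<forall>i\<ge>g. coeff q i = 0" "\<epsilon>\<^sub>g q = \<epsilon>\<^sub>g (monom 1 g)"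
      using \<epsilon>_surj[of g "\<epsilon>\<^sub>g (monom 1 g)"] by blast
    have "A 0 (monom 1 g + - q)"
      using q unfolding A_def by (simp only: \<epsilon>_add \<epsilon>_uminus) simp
    thus "\<exists>p. A 0 p" ..
  next
    fix p j assume A: "A j p"
    show "\<exists>q. A (Suc j) q \<and> \<epsilon>\<^sub>g q = - 4 * pderiv p"
    proof (cases "j < g")
      case False
      hence "degree p = 0" using A by (auto simp: A_def intro!: le_antisym degree_le split: if_splits)
      hence "pderiv p = 0" by (simp add: pderiv_eq_0_iff)
      thus ?thesis using False by (intro exI[of _ 0]) (simp add: A_def)
    next
      case True
      define n where "n = g - Suc j"
      have n: "g - j = Suc n" "n < g" "g - Suc j = n" "Suc j \<le> g" using True by (auto simp: n_def)
      have "\<forall>i\<ge>Suc n. coeff (- 4 * pderiv p) i = 0"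
        using A n by (auto simp: A_def coeff_pderiv numeral_poly)
      then obtain q where q: "\<forall>i\<ge>Suc n. coeff q i = 0" "\<epsilon>\<^sub>g q = - 4 * pderiv p"
        using \<epsilon>_surj[of "Suc n"] n(2) by (meson Suc_leI)
      have "degree q \<le> n" using q(1) by (intro degree_le) auto
      \<comment> \<open>Comparing coefficients at \<open>n\<close> carries the nonvanishing of the
        top coefficient of \<open>p\<close>, at \<open>Suc n\<close>, over to
        \<open>q\<close>.\<close>
      hence "eigenval n * coeff q n = coeff (- 4 * pderiv p) n"
        using coeff_\<epsilon>\<^sub>g q(2) by metis
      moreover have "coeff (- 4 * pderiv p) n \<noteq> 0"
        using A n by (auto simp: A_def coeff_pderiv numeral_poly simp del: of_nat_Suc)
      ultimately have "coeff q n \<noteq> 0" by auto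
      thus ?thesis using q n by (auto simp: A_def)
    qed
  qed
  then obtain q where q: "\<And>j. A j (q j)" "\<And>j. \<epsilon>\<^sub>g (q (Suc j)) = - 4 * pderiv (q j)" by blast
  have "degree (q g) = 0" using q(1)[of g] by (auto simp: A_def intro!: le_antisym degree_le)
  then obtain c where c: "q g = [:c:]" by (meson degree_eq_zeroE)
  hence "c \<noteq> 0" using q(1)[of g] by (auto simp: A_def)
  moreover have "q j = 0" if "j > g" for j using q(1)[of j] that by (auto simp: A_def)
  moreover have "\<epsilon>\<^sub>g (q 0) = 0" using q(1)[of 0] by (auto simp: A_def)
  ultimately show ?thesis using q(2) c by blast
qed

theorem commuting_square_root:
  "\<exists>M c. L \<gamma>\<^sub>g * M = M * L \<gamma>\<^sub>g \<and> 2 * (M * M) = (\<Sum>k\<le>2 * g + 1. f [:c k:] * L \<gamma>\<^sub>g ^ k) \<and>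
     c (2 * g + 1) \<noteq> 0"
proof -
  obtain q c where q: "\<epsilon>\<^sub>g (q 0) = 0" "\<And>j. \<epsilon>\<^sub>g (q (Suc j)) = - 4 * pderiv (q j)"
     "\<And>j. j > g \<Longrightarrow> q j = 0" "q g = [:c:]" "c \<noteq> 0"
    using \<epsilon>_sequence by blast
  have \<gamma>: "pderiv \<gamma>\<^sub>g = 0" by (simp add: pderiv_pCons)
  have qg: "pderiv (q g) = 0" by (simp add: q pderiv_pCons)
  note facts = \<gamma> q(1,2) qg q(3)
  define \<phi>' where "\<phi>' = \<phi> \<gamma>\<^sub>g q"
  have "degree (\<phi>' k) = 0" for k
    using \<delta>_\<phi>[OF facts, of k] unfolding \<phi>'_def by (simp add: pderiv_eq_0_iff)
  hence "\<phi>' k = [:coeff (\<phi>' k) 0:]" for k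
    by (metis degree_eq_zeroE coeff_pCons_0)
  hence "2 * (M \<gamma>\<^sub>g q g * M \<gamma>\<^sub>g q g) = (\<Sum>k\<le>2 * g + 1. f [:coeff (\<phi>' k) 0:] * L \<gamma>\<^sub>g ^ k)"
    using M_square[OF facts] unfolding \<phi>'_def by simp
  moreover have "coeff (\<phi>' (2 * g + 1)) 0 \<noteq> 0"
    unfolding \<phi>'_def using \<phi>_lead[OF facts] q by (simp add: power2_eq_square numeral_poly)
  moreover have "L \<gamma>\<^sub>g * M \<gamma>\<^sub>g q g = M \<gamma>\<^sub>g q g * L \<gamma>\<^sub>g"
    by (rule L_M_commute[OF facts])
  ultimately show ?thesis by (intro exI[of _ "M \<gamma>\<^sub>g q g"] exI[of _ "\<lambda>k. coeff (\<phi>' k) 0"] conjI)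
qed

end

end

subsection \<open>Chebyshev polynomials\<close>

lemma poly_cheb_cos: "poly (cheb n) (cos z) = cos (of_nat n * z)"
proof (induction n rule: cheb.induct)
  case (3 n)
  have "cos (of_nat (Suc (Suc n)) * z) = cos (of_nat (Suc n) * z + z)"
    by (simp add: algebra_simps)
  moreover have "cos (of_nat n * z) = cos (of_nat (Suc n) * z - z)"
    by (simp add: algebra_simps)
  ultimately have "cos (of_nat (Suc (Suc n)) * z) = 2 * cos z * cos (of_nat (Suc n) * z) - cos (of_nat n * z)"
    by (simp only: cos_add cos_diff) simp
  thus ?case using 3 by (simp add: numeral_poly)
qed simp_all

text \<open>Every complex number is a cosine. Differentiating the identity of
  \<open>poly_cheb_cos\<close> expresses \<open>sin (n z)\<close> through the derivative of
  \<open>cheb n\<close> and \<open>sin z\<close>; squaring gives the claim.\<close>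

lemma cheb_pell: "([:0, 1:]\<^sup>2 - 1) * (pderiv (cheb n))\<^sup>2 = of_nat (n\<^sup>2) * ((cheb n)\<^sup>2 - 1)"
proof -
  have "poly (([:0, 1:]\<^sup>2 - 1) * (pderiv (cheb n))\<^sup>2) y = poly (of_nat (n\<^sup>2) * ((cheb n)\<^sup>2 - 1)) y" for y :: complex
  proof -
    define z where "z = Arccos y"
    have y: "y = cos z" by (simp add: z_def)
    have "((\<lambda>z. poly (cheb n) (cos z)) has_field_derivative poly (pderiv (cheb n)) (cos z) * (- sin z)) (at z)"
      by (auto intro!: derivative_eq_intros)
    moreover have "((\<lambda>z. cos (of_nat n * z)) has_field_derivative - sin (of_nat n * z) * of_nat n) (at z)"
      by (auto intro!: derivative_eq_intros)
    ultimately have e: "poly (pderiv (cheb n)) (cos z) * sin z = of_nat n * sin (of_nat n * z)"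
      using DERIV_unique unfolding poly_cheb_cos by fastforce
    have "(poly (pderiv (cheb n)) (cos z))\<^sup>2 * (sin z)\<^sup>2 = of_nat n ^ 2 * (sin (of_nat n * z))\<^sup>2"
      using arg_cong[OF e, of "\<lambda>t. t\<^sup>2"] by (simp add: power_mult_distrib)
    thus ?thesis
      by (simp add: y poly_cheb_cos sin_squared_eq algebra_simps)
  qed
  thus ?thesis by (simp add: poly_eq_poly_eq_iff[symmetric] fun_eq_iff)
qed

lemma degree_cheb: "degree (cheb n) = n" and coeff_cheb_top: "coeff (cheb (Suc n)) (Suc n) = 2 ^ n"
  and coeff_cheb_parity: "odd (n + i) \<Longrightarrow> coeff (cheb n) i = 0"
proof -
  have top: "coeff (cheb (Suc n)) (Suc n) = 2 ^ n \<and> (\<forall>i>n. coeff (cheb n) i = 0)" for n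
  proof (induction n rule: cheb.induct)
    case (3 n)
    thus ?case by (auto simp: numeral_poly coeff_pCons split: nat.split)
  qed (auto simp: numeral_poly coeff_pCons split: nat.split)
  thus "coeff (cheb (Suc n)) (Suc n) = 2 ^ n" by blast
  show "degree (cheb n) = n"
  proof (rule antisym)
    show "degree (cheb n) \<le> n" using top[of n] by (intro degree_le) auto
    show "degree (cheb n) \<ge> n" using top[of "n - 1"] by (cases n) (auto intro!: le_degree)
  qed
  show "odd (n + i) \<Longrightarrow> coeff (cheb n) i = 0"
  proof (induction n arbitrary: i rule: cheb.induct)
    case (3 n)
    thus ?case by (cases i) (auto simp: numeral_poly coeff_pCons)
  qed (auto simp: coeff_pCons odd_pos split: nat.split)
qed

text \<open>The derivative of \<open>cheb_pell\<close>, divided by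
  \<open>2 * pderiv (cheb n)\<close>, which is nonzero for positive \<open>n\<close>.\<close>

lemma cheb_ode:
  "([:0, 1:]\<^sup>2 - 1) * pderiv (pderiv (cheb n)) + [:0, 1:] * pderiv (cheb n) = of_nat (n\<^sup>2) * cheb n"
proof (cases "n = 0")
  case False
  define x where "x = [:0, 1 :: complex:]"
  have x: "pderiv x = 1" by (simp add: x_def pderiv_pCons one_pCons)
  have nz: "2 * pderiv (cheb n) \<noteq> 0"
    using degree_cheb[of n] False by (auto simp: pderiv_eq_0_iff)
  have "pderiv ((x\<^sup>2 - 1) * (pderiv (cheb n))\<^sup>2) = pderiv (of_nat (n\<^sup>2) * ((cheb n)\<^sup>2 - 1))"
    using cheb_pell[of n] by (simp only: x_def)
  hence "2 * pderiv (cheb n) * ((x\<^sup>2 - 1) * pderiv (pderiv (cheb n)) + x * pderiv (cheb n)) =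
      2 * pderiv (cheb n) * (of_nat (n\<^sup>2) * cheb n)"
    by (simp add: pderiv_mult pderiv_diff power2_eq_square x algebra_simps)
  thus ?thesis using nz unfolding x_def[symmetric] by (metis mult_left_cancel)
qed simp

subsection \<open>The Weyl algebra\<close>

abbreviation op_D :: diffop where "op_D \<equiv> - op_x"
abbreviation \<iota> :: "complex poly \<Rightarrow> diffop" where "\<iota> p \<equiv> poly_at_op p op_d"

lemma op_D_\<iota>: "op_D * \<iota> p = \<iota> p * op_D + \<iota> (pderiv p)"
proof (induction p)
  case (pCons c p)
  have "op_D * \<iota> (pCons c p) = op_const c * op_D + (op_D * op_d) * \<iota> p"
    by (simp add: poly_at_op_pCons distrib_left op_const_commute mult.assoc)
  also have "op_D * op_d = op_d * op_D + 1"
    by (simp add: op_d_op_x)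
  also have "op_const c * op_D + \<dots> * \<iota> p = op_const c * op_D + op_d * (op_D * \<iota> p) + \<iota> p"
    by (simp add: distrib_right left_diff_distrib mult.assoc)
  also have "\<dots> = \<iota> (pCons c p) * op_D + \<iota> (pderiv (pCons c p))"
    unfolding pCons.IH by (simp add: poly_at_op_pCons pderiv_pCons poly_at_op_add algebra_simps)
  finally show ?case .
qed simp

text \<open>Polynomials in \<open>op_d\<close> stand to the left of powers of \<open>op_D\<close>.
  Order three is enough for the product of the second-order \<open>cosh_H\<close> and the
  first-order \<open>cosh_K\<close>.\<close>

definition weyl_nf :: "complex poly \<Rightarrow> complex poly \<Rightarrow> complex poly \<Rightarrow> complex poly \<Rightarrow> diffop" where
  "weyl_nf a b c d = \<iota> a + \<iota> b * op_D + \<iota> c * op_D\<^sup>2 + \<iota> d * op_D ^ 3"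

lemma weyl_nf_add: "weyl_nf a b c d + weyl_nf a' b' c' d' = weyl_nf (a + a') (b + b') (c + c') (d + d')"
  by (simp add: weyl_nf_def poly_at_op_add algebra_simps)

lemma \<iota>_weyl_nf: "\<iota> p * weyl_nf a b c d = weyl_nf (p * a) (p * b) (p * c) (p * d)"
  by (simp add: weyl_nf_def poly_at_op_mult distrib_left right_diff_distrib mult.assoc)

lemma op_D_weyl_nf: "op_D * weyl_nf a b c 0 = weyl_nf (pderiv a) (a + pderiv b) (b + pderiv c) c"
proof -
  have "op_D * (\<iota> p * z) = \<iota> p * (op_D * z) + \<iota> (pderiv p) * z" for p z
    by (simp only: mult.assoc[symmetric] op_D_\<iota> distrib_right)
  note * = this this[of p 1 for p, unfolded mult_1_right]
  show ?thesis
    unfolding weyl_nf_def by (simp only: distrib_left * poly_at_op_0 mult_zero_right mult_zero_left power_Suc[symmetric] power2_eq_square power3_eq_cube poly_at_op_add distrib_right)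
       (simp add: algebra_simps)
qed

lemma weyl_nf_cong: "a = a' \<Longrightarrow> b = b' \<Longrightarrow> c = c' \<Longrightarrow> d = d' \<Longrightarrow> weyl_nf a b c d = weyl_nf a' b' c' d'"
  by simp

text \<open>For \<open>y = cosh t\<close> and \<open>s = r t\<close>, \<open>d/ds\<close> is
  \<open>sinh t / r\<close> times \<open>d/dy\<close>, and
  \<open>sinh s = sinh t * T_r'(y) / r\<close>. Hence \<open>sinh s d/ds\<close> has the polynomial
  coefficient \<open>(y^2 - 1) * T_r'(y) / r^2\<close>.\<close>

definition cosh_K :: "nat \<Rightarrow> diffop" where
  "cosh_K r = \<iota> (smult (1 / of_nat (r\<^sup>2)) (([:0, 1:]\<^sup>2 - 1) * pderiv (cheb r))) * op_D"

text \<open>In the same variables \<open>(d/ds)^2\<close> is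
  \<open>((y^2 - 1) (d/dy)^2 + y d/dy) / r^2\<close>, and the potential is
  \<open>a * cosh s + b\<close> with \<open>cosh s = T_r(y)\<close>.\<close>

definition cosh_H :: "nat \<Rightarrow> complex \<Rightarrow> complex \<Rightarrow> diffop" where
  "cosh_H r a b = op_const (1 / of_nat (r\<^sup>2)) * (\<iota> ([:0, 1:]\<^sup>2 - 1) * op_D\<^sup>2 + \<iota> [:0, 1:] * op_D)
     + \<iota> ([:b, a:] \<circ>\<^sub>p cheb r)"

lemma pcompose_1: "1 \<circ>\<^sub>p p = 1"
  by (simp add: one_pCons)

text \<open>In Weyl normal form each commutation rule becomes a list of polynomial identities. The
  nontrivial ones follow from the Pell identity and the differential equation of \<open>T\<close>,
  which stand for the relations between \<open>cosh s\<close> and \<open>sinh s\<close>.\<close>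

lemma cosh_poly_operators:
  assumes "r > 0"
  shows "cosh_poly_operators a b (\<lambda>p. \<iota> (p \<circ>\<^sub>p cheb r)) (cosh_H r a b) (cosh_K r)"
proof -
  define x where "x = [:0, 1 :: complex:]"
  define T where "T = cheb r"
  define c where "c = [:1 / of_nat (r\<^sup>2) :: complex:]"
  define c' where "c' = [:of_nat (r\<^sup>2) :: complex:]"
  define S where "S = pderiv T"
  define k where "k = c * ((x\<^sup>2 - 1) * S)"
  define v where "v = [:a:] * T + [:b:]"
  have cc: "c * c' = 1" using assms by (simp add: c_def c'_def one_pCons)
  have dx: "pderiv x = 1" by (simp add: x_def pderiv_pCons one_pCons)
  have dc: "pderiv c = 0" by (simp add: c_def pderiv_pCons)
  have pell: "(x\<^sup>2 - 1) * S\<^sup>2 = c' * (T\<^sup>2 - 1)"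
    using cheb_pell[of r] by (simp add: x_def S_def T_def c'_def of_nat_poly)
  have ode: "(x\<^sup>2 - 1) * pderiv S + x * S = c' * T"
    using cheb_ode[of r] by (simp add: x_def S_def T_def c'_def of_nat_poly)
  \<comment> \<open>This is \<open>K\<close> applied to \<open>cosh s\<close>, that is, the square
    of \<open>sinh s\<close>. It lets \<open>K\<close> act on polynomials in \<open>T\<close>
    without the derivative of \<open>T\<close> appearing in the result.\<close>
  have kS: "k * S = T\<^sup>2 - 1"
    using pell cc unfolding k_def by algebra
  have dk: "pderiv k = c * x * S + T"
  proof -
    have "pderiv k = c * (2 * x * S + (x\<^sup>2 - 1) * pderiv S)"
      by (simp add: k_def pderiv_mult dc pderiv_diff power2_eq_square dx algebra_simps)
    thus ?thesis using ode cc by algebra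
  qed
  have ddk: "pderiv (pderiv k) = c * S + c * x * pderiv S + S"
    unfolding dk by (simp add: pderiv_mult pderiv_add dc dx S_def)
  have K: "cosh_K r = weyl_nf 0 k 0 0"
    by (simp add: cosh_K_def weyl_nf_def k_def c_def S_def x_def T_def)
  have H: "cosh_H r a b = weyl_nf v (c * x) (c * (x\<^sup>2 - 1)) 0"
  proof -
    have "\<iota> (c * p) = op_const (1 / of_nat (r\<^sup>2)) * \<iota> p" for p
      by (simp add: c_def poly_at_op_smult)
    moreover have "[:b, a:] \<circ>\<^sub>p T = v" by (simp add: v_def pcompose_pCons)
    ultimately show ?thesis
      unfolding cosh_H_def weyl_nf_def T_def[symmetric] x_def[symmetric] by (simp only:) (simp add: algebra_simps)
  qed
  have f: "\<iota> p = weyl_nf p 0 0 0" for p by (simp add: weyl_nf_def)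
  have Wl: "weyl_nf a b e 0 * z = \<iota> a * z + \<iota> b * (op_D * z) + \<iota> e * (op_D * (op_D * z))" for a b e z
    by (simp add: weyl_nf_def distrib_right left_diff_distrib mult.assoc power2_eq_square)
  have Wk: "weyl_nf 0 b 0 0 * z = \<iota> b * (op_D * z)" for b z
    by (simp add: weyl_nf_def mult.assoc)
  have dT: "pderiv (p \<circ>\<^sub>p T) = (pderiv p \<circ>\<^sub>p T) * S" for p
    by (simp add: pderiv_pcompose S_def)
  have pc: "[:0, 1:] \<circ>\<^sub>p T = T" "([:0, 1:]\<^sup>2 - 1) \<circ>\<^sub>p T = T\<^sup>2 - 1" "[:a:] \<circ>\<^sub>p T = [:a:]" "[:b:] \<circ>\<^sub>p T = [:b:]"
    by (simp_all add: pcompose_pCons pcompose_diff power2_eq_square pcompose_mult one_pCons)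
  have num: "numeral n * weyl_nf a b e d = weyl_nf (numeral n * a) (numeral n * b) (numeral n * e) (numeral n * d)" for n a b e d
    using \<iota>_weyl_nf[of "numeral n" a b e d] by (simp add: numeral_poly op_const_numeral)
  show ?thesis
    unfolding cosh_poly_operators_def T_def[symmetric]
  proof
    fix p q :: "complex poly"
    show "pderiv [:0, 1 :: complex:] = 1" "pderiv [:a:] = 0" "pderiv [:b:] = 0" "pderiv (p + q) = pderiv p + pderiv q"
      "pderiv (p * q) = pderiv p * q + p * pderiv q"
      by (simp_all add: pderiv_pCons one_pCons pderiv_add pderiv_mult)
    show "\<iota> ((p + q) \<circ>\<^sub>p T) = \<iota> (p \<circ>\<^sub>p T) + \<iota> (q \<circ>\<^sub>p T)" "\<iota> ((p * q) \<circ>\<^sub>p T) = \<iota> (p \<circ>\<^sub>p T) * \<iota> (q \<circ>\<^sub>p T)"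
      "\<iota> (1 \<circ>\<^sub>p T) = 1"
      by (simp_all add: pcompose_add pcompose_mult poly_at_op_add poly_at_op_mult pcompose_1)
    have xs: "(([:0, 1:]\<^sup>2 - 1) * pderiv p) \<circ>\<^sub>p T = (T\<^sup>2 - 1) * (pderiv p \<circ>\<^sub>p T)"
      by (simp only: pcompose_mult pc)
    show "cosh_K r * \<iota> (p \<circ>\<^sub>p T) = \<iota> (p \<circ>\<^sub>p T) * cosh_K r + \<iota> ((([:0, 1:]\<^sup>2 - 1) * pderiv p) \<circ>\<^sub>p T)"
    proof -
      define u where "u = p \<circ>\<^sub>p T"
      define u1 where "u1 = pderiv p \<circ>\<^sub>p T"
      have du: "pderiv u = u1 * S" unfolding u_def u1_def by (rule dT)
      have "weyl_nf 0 k 0 0 * weyl_nf u 0 0 0 = \<iota> u * weyl_nf 0 k 0 0 + weyl_nf ((T\<^sup>2 - 1) * u1) 0 0 0"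
        unfolding Wk unfolding Wl op_D_weyl_nf \<iota>_weyl_nf weyl_nf_add
        by (rule weyl_nf_cong) (simp_all add: du kS[symmetric] algebra_simps)
      thus ?thesis
        unfolding K xs u_def[symmetric] u1_def[symmetric] f[of "_ * u1"] f[of u, symmetric] .
    qed
    have xs2: "(([:0, 1:]\<^sup>2 - 1) * pderiv (pderiv p) + [:0, 1:] * pderiv p) \<circ>\<^sub>p T
      = (T\<^sup>2 - 1) * (pderiv (pderiv p) \<circ>\<^sub>p T) + T * (pderiv p \<circ>\<^sub>p T)"
      by (simp only: pcompose_mult pc pcompose_add)
    show "cosh_H r a b * \<iota> (p \<circ>\<^sub>p T) = \<iota> (p \<circ>\<^sub>p T) * cosh_H r a b + 2 * \<iota> (pderiv p \<circ>\<^sub>p T) * cosh_K r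
        + \<iota> ((([:0, 1:]\<^sup>2 - 1) * pderiv (pderiv p) + [:0, 1:] * pderiv p) \<circ>\<^sub>p T)"
    proof -
      define u where "u = p \<circ>\<^sub>p T"
      define u1 where "u1 = pderiv p \<circ>\<^sub>p T"
      define u2 where "u2 = pderiv (pderiv p) \<circ>\<^sub>p T"
      have du: "pderiv u = u1 * S" "pderiv u1 = u2 * S" unfolding u_def u1_def u2_def by (rule dT)+
      have e1: "c * x * (u1 * S) + c * (x\<^sup>2 - 1) * (u2 * S * S + u1 * pderiv S) = (T\<^sup>2 - 1) * u2 + T * u1"
        using ode cc kS unfolding k_def by algebra
      have "weyl_nf v (c * x) (c * (x\<^sup>2 - 1)) 0 * weyl_nf u 0 0 0 = \<iota> u * weyl_nf v (c * x) (c * (x\<^sup>2 - 1)) 0 + 2 * (\<iota> u1 * weyl_nf 0 k 0 0)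
         + weyl_nf ((T\<^sup>2 - 1) * u2 + T * u1) 0 0 0"
        unfolding Wk unfolding Wl op_D_weyl_nf \<iota>_weyl_nf num weyl_nf_add
        apply (rule weyl_nf_cong)
        subgoal using e1 by (simp add: du pderiv_mult algebra_simps)
        by (simp_all add: du pderiv_mult k_def algebra_simps)
      thus ?thesis
        unfolding H K xs2 u_def[symmetric] u1_def[symmetric] u2_def[symmetric] f[of "_ + _"] f[of u, symmetric] mult.assoc .
    qed
  next
    have xs3: "(2 * [:0, 1:] * ([:a:] * [:0, 1:] + [:b:]) + [:a:] * ([:0, 1:]\<^sup>2 - 1)) \<circ>\<^sub>p T
       = 2 * T * v + [:a:] * (T\<^sup>2 - 1)"
    proof -
      have two: "2 \<circ>\<^sub>p T = 2" by (simp add: numeral_poly)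
      show ?thesis by (simp only: pcompose_mult pc pcompose_add v_def two)
    qed
    show "cosh_H r a b * cosh_K r = cosh_K r * cosh_H r a b + 2 * \<iota> ([:0, 1:] \<circ>\<^sub>p T) * cosh_H r a b + cosh_K r
       - \<iota> ((2 * [:0, 1:] * ([:a:] * [:0, 1:] + [:b:]) + [:a:] * ([:0, 1:]\<^sup>2 - 1)) \<circ>\<^sub>p T)"
    proof -
      have dv: "pderiv v = [:a:] * S" by (simp add: v_def S_def pderiv_add pderiv_mult pderiv_smult pderiv_pCons)
      have e1: "c * x * pderiv k + c * (x\<^sup>2 - 1) * pderiv (pderiv k) = k * c + 2 * T * (c * x) + k"
        unfolding ddk unfolding dk unfolding k_def using ode cc by algebra
      have e2: "c * x * k + c * (x\<^sup>2 - 1) * (2 * pderiv k) = k * (c * x + 2 * (c * x)) + 2 * T * (c * (x\<^sup>2 - 1))"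
        unfolding dk unfolding k_def by algebra
      have e3: "k * ([:a:] * S) = [:a:] * (T\<^sup>2 - 1)" using kS by algebra
      have "weyl_nf v (c * x) (c * (x\<^sup>2 - 1)) 0 * weyl_nf 0 k 0 0 + weyl_nf (2 * T * v + [:a:] * (T\<^sup>2 - 1)) 0 0 0
        = weyl_nf 0 k 0 0 * weyl_nf v (c * x) (c * (x\<^sup>2 - 1)) 0 + 2 * (\<iota> T * weyl_nf v (c * x) (c * (x\<^sup>2 - 1)) 0) + weyl_nf 0 k 0 0"
        unfolding Wk unfolding Wl op_D_weyl_nf \<iota>_weyl_nf num weyl_nf_add
        apply (rule weyl_nf_cong)
        subgoal using e3 by (simp add: dv)
        subgoal using e1 by (simp add: pderiv_mult dc dx algebra_simps)
        subgoal using e2 by (simp add: pderiv_mult pderiv_diff power2_eq_square dc dx algebra_simps)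
        subgoal by (simp add: algebra_simps)
        done
      thus ?thesis
        unfolding H K xs3 pc f[of "_ + _"] by (simp add: eq_diff_eq mult.assoc)
    qed
    have xs4: "(([:0, 1:]\<^sup>2 - 1) * ([:a:] * [:0, 1:] + [:b:])) \<circ>\<^sub>p T = (T\<^sup>2 - 1) * v"
      by (simp only: pcompose_mult pc pcompose_add v_def)
    show "cosh_K r * cosh_K r = \<iota> (([:0, 1:]\<^sup>2 - 1) \<circ>\<^sub>p T) * cosh_H r a b + \<iota> ([:0, 1:] \<circ>\<^sub>p T) * cosh_K r
       - \<iota> ((([:0, 1:]\<^sup>2 - 1) * ([:a:] * [:0, 1:] + [:b:])) \<circ>\<^sub>p T)"
    proof -
      have e1: "k * pderiv k = (T\<^sup>2 - 1) * (c * x) + T * k"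
        unfolding dk using kS by algebra
      have e2: "k * k = (T\<^sup>2 - 1) * (c * (x\<^sup>2 - 1))"
        using kS unfolding k_def by algebra
      have "weyl_nf 0 k 0 0 * weyl_nf 0 k 0 0 + weyl_nf ((T\<^sup>2 - 1) * v) 0 0 0 = \<iota> (T\<^sup>2 - 1) * weyl_nf v (c * x) (c * (x\<^sup>2 - 1)) 0 + \<iota> T * weyl_nf 0 k 0 0"
        unfolding Wk unfolding Wl op_D_weyl_nf \<iota>_weyl_nf num weyl_nf_add
        by (rule weyl_nf_cong) (simp_all add: e1 e2)
      thus ?thesis
        unfolding H K xs4 pc f[of "_ * v"] by (simp add: eq_diff_eq)
    qed
  qed
qed

text \<open>Moving \<open>op_x\<close> to the left in the second-order part of \<open>cosh_H\<close>
  produces \<open>x^2 (d/dx)^2 + 3 x d/dx + 1 - x^2\<close>; its constant term accounts for the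
  shift from \<open>b\<close> to \<open>b + 1\<close>.\<close>

lemma cheb_op_inner:
  assumes "r > 0"
  shows "op_const a * poly_at_op (cheb r) op_d - op_x ^ 2 * op_d ^ 2 - 3 * op_x * op_d + op_x ^ 2 + op_const b
    = - op_const (of_nat (r\<^sup>2)) * cosh_H r (- a / of_nat (r\<^sup>2)) (- (b + 1) / of_nat (r\<^sup>2))"
proof -
  define c where "c = (of_nat (r\<^sup>2) :: complex)"
  have c: "c \<noteq> 0" using assms by (simp add: c_def)
  have dx: "op_d * (op_x * z) = op_x * (op_d * z) + z" for z
    using arg_cong[OF op_d_op_x, of "\<lambda>y. y * z"] by (simp add: distrib_right mult.assoc)
  have three: "3 * z = z + z + z" for z :: diffop
  proof -
    have "(3 :: diffop) = 1 + 1 + 1" by simp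
    thus ?thesis by (simp only: distrib_right mult_1_left)
  qed
  have "\<iota> ([:0, 1:]\<^sup>2 - 1) = op_d\<^sup>2 - 1" "\<iota> [:0, 1:] = op_d"
    by (simp_all add: poly_at_op_diff poly_at_op_power poly_at_op_pCons)
  hence A: "\<iota> ([:0, 1:]\<^sup>2 - 1) * op_D\<^sup>2 + \<iota> [:0, 1:] * op_D
     = op_x\<^sup>2 * op_d\<^sup>2 + 3 * op_x * op_d + 1 - op_x\<^sup>2" (is "?A = _")
    by (simp add: power2_eq_square left_diff_distrib distrib_left dx op_d_op_x mult.assoc mult_2 three distrib_right)
  have v: "[:- (b + 1) / c, - a / c:] \<circ>\<^sub>p cheb r = smult (- 1 / c) (smult a (cheb r) + [:b + 1:])"
    using c by (simp add: pcompose_pCons smult_add_right field_simps)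
  have "- op_const c * cosh_H r (- a / c) (- (b + 1) / c)
      = - op_const (c * (1 / c)) * ?A - op_const (c * (- 1 / c)) * (op_const a * \<iota> (cheb r) + op_const (b + 1))"
    unfolding cosh_H_def c_def[symmetric] v op_const_mult
    by (simp only: poly_at_op_smult poly_at_op_add poly_at_op_const distrib_left mult.assoc mult_minus_left mult_minus_right)
       simp
  also have "\<dots> = - ?A + (op_const a * \<iota> (cheb r) + op_const (b + 1))"
    using c by (simp add: op_const_uminus)
  finally show ?thesis
    unfolding c_def[symmetric] A by (simp add: op_const_add algebra_simps)
qed

theorem cheb_op_square_root:
  assumes "r > 0" "a \<noteq> 0" and L_eq: "L = cheb_op g r a b"
  shows "\<exists>M \<alpha>. commutator L M = 0 \<and> M ^ 2 = L ^ (2 * g + 1) + (\<Sum>i\<le>2 * g. op_const (\<alpha> i) * L ^ i)"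
proof -
  define c where "c = (of_nat (r\<^sup>2) :: complex)"
  have c: "c \<noteq> 0" using assms by (simp add: c_def)
  interpret cosh_poly_operators "- a / c" "- (b + 1) / c" "\<lambda>p. \<iota> (p \<circ>\<^sub>p cheb r)" "cosh_H r (- a / c) (- (b + 1) / c)" "cosh_K r"
    by (rule cosh_poly_operators) fact
  define \<kappa> where "\<kappa> = (of_nat (g * (g + 1)) :: complex)"
  define L' where "L' = local.L [:\<kappa>:]"
  \<comment> \<open>The inner factor is \<open>- c\<close> times \<open>H\<close>, so its square
    carries the factor \<open>c^2\<close>; the same factor turns \<open>w\<close> into the term
    subtracted in \<open>cheb_op\<close>.\<close>
  have L: "L = op_const (c\<^sup>2) * L'"
  proof -
    have "w [:\<kappa>:] \<circ>\<^sub>p cheb r = smult (- a / c * \<kappa>) (cheb r)"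
      unfolding w_def by (simp add: pcompose_mult pcompose_pCons mult.commute)
    hence "op_const (c\<^sup>2) * \<iota> (w [:\<kappa>:] \<circ>\<^sub>p cheb r) = op_const (c\<^sup>2 * (- a / c * \<kappa>)) * \<iota> (cheb r)"
      by (simp only: poly_at_op_smult op_const_mult mult.assoc)
    also have "c\<^sup>2 * (- a / c * \<kappa>) = - (a * of_nat (r\<^sup>2 * g * (g + 1)))"
      using c by (simp add: c_def \<kappa>_def power2_eq_square field_simps)
    finally have 1: "op_const (c\<^sup>2) * \<iota> (w [:\<kappa>:] \<circ>\<^sub>p cheb r) = - op_const (a * of_nat (r\<^sup>2 * g * (g + 1))) * \<iota> (cheb r)"
      by (simp only: op_const_uminus)
    show ?thesis
      unfolding L_eq cheb_op_def cheb_op_inner[OF assms(1)] L'_def local.L_def distrib_left 1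
      unfolding c_def[symmetric]
      by (simp add: power2_eq_square op_const_mult mult.assoc
          op_const_left_commute[of "cosh_H r x y" for x y] del: of_nat_mult of_nat_power)
  qed
  have \<alpha>: "- a / c \<noteq> 0" using assms c by simp
  obtain N k where comm: "L' * N = N * L'" and N: "2 * (N * N) = (\<Sum>i\<le>2 * g + 1. \<iota> ([:k i:] \<circ>\<^sub>p cheb r) * L' ^ i)"
    and k: "k (2 * g + 1) \<noteq> 0"
    using commuting_square_root[OF \<alpha> \<kappa>_def] unfolding L'_def by blast
  \<comment> \<open>After substituting \<open>L / c^2\<close> for \<open>L'\<close>,
    \<open>s\<close> is the coefficient of \<open>L ^ (2 * g + 1)\<close> in
    \<open>2 * (N * N)\<close>. The factor \<open>t\<close> with \<open>t^2 = 2 / s\<close>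
    normalizes it to 1.\<close>
  define s where "s = k (2 * g + 1) / (c\<^sup>2) ^ (2 * g + 1)"
  have s: "s \<noteq> 0" using k c by (simp add: s_def)
  define t where "t = csqrt (2 / s)"
  have L': "L' = op_const (1 / c\<^sup>2) * L"
    using c by (simp add: L mult.assoc[symmetric] op_const_mult[symmetric])
  define M where "M = op_const t * N"
  define \<alpha> where "\<alpha> i = k i / (c\<^sup>2) ^ i / s" for i
  have "M ^ 2 = op_const (t ^ 2 / 2) * (2 * (N * N))"
  proof -
    have "op_const (t ^ 2 / 2) * (op_const 2 * (N * N)) = op_const (t ^ 2) * (N * N)"
      by (simp only: mult.assoc[symmetric] op_const_mult[symmetric]) simp
    thus ?thesis
      by (simp add: M_def op_const_power_mult op_const_numeral power2_eq_square[of N])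
  qed
  also have "\<dots> = op_const (1 / s) * (\<Sum>i\<le>2 * g + 1. op_const (k i / (c\<^sup>2) ^ i) * L ^ i)"
    unfolding N using s
    by (simp add: t_def L' op_const_power_mult mult.assoc[symmetric] op_const_mult[symmetric] power_divide)
  also have "\<dots> = (\<Sum>i\<le>2 * g + 1. op_const (\<alpha> i) * L ^ i)"
    by (simp only: sum_distrib_left mult.assoc[symmetric] op_const_mult[symmetric]) (simp add: \<alpha>_def mult.commute[of s])
  also have "\<dots> = L ^ (2 * g + 1) + (\<Sum>i\<le>2 * g. op_const (\<alpha> i) * L ^ i)"
    using s by (simp add: \<alpha>_def s_def add.commute)
  finally have "M ^ 2 = L ^ (2 * g + 1) + (\<Sum>i\<le>2 * g. op_const (\<alpha> i) * L ^ i)" .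
  moreover have "commutator L M = 0"
  proof -
    have "L * M = op_const (c\<^sup>2) * (op_const t * (L' * N))"
      by (simp add: L M_def mult.assoc op_const_left_commute[of L'])
    also have "\<dots> = M * L"
      unfolding comm by (simp add: L M_def mult.assoc op_const_left_commute[of N] op_const_left_commute[of "op_const t"])
    finally show ?thesis by (simp add: commutator_def)
  qed
  ultimately show ?thesis by blast
qed

subsection \<open>Dimension of function spaces\<close>

lemma sum_fun_apply:
  fixes F :: "'i \<Rightarrow> 'a \<Rightarrow> 'b::comm_monoid_add"
  shows "(\<Sum>i\<in>A. F i) x = (\<Sum>i\<in>A. F i x)"
  by (induction A rule: infinite_finite_induct) auto

text \<open>A basis is a set, whereas the functions on the curve come as an indexed family;
  independence of the family first shows that \<open>e\<close> is injective.\<close>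

lemma cfun_dim_eqI:
  fixes e :: "'i \<Rightarrow> 'a \<Rightarrow> complex"
  assumes I: "finite I"
    and V: "V = {f. \<exists>c. \<forall>x. f x = (\<Sum>i\<in>I. c i * e i x)}"
    and indep: "\<And>c. (\<And>x. (\<Sum>i\<in>I. c i * e i x) = 0) \<Longrightarrow> \<forall>i\<in>I. c i = 0"
  shows "cfun.dim V = card I"
proof -
  have inj: "inj_on e I"
  proof (rule inj_onI)
    fix i j assume ij: "i \<in> I" "j \<in> I" "e i = e j"
    show "i = j"
    proof (rule ccontr)
      assume ne: "i \<noteq> j"
      define c :: "'i \<Rightarrow> complex" where "c k = (if k = i then 1 else if k = j then - 1 else 0)" for k
      have "(\<Sum>k\<in>I. c k * e k x) = 0" for x
      proof -
        have "(\<Sum>k\<in>I. c k * e k x) = (\<Sum>k\<in>I. (if k = i then e i x else 0) - (if k = j then e j x else 0))"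
          using ne by (intro sum.cong) (auto simp: c_def)
        also have "\<dots> = e i x - e j x"
          using ij I unfolding sum_subtractf by (simp add: sum.delta)
        finally show ?thesis using ij by simp
      qed
      hence "c i = 0" using indep ij by blast
      thus False by (simp add: c_def)
    qed
  qed
  show ?thesis
  proof (rule cfun.dim_unique[of "e ` I"])
    have "(\<Sum>k\<in>I. (if k = i then 1 else 0) * e k x) = e i x" if "i \<in> I" for i x
      using that I by (simp add: sum.delta if_distrib[of "\<lambda>t. t * _"] cong: if_cong)
    hence "\<exists>c. \<forall>x. e i x = (\<Sum>k\<in>I. c k * e k x)" if "i \<in> I" for i
      using that by (intro exI[of _ "\<lambda>k. if k = i then 1 else 0"]) simp
    thus "e ` I \<subseteq> V" unfolding V by auto
    show "V \<subseteq> cfun.span (e ` I)"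
    proof
      fix f assume "f \<in> V"
      then obtain c where "\<And>x. f x = (\<Sum>i\<in>I. c i * e i x)" unfolding V by blast
      hence "f = (\<Sum>i\<in>I. (\<lambda>x. c i * e i x))" by (auto simp: sum_fun_apply)
      moreover have "(\<lambda>x. c i * e i x) \<in> cfun.span (e ` I)" if "i \<in> I" for i
        using that by (intro cfun.span_scale cfun.span_base) auto
      ultimately show "f \<in> cfun.span (e ` I)" by (simp only: cfun.span_sum)
    qed
    show "cfun.independent (e ` I)"
    proof
      assume "cfun.dependent (e ` I)"
      then obtain u v where uv: "v \<in> e ` I" "u v \<noteq> 0" "(\<Sum>v\<in>e ` I. (\<lambda>x. u v * v x)) = 0"
        using I by (subst (asm) cfun.dependent_finite) auto
      have "(\<Sum>i\<in>I. u (e i) * e i x) = 0" for x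
        using fun_cong[OF uv(3), of x] by (simp add: sum_fun_apply sum.reindex[OF inj])
      thus False using indep[of "\<lambda>i. u (e i)"] uv by auto
    qed
    show "card (e ` I) = card I" by (rule card_image) (rule inj)
  qed
qed

subsection \<open>Spectral curve\<close>

lemma poly2_at_ops_pCons:
  "poly2_at_ops (pCons c Q) L M = poly_at_op c L + poly2_at_ops Q L M * M"
proof -
  have alt: "poly2_at_ops Q L M = (\<Sum>j\<le>n. poly_at_op (coeff Q j) L * M ^ j)" if "degree Q \<le> n" for Q n
    unfolding poly2_at_ops_def using that by (intro sum.mono_neutral_left) (auto simp: coeff_eq_0)
  have "poly2_at_ops (pCons c Q) L M = (\<Sum>j\<le>Suc (degree Q). poly_at_op (coeff (pCons c Q) j) L * M ^ j)"
    by (rule alt) (rule degree_pCons_le)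
  thus ?thesis
    by (subst (asm) sum.atMost_Suc_shift)
       (simp add: poly2_at_ops_def sum_distrib_right mult.assoc power_commutes)
qed

text \<open>Horner's scheme modulo \<open>m^2 = F\<close>: multiplying \<open>p + m q\<close> by
  \<open>m\<close> and adding \<open>c\<close> gives \<open>(c + q F) + m p\<close>. The same
  \<open>p\<close> and \<open>q\<close> serve points of the curve and operators, so relations can be
  transferred.\<close>

lemma curve_reduction:
  "\<exists>p q. (\<forall>l m. m\<^sup>2 = poly F l \<longrightarrow> poly2_eval Q l m = poly p l + m * poly q l) \<and>
     (\<forall>L M. M\<^sup>2 = poly_at_op F L \<longrightarrow> poly2_at_ops Q L M = poly_at_op p L + poly_at_op q L * M)"
proof (induction Q)
  case 0
  show ?case by (intro exI[of _ 0]) (simp add: poly2_eval_def poly2_at_ops_def)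
next
  case (pCons c Q)
  then obtain p q where pq:
    "\<And>l m. m\<^sup>2 = poly F l \<Longrightarrow> poly2_eval Q l m = poly p l + m * poly q l"
    "\<And>L M. M\<^sup>2 = poly_at_op F L \<Longrightarrow> poly2_at_ops Q L M = poly_at_op p L + poly_at_op q L * M"
    by blast
  have 1: "poly2_eval (pCons c Q) l m = poly c l + m * poly2_eval Q l m" for l m
    by (simp add: poly2_eval_def)
  show ?case
  proof (rule exI[of _ "c + q * F"], rule exI[of _ p], intro conjI allI impI)
    fix l m :: complex assume m: "m\<^sup>2 = poly F l"
    thus "poly2_eval (pCons c Q) l m = poly (c + q * F) l + m * poly p l"
      unfolding 1 pq(1)[OF m] by (simp add: m[symmetric] power2_eq_square algebra_simps)
  next
    fix L M :: diffop assume M: "M\<^sup>2 = poly_at_op F L"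
    show "poly2_at_ops (pCons c Q) L M = poly_at_op (c + q * F) L + poly_at_op p L * M"
      unfolding poly2_at_ops_pCons pq(2)[OF M]
      by (simp add: poly_at_op_add poly_at_op_mult M[symmetric] power2_eq_square distrib_right mult.assoc)
  qed
qed

text \<open>Every relation reduces to \<open>p(L) + q(L) M = 0\<close>. The order of
  \<open>M\<close> is \<open>degree F / 2\<close> times that of \<open>L\<close>, with
  \<open>degree F\<close> odd, so nonzero summands would have different orders; hence
  \<open>p = q = 0\<close>.\<close>

lemma spectral_curve_hyperelliptic:
  assumes M: "M\<^sup>2 = poly_at_op F L" and L: "op_order L > 0" and F: "odd (degree F)"
  shows "spectral_curve L M = {(l, m). m\<^sup>2 = poly F l}"
proof (intro equalityI subsetI; clarify)
  fix l m assume "(l, m) \<in> spectral_curve L M"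
  moreover have "poly2_at_ops [:- F, 0, 1:] L M = 0"
    by (simp add: poly2_at_ops_pCons poly_at_op_uminus M[symmetric] power2_eq_square) (simp add: poly2_at_ops_def)
  ultimately have "poly2_eval [:- F, 0, 1:] l m = 0"
    by (auto simp: spectral_curve_def)
  thus "m\<^sup>2 = poly F l" by (simp add: poly2_eval_def power2_eq_square)
next
  fix l m assume m: "m\<^sup>2 = poly F l"
  have "poly2_eval Q l m = 0" if Q: "poly2_at_ops Q L M = 0" for Q
  proof -
    obtain p q where pq: "poly2_eval Q l m = poly p l + m * poly q l"
      "poly2_at_ops Q L M = poly_at_op p L + poly_at_op q L * M"
      using curve_reduction[of F Q] M m by blast
    have nz: "poly_at_op u L = 0 \<longleftrightarrow> u = 0" for u
    proof
      assume "poly_at_op u L = 0"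
      thus "u = 0" using op_order_poly_at_op(2)[OF L, of u] L
        by (cases "u = 0") auto
    qed simp
    have F0: "F \<noteq> 0" using F by auto
    have M0: "M \<noteq> 0" using M nz[of F] F0 by auto
    have oM: "2 * op_order M = degree F * op_order L"
      using arg_cong[OF M, of op_order] F0 M0 by (simp add: op_order_power op_order_poly_at_op[OF L])
    have eq: "poly_at_op p L = - (poly_at_op q L * M)"
      using pq(2) Q by (simp add: eq_neg_iff_add_eq_0)
    have "q = 0"
    proof (rule ccontr)
      assume q: "q \<noteq> 0"
      hence p: "p \<noteq> 0" using eq nz[of q] M0 by auto
      have "degree p * op_order L = degree q * op_order L + op_order M"
        using arg_cong[OF eq, of op_order] p q M0 nz[of q] by (simp add: op_order_poly_at_op[OF L] op_order_mult)
      hence "(2 * degree p) * op_order L = (2 * degree q + degree F) * op_order L"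
        using oM by (simp add: algebra_simps)
      hence "2 * degree p = 2 * degree q + degree F" using L by simp
      thus False using F by presburger
    qed
    moreover have "p = 0" using eq nz[of p] calculation by simp
    ultimately show ?thesis using pq by simp
  qed
  thus "(l, m) \<in> spectral_curve L M" by (auto simp: spectral_curve_def)
qed

subsection \<open>Genus\<close>

lemma card_roots_rsquarefree:
  fixes p :: "complex poly"
  assumes "rsquarefree p"
  shows "card {z. poly p z = 0} = degree p"
proof -
  have p: "p \<noteq> 0" using assms by (auto simp: rsquarefree_def)
  have "degree p = degree (smult (lead_coeff p) (\<Prod>z|poly p z = 0. [:-z, 1:]))"
    using complex_poly_decompose_rsquarefree[OF assms] by simp
  also have "\<dots> = (\<Sum>z|poly p z = 0. degree [:-z, 1:])"
    using p by (simp add: degree_prod_eq_sum_degree)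
  finally show ?thesis by simp
qed

lemma degree_diff_const:
  fixes p :: "complex poly"
  shows "degree (p - [:c:]) = degree p"
proof (cases "degree p = 0")
  case False
  thus ?thesis
    using degree_add_eq_left[of "- [:c:]" p] unfolding diff_conv_add_uminus by simp
qed (auto elim: degree_eq_zeroE)

definition hyper_curve :: "complex poly \<Rightarrow> (complex \<times> complex) set" where
  "hyper_curve F = {(l, m). m\<^sup>2 = poly F l}"

definition curve_fun :: "complex poly \<Rightarrow> complex poly \<Rightarrow> complex poly \<Rightarrow> complex \<times> complex \<Rightarrow> complex" where
  "curve_fun F p q = (\<lambda>(l, m). if (l, m) \<in> hyper_curve F then poly p l + m * poly q l else 0)"

text \<open>At infinity \<open>l\<close> has a pole of order 2 and \<open>m\<close> one of order
  \<open>degree F\<close>. For odd \<open>degree F\<close> the two summands have poles of different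
  parity and cannot cancel. The case \<open>q = 0\<close> is separate because
  \<open>degree 0 = 0\<close> would still count the pole of \<open>m\<close>.\<close>

definition pole_order :: "complex poly \<Rightarrow> complex poly \<Rightarrow> complex poly \<Rightarrow> nat" where
  "pole_order F p q = max (2 * degree p) (if q = 0 then 0 else 2 * degree q + degree F)"

definition generic_fibre_card :: "(complex \<times> complex) set \<Rightarrow> (complex \<times> complex \<Rightarrow> complex) \<Rightarrow> nat \<Rightarrow> bool" where
  "generic_fibre_card C f d \<longleftrightarrow>
     (\<exists>S. finite S \<and> (\<forall>c. c \<notin> S \<longrightarrow> finite {p \<in> C. f p = c} \<and> card {p \<in> C. f p = c} = d))"

lemma generic_fibre_card_unique:
  assumes "generic_fibre_card C f d" "generic_fibre_card C f d'"
  shows "d = d'"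
proof -
  obtain S S' where S: "finite S" "finite S'"
     "\<And>c. c \<notin> S \<Longrightarrow> card {p \<in> C. f p = c} = d" "\<And>c. c \<notin> S' \<Longrightarrow> card {p \<in> C. f p = c} = d'"
    using assms unfolding generic_fibre_card_def by blast
  obtain c where "c \<notin> S \<union> S'"
    using S(1,2) ex_new_if_finite[of "S \<union> S'"] infinite_UNIV_char_0 by blast
  thus ?thesis using S by auto
qed

lemma finite_roots: "p \<noteq> 0 \<Longrightarrow> finite {z. poly p z = 0}" for p :: "complex poly"
  by (rule poly_roots_finite)

text \<open>For \<open>q = 0\<close> the norm is a perfect square, so the fibre is counted directly,
  with two points above each root of \<open>p - c\<close>.\<close>

lemma generic_fibre_polynomial:
  assumes F: "odd (degree F)"
  shows "generic_fibre_card (hyper_curve F) (curve_fun F p 0) (2 * degree p)"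
proof (cases "degree p = 0")
  case True
  then obtain k where "p = [:k:]" by (meson degree_eq_zeroE)
  hence *: "{x \<in> hyper_curve F. curve_fun F p 0 x = c} = {}" if "c \<notin> {k}" for c
    using that by (auto simp: curve_fun_def split: if_splits)
  have "finite {x \<in> hyper_curve F. curve_fun F p 0 x = c} \<and>
      card {x \<in> hyper_curve F. curve_fun F p 0 x = c} = 2 * degree p" if "c \<notin> {k}" for c
    unfolding *[OF that] using True by simp
  thus ?thesis unfolding generic_fibre_card_def by blast
next
  case False
  \<comment> \<open>Excluded are the critical values of \<open>p\<close>, where roots collide, and
    its values at zeros of \<open>F\<close>, where the two points above a root coincide.\<close>
  define S where "S = poly p ` {z. poly (pderiv p) z = 0} \<union> poly p ` {z. poly F z = 0}"
  have "pderiv p \<noteq> 0" using False by (auto simp: pderiv_eq_0_iff)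
  moreover have "F \<noteq> 0" using F by auto
  ultimately have "finite S" unfolding S_def by (auto intro: finite_roots)
  moreover have "finite {x \<in> hyper_curve F. curve_fun F p 0 x = c} \<and>
     card {x \<in> hyper_curve F. curve_fun F p 0 x = c} = 2 * degree p" if c: "c \<notin> S" for c
  proof -
    define Z where "Z = {z. poly (p - [:c:]) z = 0}"
    have p': "p - [:c:] \<noteq> 0" using False by auto
    have Z: "finite Z" unfolding Z_def by (rule finite_roots[OF p'])
    have "rsquarefree (p - [:c:])"
      using c unfolding rsquarefree_roots S_def by (auto simp: pderiv_diff pderiv_pCons)
    hence "card Z = degree (p - [:c:])" unfolding Z_def by (rule card_roots_rsquarefree)
    also have "\<dots> = degree p" by (rule degree_diff_const)
    finally have cZ: "card Z = degree p" .
    have "{x \<in> hyper_curve F. curve_fun F p 0 x = c} = (\<Union>z\<in>Z. {(z, csqrt (poly F z)), (z, - csqrt (poly F z))})"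
    proof -
      have "m\<^sup>2 = poly F l \<longleftrightarrow> m = csqrt (poly F l) \<or> m = - csqrt (poly F l)" for l m
        by (metis power2_csqrt power2_eq_iff)
      thus ?thesis unfolding Z_def curve_fun_def hyper_curve_def by auto
    qed
    moreover have "card (\<Union>z\<in>Z. {(z, csqrt (poly F z)), (z, - csqrt (poly F z))}) = (\<Sum>z\<in>Z. 2)"
    proof (subst card_UN_disjoint)
      have "csqrt (poly F z) \<noteq> - csqrt (poly F z)" if "z \<in> Z" for z
      proof -
        have "poly p z = c" using that by (simp add: Z_def)
        hence "poly F z \<noteq> 0" using c by (auto simp: S_def)
        thus ?thesis by (simp add: equation_minus_iff)
      qed
      thus "(\<Sum>z\<in>Z. card {(z, csqrt (poly F z)), (z, - csqrt (poly F z))}) = (\<Sum>z\<in>Z. 2)"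
        by (intro sum.cong) auto
    qed (use Z in auto)
    ultimately show ?thesis using Z cZ by simp
  qed
  ultimately show ?thesis unfolding generic_fibre_card_def by blast
qed

text \<open>The point \<open>(l, m)\<close> of the fibre over \<open>c\<close> is recovered from the root \<open>l\<close> of the norm
  \<open>(p - c)\<^sup>2 - q\<^sup>2 F\<close>, which for generic \<open>c\<close> is squarefree and has no root in common with \<open>q\<close>.\<close>

lemma generic_fibre:
  assumes F: "odd (degree F)"
  shows "generic_fibre_card (hyper_curve F) (curve_fun F p q) (pole_order F p q)"
proof (cases "q = 0")
  case True
  thus ?thesis using generic_fibre_polynomial[OF F] by (simp add: pole_order_def)
next
  case False
  define B where "B = q\<^sup>2 * F"
  have F0: "F \<noteq> 0" using F by auto
  have degB: "degree B = 2 * degree q + degree F"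
    using False F0 by (simp add: B_def degree_mult_eq degree_power_eq)
  have B0: "B \<noteq> 0" using False F0 by (simp add: B_def)
  \<comment> \<open>A multiple root of the norm satisfies \<open>(p - c)^2 = B\<close> and
    \<open>2 (p - c) p' = B'\<close>; eliminating \<open>c\<close> gives \<open>E = 0\<close>. Since
    \<open>degree B\<close> is odd, the two terms of \<open>E\<close> have degrees of different
    parity.\<close>
  define E where "E = 4 * B * (pderiv p)\<^sup>2 - (pderiv B)\<^sup>2"
  have dB: "pderiv B \<noteq> 0" using degB F by (auto simp: pderiv_eq_0_iff)
  have E0: "E \<noteq> 0"
  proof
    assume "E = 0"
    hence eq: "4 * B * (pderiv p)\<^sup>2 = (pderiv B)\<^sup>2" by (simp add: E_def)
    have "pderiv p \<noteq> 0" using eq dB by auto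
    hence "degree (4 * B * (pderiv p)\<^sup>2) = degree B + 2 * degree (pderiv p)"
      using B0 by (simp add: degree_mult_eq degree_power_eq numeral_poly)
    moreover have "degree ((pderiv B)\<^sup>2) = 2 * degree (pderiv B)"
      using dB by (simp add: degree_power_eq)
    ultimately have "degree B + 2 * degree (pderiv p) = 2 * degree (pderiv B)"
      using eq by simp
    thus False using degB F by presburger
  qed
  \<comment> \<open>The first set keeps \<open>q\<close> nonzero on the fibre; the second contains
    every \<open>c\<close> for which a zero of \<open>E\<close> is a root of the norm.\<close>
  define S where "S = poly p ` {z. poly q z = 0} \<union>
     (\<Union>z\<in>{z. poly E z = 0}. {poly p z - csqrt (poly B z), poly p z + csqrt (poly B z)})"
  have "finite S" using finite_roots[OF False] finite_roots[OF E0] by (auto simp: S_def)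
  moreover have "finite {x \<in> hyper_curve F. curve_fun F p q x = c} \<and>
     card {x \<in> hyper_curve F. curve_fun F p q x = c} = pole_order F p q" if c: "c \<notin> S" for c
  proof -
    define R where "R = (p - [:c:])\<^sup>2 - B"
    note dp = degree_diff_const[of p c]
    have dp2: "degree ((p - [:c:])\<^sup>2) = 2 * degree p"
      using dp by (cases "p - [:c:] = 0") (simp_all add: degree_power_eq)
    have degR: "degree R = pole_order F p q"
    proof (cases "2 * degree p < degree B")
      case True
      hence "degree R = degree B"
        using dp2 degree_add_eq_left[of "(p - [:c:])\<^sup>2" "- B"] by (simp add: R_def)
      thus ?thesis using True False by (simp add: pole_order_def degB)
    next
      case False': False
      hence "degree B < 2 * degree p" using degB F by presburger
      moreover from this have "degree R = 2 * degree p"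
        using dp2 degree_add_eq_left[of "- B" "(p - [:c:])\<^sup>2"] by (simp add: R_def)
      ultimately show ?thesis using False by (simp add: pole_order_def degB)
    qed
    have "rsquarefree R"
      unfolding rsquarefree_roots
    proof clarify
      fix z assume z: "poly R z = 0" "poly (pderiv R) z = 0"
      have 1: "(poly p z - c)\<^sup>2 = poly B z" using z(1) by (simp add: R_def)
      have "pderiv R = 2 * (p - [:c:]) * pderiv p - pderiv B"
        unfolding R_def power2_eq_square pderiv_mult pderiv_diff by (simp add: pderiv_pCons algebra_simps)
      hence "poly (pderiv R) z = 2 * (poly p z - c) * poly (pderiv p) z - poly (pderiv B) z"
        by (simp only: poly_diff poly_mult) (simp add: numeral_poly)
      hence 2: "2 * (poly p z - c) * poly (pderiv p) z = poly (pderiv B) z"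
        using z(2) by simp
      have "poly E z = 4 * (poly p z - c)\<^sup>2 * (poly (pderiv p) z)\<^sup>2 - (2 * (poly p z - c) * poly (pderiv p) z)\<^sup>2"
        unfolding 1 2 by (simp add: E_def numeral_poly)
      hence "poly E z = 0" by (simp add: power2_eq_square algebra_simps)
      moreover have "poly p z - c = csqrt (poly B z) \<or> poly p z - c = - csqrt (poly B z)"
        using 1 by (metis power2_csqrt power2_eq_iff)
      hence "c = poly p z - csqrt (poly B z) \<or> c = poly p z + csqrt (poly B z)"
        by (auto simp: algebra_simps)
      ultimately show False using c by (auto simp: S_def)
    qed
    hence cR: "card {z. poly R z = 0} = pole_order F p q" and R0: "R \<noteq> 0"
      using card_roots_rsquarefree degR by (auto simp: rsquarefree_def)
    have bij: "bij_betw fst {x \<in> hyper_curve F. curve_fun F p q x = c} {z. poly R z = 0}"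
    proof (rule bij_betw_byWitness[of _ "\<lambda>z. (z, (c - poly p z) / poly q z)"])
      have ev: "poly R z = (poly p z - c)\<^sup>2 - (poly q z)\<^sup>2 * poly F z" for z
        by (simp add: R_def B_def)
      have qnz: "poly q z \<noteq> 0" if "poly R z = 0" for z
      proof
        assume q: "poly q z = 0"
        hence "poly p z = c" using that ev by simp
        thus False using c q by (auto simp: S_def)
      qed
      have fib: "poly R l = 0 \<and> (c - poly p l) / poly q l = m" if "(l, m) \<in> hyper_curve F" "curve_fun F p q (l, m) = c" for l m
      proof -
        have 1: "m\<^sup>2 = poly F l" "c = poly p l + m * poly q l"
          using that by (auto simp: hyper_curve_def curve_fun_def)
        have "poly R l = 0" unfolding ev 1(2) 1(1)[symmetric] by (simp add: power2_eq_square)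
        thus ?thesis using qnz[of l] 1 by simp
      qed
      show "\<forall>a\<in>{x \<in> hyper_curve F. curve_fun F p q x = c}. (fst a, (c - poly p (fst a)) / poly q (fst a)) = a"
        "fst ` {x \<in> hyper_curve F. curve_fun F p q x = c} \<subseteq> {z. poly R z = 0}"
        using fib by auto
      show "(\<lambda>z. (z, (c - poly p z) / poly q z)) ` {z. poly R z = 0} \<subseteq> {x \<in> hyper_curve F. curve_fun F p q x = c}"
      proof (clarify, intro conjI)
        fix z assume z: "poly R z = 0"
        note q = qnz[OF z]
        have "(poly p z - c)\<^sup>2 = (poly q z)\<^sup>2 * poly F z" using z ev by simp
        hence "((c - poly p z) / poly q z)\<^sup>2 = poly F z"
          using q by (simp add: power_divide power2_commute)
        thus "(z, (c - poly p z) / poly q z) \<in> hyper_curve F" by (simp add: hyper_curve_def)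
        thus "curve_fun F p q (z, (c - poly p z) / poly q z) = c" using q by (simp add: curve_fun_def)
      qed
    qed simp
    thus ?thesis
      using bij_betw_same_card[OF bij] bij_betw_finite[OF bij] cR finite_roots[OF R0] by argo
  qed
  ultimately show ?thesis unfolding generic_fibre_card_def by blast
qed

lemma functions_pole_le_hyper_curve:
  assumes F: "odd (degree F)"
  shows "functions_pole_le (hyper_curve F) n = {curve_fun F p q | p q. pole_order F p q \<le> n}"
proof (intro equalityI subsetI)
  fix f assume "f \<in> functions_pole_le (hyper_curve F) n"
  then obtain Q d where Q: "\<And>l m. f (l, m) = (if (l, m) \<in> hyper_curve F then poly2_eval Q l m else 0)"
    and d: "d \<le> n" "generic_fibre_card (hyper_curve F) f d"
    unfolding functions_pole_le_def generic_fibre_card_def by blast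
  obtain p q where "\<And>l m. m\<^sup>2 = poly F l \<Longrightarrow> poly2_eval Q l m = poly p l + m * poly q l"
    using curve_reduction[of F Q] by blast
  hence f: "f = curve_fun F p q"
    by (auto simp: Q curve_fun_def hyper_curve_def)
  hence "d = pole_order F p q" using d generic_fibre[OF F] generic_fibre_card_unique by blast
  thus "f \<in> {curve_fun F p q | p q. pole_order F p q \<le> n}" using f d by blast
next
  fix f assume "f \<in> {curve_fun F p q | p q. pole_order F p q \<le> n}"
  then obtain p q where f: "f = curve_fun F p q" "pole_order F p q \<le> n" by blast
  have "f (l, m) = (if (l, m) \<in> hyper_curve F then poly2_eval [:p, q:] l m else 0)" for l m
    by (simp add: f curve_fun_def poly2_eval_def)
  thus "f \<in> functions_pole_le (hyper_curve F) n"
    using f generic_fibre[OF F, of p q] unfolding functions_pole_le_def generic_fibre_card_def by blast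
qed

text \<open>Evaluation at both points above \<open>l\<close> separates the part that is even in
  \<open>m\<close> from the odd one.\<close>

lemma curve_fun_eq_0:
  assumes F: "F \<noteq> 0" and z: "\<And>x. curve_fun F p q x = 0"
  shows "p = 0 \<and> q = 0"
proof -
  have *: "poly p l = 0 \<and> csqrt (poly F l) * poly q l = 0" for l
    using z[of "(l, csqrt (poly F l))"] z[of "(l, - csqrt (poly F l))"]
    by (auto simp: curve_fun_def hyper_curve_def)
  have "p = 0" using * by (metis poly_all_0_iff_0)
  moreover have "poly (q * F) l = 0" for l using *[of l] by auto
  hence "q * F = 0" by (metis poly_all_0_iff_0)
  ultimately show ?thesis using F by simp
qed

text \<open>The choices of \<open>p\<close> and \<open>q\<close> have dimensions
  \<open>n div 2 + 1\<close> and \<open>(n - (2 * g + 1)) div 2 + 1\<close>. As \<open>n\<close> and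
  \<open>n - (2 * g + 1)\<close> have opposite parity, exactly one division loses a half, and the
  sum is \<open>n + 1 - g\<close>.\<close>

lemma has_genus_hyper_curve:
  assumes F: "degree F = 2 * g + 1"
  shows "has_genus (hyper_curve F) g"
  unfolding has_genus_def eventually_sequentially
proof (intro exI[of _ "2 * g + 1"] allI impI)
  fix n assume n: "n \<ge> 2 * g + 1"
  define a where "a = n div 2"
  define b where "b = (n - (2 * g + 1)) div 2"
  define I where "I = {..a} <+> {..b}"
  define e where "e i = (case i of Inl k \<Rightarrow> curve_fun F (monom 1 k) 0 | Inr k \<Rightarrow> curve_fun F 0 (monom 1 k))" for i
  have po: "pole_order F p q \<le> n \<longleftrightarrow> degree p \<le> a \<and> degree q \<le> b" for p q
  proof -
    have "2 * degree p \<le> n \<longleftrightarrow> degree p \<le> a" unfolding a_def by presburger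
    moreover have "(if q = 0 then 0 else 2 * degree q + degree F) \<le> n \<longleftrightarrow> degree q \<le> b"
    proof (cases "q = 0")
      case False
      thus ?thesis using n F unfolding b_def by simp presburger
    qed simp
    ultimately show ?thesis unfolding pole_order_def by simp
  qed
  have odd: "odd (degree F)" and F0: "F \<noteq> 0" using F by auto
  have expand: "(\<Sum>i\<in>I. c i * e i x) = curve_fun F (\<Sum>k\<le>a. monom (c (Inl k)) k) (\<Sum>k\<le>b. monom (c (Inr k)) k) x" for c x
    by (cases x) (simp add: I_def sum.Plus e_def curve_fun_def poly_sum poly_monom sum_distrib_left mult_ac)
  have cs: "coeff (\<Sum>k\<le>m. monom (c k) k) j = (if j \<le> m then c j else 0)" for c :: "nat \<Rightarrow> complex" and m j
    by (simp add: coeff_sum)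
  have "cfun.dim (functions_pole_le (hyper_curve F) n) = card I"
  proof (rule cfun_dim_eqI)
    show "finite I" by (simp add: I_def)
    show "functions_pole_le (hyper_curve F) n = {f. \<exists>c. \<forall>x. f x = (\<Sum>i\<in>I. c i * e i x)}"
      unfolding expand functions_pole_le_hyper_curve[OF odd] po
    proof (intro equalityI subsetI; clarify)
      fix p q :: "complex poly" assume d: "degree p \<le> a" "degree q \<le> b"
      define c where "c i = (case i of Inl k \<Rightarrow> coeff p k | Inr k \<Rightarrow> coeff q k)" for i
      show "\<exists>c. \<forall>x. curve_fun F p q x = curve_fun F (\<Sum>k\<le>a. monom (c (Inl k)) k) (\<Sum>k\<le>b. monom (c (Inr k)) k) x"
        using d by (intro exI[of _ c]) (simp add: c_def poly_as_sum_of_monoms')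
    next
      fix f c assume "\<forall>x. f x = curve_fun F (\<Sum>k\<le>a. monom (c (Inl k)) k) (\<Sum>k\<le>b. monom (c (Inr k)) k) x"
      hence "f = curve_fun F (\<Sum>k\<le>a. monom (c (Inl k)) k) (\<Sum>k\<le>b. monom (c (Inr k)) k)" by auto
      moreover have "degree (\<Sum>k\<le>m. monom (c k) k) \<le> m" for m and c :: "nat \<Rightarrow> complex"
        by (rule degree_le) (simp add: cs)
      ultimately show "\<exists>p q. f = curve_fun F p q \<and> degree p \<le> a \<and> degree q \<le> b"
        by (intro exI conjI)
    qed
    fix c assume "\<And>x. (\<Sum>i\<in>I. c i * e i x) = 0"
    hence "(\<Sum>k\<le>a. monom (c (Inl k)) k) = 0 \<and> (\<Sum>k\<le>b. monom (c (Inr k)) k) = 0"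
      unfolding expand by (rule curve_fun_eq_0[OF F0])
    thus "\<forall>i\<in>I. c i = 0"
      using cs[where m = a and c = "\<lambda>k. c (Inl k)"] cs[where m = b and c = "\<lambda>k. c (Inr k)"] unfolding I_def
      by (metis (no_types, lifting) PlusE atMost_iff coeff_0)
  qed
  also have "card I = Suc a + Suc b" by (simp add: I_def card_Plus)
  finally show "cfun.dim (functions_pole_le (hyper_curve F) n) + g = n + 1"
    using n unfolding a_def b_def by presburger
qed

subsection \<open>Linear systems of differential equations on a disc\<close>

text \<open>The Taylor coefficients forced by the system \<open>y' = B y\<close> with initial value
  \<open>v\<close>, read off from the Cauchy product.\<close>

fun system_coeff :: "nat \<Rightarrow> (nat \<Rightarrow> nat \<Rightarrow> complex fps) \<Rightarrow> (nat \<Rightarrow> complex) \<Rightarrow> nat \<Rightarrow> nat \<Rightarrow> complex" where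
  "system_coeff n B v 0 i = v i"
| "system_coeff n B v (Suc k) i =
     (\<Sum>j<n. \<Sum>m\<le>k. system_coeff n B v m j * fps_nth (B i j) (k - m)) / of_nat (Suc k)"

text \<open>With \<open>S k\<close> the sum of the norms of the coefficients up to \<open>k\<close>, weighted by powers of a
  radius \<open>\<rho>\<close> inside the disc of convergence of \<open>B\<close>, the recursion gives
  \<open>S (k + 1) \<le> (1 + C / (k + 1)) S k\<close>, so that \<open>S\<close> grows subexponentially.\<close>

lemma system_coeff_summable:
  assumes B: "\<And>i j. i < n \<Longrightarrow> j < n \<Longrightarrow> fps_conv_radius (B i j) \<ge> R"
    and t: "0 < t" "ereal t < R" and i: "i < n"
  shows "summable (\<lambda>k. system_coeff n B v k i * of_real t ^ k)"
proof -
  let ?Y = "system_coeff n B v"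
  obtain \<rho> where \<rho>: "t < \<rho>" "ereal \<rho> < R" using ereal_dense2[OF t(2)] by auto
  have \<rho>0: "\<rho> > 0" using \<rho> t by simp
  have "\<exists>K. \<forall>k. norm (fps_nth (B i j) k) * \<rho> ^ k \<le> K" if "i < n" "j < n" for i j
  proof -
    have "ereal (norm (of_real \<rho> :: complex)) < fps_conv_radius (B i j)"
      using \<rho> \<rho>0 B[OF that] by (simp add: less_le_trans)
    hence "summable (\<lambda>k. fps_nth (B i j) k * of_real \<rho> ^ k)" by (rule summable_fps)
    hence "Bseq (\<lambda>k. fps_nth (B i j) k * of_real \<rho> ^ k)"
      by (meson convergent_imp_Bseq convergentI summable_LIMSEQ_zero)
    then obtain K where "\<And>k. norm (fps_nth (B i j) k * of_real \<rho> ^ k) \<le> K"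
      unfolding Bseq_def by blast
    thus ?thesis using \<rho>0 by (intro exI[of _ K]) (simp add: norm_mult norm_power)
  qed
  then obtain K' where K': "\<And>i j k. i < n \<Longrightarrow> j < n \<Longrightarrow> norm (fps_nth (B i j) k) * \<rho> ^ k \<le> K' i j"
    by metis
  define K where "K = (\<Sum>i<n. \<Sum>j<n. \<bar>K' i j\<bar>)"
  have K: "norm (fps_nth (B i j) k) * \<rho> ^ k \<le> K" if "i < n" "j < n" for i j k
  proof -
    have "norm (fps_nth (B i j) k) * \<rho> ^ k \<le> \<bar>K' i j\<bar>" using K'[OF that, of k] by simp
    also have "\<dots> \<le> (\<Sum>j<n. \<bar>K' i j\<bar>)" using that by (intro member_le_sum) auto
    also have "\<dots> \<le> K" unfolding K_def using that by (intro member_le_sum[of i "{..<n}" "\<lambda>i. \<Sum>j<n. \<bar>K' i j\<bar>"]) (auto intro: sum_nonneg)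
    finally show ?thesis .
  qed
  have K0: "K \<ge> 0" by (simp add: K_def sum_nonneg)
  define w where "w k = (\<Sum>i<n. norm (?Y k i)) * \<rho> ^ k" for k
  define S where "S k = (\<Sum>m\<le>k. w m)" for k
  define C where "C = of_nat n * K * \<rho>"
  have C0: "C \<ge> 0" using K0 \<rho>0 by (simp add: C_def)
  have w0: "w k \<ge> 0" for k using \<rho>0 by (simp add: w_def sum_nonneg)
  have wS: "w k \<le> S k" for k unfolding S_def using w0 by (intro member_le_sum) auto
  have S0: "S k \<ge> 0" for k using wS w0 order_trans by blast
  have step: "w (Suc k) \<le> C / of_nat (Suc k) * S k" for k
  proof -
    have "norm (?Y (Suc k) i) * \<rho> ^ Suc k \<le> K * \<rho> / of_nat (Suc k) * S k" if i: "i < n" for i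
    proof -
      have "norm (?Y (Suc k) i) * \<rho> ^ Suc k =
          norm (\<Sum>j<n. \<Sum>m\<le>k. ?Y m j * fps_nth (B i j) (k - m)) * \<rho> ^ Suc k / of_nat (Suc k)"
        by (simp add: norm_divide del: of_nat_Suc)
      also have "\<dots> \<le> (\<Sum>j<n. \<Sum>m\<le>k. norm (?Y m j) * norm (fps_nth (B i j) (k - m))) * \<rho> ^ Suc k / of_nat (Suc k)"
        using \<rho>0 by (intro divide_right_mono mult_right_mono order_trans[OF norm_sum] sum_mono)
           (auto simp: norm_mult intro!: order_trans[OF norm_sum] sum_mono)
      also have "(\<Sum>j<n. \<Sum>m\<le>k. norm (?Y m j) * norm (fps_nth (B i j) (k - m))) * \<rho> ^ Suc k
         = (\<Sum>j<n. \<Sum>m\<le>k. norm (?Y m j) * \<rho> ^ m * (norm (fps_nth (B i j) (k - m)) * \<rho> ^ (k - m))) * \<rho>"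
      proof -
        have "\<rho> ^ Suc k = \<rho> ^ m * \<rho> ^ (k - m) * \<rho>" if "m \<le> k" for m
          using that by (simp flip: power_add)
        thus ?thesis unfolding sum_distrib_right by (intro sum.cong refl) simp
      qed
      also have "\<dots> \<le> (\<Sum>j<n. \<Sum>m\<le>k. norm (?Y m j) * \<rho> ^ m * K) * \<rho>"
        using \<rho>0 i K by (intro mult_right_mono sum_mono mult_left_mono) auto
      also have "(\<Sum>j<n. \<Sum>m\<le>k. norm (?Y m j) * \<rho> ^ m * K) = K * S k"
        unfolding S_def w_def sum_distrib_left sum_distrib_right
        by (subst sum.swap) (simp add: mult_ac)
      finally show ?thesis by (simp add: mult_ac divide_right_mono)
    qed
    hence "w (Suc k) \<le> (\<Sum>i<n. K * \<rho> / of_nat (Suc k) * S k)"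
      unfolding w_def sum_distrib_right by (intro sum_mono) auto
    thus ?thesis by (simp add: C_def mult_ac del: of_nat_Suc)
  qed
  \<comment> \<open>The terms at radius \<open>t\<close> are bounded by \<open>S k * q ^ k\<close>.
    With \<open>c\<close> halfway between \<open>q\<close> and 1, the growth factor
    \<open>1 + C / (k + 1)\<close> is at most \<open>c / q\<close> from \<open>N\<close> on, and the
    ratio test applies.\<close>
  define q where "q = t / \<rho>"
  have q: "0 < q" "q < 1" using t \<rho> by (auto simp: q_def)
  define c where "c = (1 + q) / 2"
  have c: "c < 1" "q < c" using q by (auto simp: c_def)
  obtain N where N: "real N > q * C / (c - q)" using reals_Archimedean2 by blast
  have "summable (\<lambda>k. S k * q ^ k)"
  proof (rule summable_ratio_test[OF c(1)])
    fix k assume k: "k \<ge> N"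
    have "S (Suc k) \<le> S k * (1 + C / of_nat (Suc k))"
      using step[of k] by (simp add: S_def algebra_simps)
    hence "S (Suc k) * q ^ Suc k \<le> S k * (1 + C / of_nat (Suc k)) * q ^ Suc k"
      using q by (intro mult_right_mono) auto
    moreover have "q * (1 + C / of_nat (Suc k)) \<le> c"
    proof -
      have "q * C / (c - q) \<le> real (Suc k)" using N k by linarith
      hence "q * C \<le> (c - q) * real (Suc k)" using c by (simp add: pos_divide_le_eq mult.commute)
      hence "q * C / real (Suc k) \<le> c - q" by (simp add: pos_divide_le_eq del: of_nat_Suc)
      thus ?thesis by (simp add: distrib_left)
    qed
    hence "S k * (1 + C / of_nat (Suc k)) * q ^ Suc k \<le> c * (S k * q ^ k)"
      using S0[of k] q mult_right_mono[of "q * (1 + C / of_nat (Suc k))" c "S k * q ^ k"]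
      by (simp add: mult_ac)
    ultimately have "S (Suc k) * q ^ Suc k \<le> c * (S k * q ^ k)"
      by (rule order_trans)
    moreover have "norm (S k * q ^ k) = S k * q ^ k" for k
      using S0[of k] q by (simp add: abs_mult)
    ultimately show "norm (S (Suc k) * q ^ Suc k) \<le> c * norm (S k * q ^ k)"
      by (simp only:)
  qed
  thus ?thesis
  proof (rule summable_comparison_test'[where N = 0])
    fix k
    have "norm (?Y k i) * \<rho> ^ k \<le> w k"
      unfolding w_def using i \<rho>0 by (intro mult_right_mono member_le_sum) auto
    hence "norm (?Y k i) * \<rho> ^ k * q ^ k \<le> S k * q ^ k"
      using wS[of k] q by (intro mult_right_mono) auto
    thus "norm (?Y k i * of_real t ^ k) \<le> S k * q ^ k"
      using \<rho>0 t by (simp add: q_def norm_mult norm_power power_divide)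
  qed
qed

lemma eval_fps_sum:
  fixes z :: complex
  assumes "finite A" "\<And>a. a \<in> A \<Longrightarrow> ereal (norm z) < fps_conv_radius (F a)"
  shows "ereal (norm z) < fps_conv_radius (sum F A) \<and> eval_fps (sum F A) z = (\<Sum>a\<in>A. eval_fps (F a) z)"
  using assms
proof (induction A rule: finite_induct)
  case (insert a A)
  hence "ereal (norm z) < min (fps_conv_radius (F a)) (fps_conv_radius (sum F A))" by simp
  hence "ereal (norm z) < fps_conv_radius (F a + sum F A)"
    by (rule less_le_trans) (rule fps_conv_radius_add)
  thus ?case using insert by (simp add: eval_fps_add)
qed simp

text \<open>The power series of the solution converges on every disc on which those of the
  coefficients do, so the solution exists on the whole disc and not merely near
  \<open>x0\<close>.\<close>

lemma linear_system_solution: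
  fixes a :: "nat \<Rightarrow> nat \<Rightarrow> complex \<Rightarrow> complex"
  assumes a: "\<And>i j. i < n \<Longrightarrow> j < n \<Longrightarrow> a i j holomorphic_on ball x0 e" and e: "e > 0"
  shows "\<exists>y. \<forall>i<n. y i holomorphic_on ball x0 e \<and> y i x0 = v i \<and>
     (\<forall>x\<in>ball x0 e. deriv (y i) x = (\<Sum>j<n. a i j x * y j x))"
proof -
  define B where "B i j = fps_expansion (a i j) x0" for i j
  have B: "fps_conv_radius (B i j) \<ge> ereal e" if "i < n" "j < n" for i j
    unfolding B_def using a[OF that] by (intro conv_radius_fps_expansion) simp
  define G where "G i = Abs_fps (\<lambda>k. system_coeff n B v k i)" for i
  have G: "fps_conv_radius (G i) \<ge> ereal e" if "i < n" for i
    unfolding fps_conv_radius_def G_def fps_nth_Abs_fps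
    using system_coeff_summable[OF B _ _ that] by (intro conv_radius_geI_ex')
  have dG: "fps_deriv (G i) = (\<Sum>j<n. G j * B i j)" for i
  proof (rule fps_ext)
    fix k
    show "fps_nth (fps_deriv (G i)) k = fps_nth (\<Sum>j<n. G j * B i j) k"
      by (simp add: fps_sum_nth fps_mult_nth G_def atLeast0AtMost del: of_nat_Suc)
  qed
  define y where "y i x = eval_fps (G i) (x - x0)" for i x
  have nrm: "ereal (norm (x - x0)) < ereal e" if "x \<in> ball x0 e" for x
    using that by (simp add: dist_norm norm_minus_commute)
  have rG: "ereal (norm (x - x0)) < fps_conv_radius (G i)" if "x \<in> ball x0 e" "i < n" for x i
    using nrm G that by (meson less_le_trans)
  have rB: "ereal (norm (x - x0)) < fps_conv_radius (B i j)" if "x \<in> ball x0 e" "i < n" "j < n" for x i j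
    using nrm B that by (meson less_le_trans)
  have "y i holomorphic_on ball x0 e \<and> y i x0 = v i \<and>
     (\<forall>x\<in>ball x0 e. deriv (y i) x = (\<Sum>j<n. a i j x * y j x))" if i: "i < n" for i
  proof (intro conjI ballI)
    have d: "(y i has_field_derivative eval_fps (fps_deriv (G i)) (x - x0)) (at x)" if x: "x \<in> ball x0 e" for x
    proof -
      have "(eval_fps (G i) has_field_derivative eval_fps (fps_deriv (G i)) (x - x0)) (at (x - x0))"
        using nrm[OF x] G[OF i] by (intro has_field_derivative_eval_fps) (rule less_le_trans)
      moreover have "((\<lambda>x. x - x0) has_field_derivative 1) (at x)"
        by (auto intro!: derivative_eq_intros)
      ultimately show ?thesis
        unfolding y_def using DERIV_chain2[where f = "eval_fps (G i)" and g = "\<lambda>x. x - x0"] by fastforce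
    qed
    thus "y i holomorphic_on ball x0 e"
      unfolding holomorphic_on_open[OF open_ball] using d by blast
    show "y i x0 = v i" by (simp add: y_def eval_fps_at_0 G_def)
    fix x assume x: "x \<in> ball x0 e"
    have "deriv (y i) x = eval_fps (\<Sum>j<n. G j * B i j) (x - x0)"
      using DERIV_imp_deriv[OF d[OF x]] by (simp add: dG)
    also have "\<dots> = (\<Sum>j<n. eval_fps (G j * B i j) (x - x0))"
    proof (rule eval_fps_sum[THEN conjunct2])
      fix j assume "j \<in> {..<n}"
      hence "ereal (norm (x - x0)) < min (fps_conv_radius (G j)) (fps_conv_radius (B i j))"
        using rG[OF x] rB[OF x i] by simp
      thus "ereal (norm (x - x0)) < fps_conv_radius (G j * B i j)"
        by (rule less_le_trans) (rule fps_conv_radius_mult)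
    qed simp
    also have "\<dots> = (\<Sum>j<n. a i j x * y j x)"
    proof (rule sum.cong)
      fix j assume j: "j \<in> {..<n}"
      have "eval_fps (B i j) (x - x0) = a i j x"
        unfolding B_def using a[of i j] i j x
        by (subst eval_fps_expansion'[of _ _ "ereal e"]) (use nrm[OF x] in auto)
      moreover have "eval_fps (G j * B i j) (x - x0) = eval_fps (G j) (x - x0) * eval_fps (B i j) (x - x0)"
        using rG[OF x] rB[OF x i] j by (intro eval_fps_mult) auto
      ultimately show "eval_fps (G j * B i j) (x - x0) = a i j x * y j x"
        by (simp add: y_def)
    qed simp
    finally show "deriv (y i) x = (\<Sum>j<n. a i j x * y j x)" .
  qed
  thus ?thesis by blast
qed

subsection \<open>Solutions of a scalar equation on a disc\<close>

definition eigenspace :: "complex set \<Rightarrow> diffop \<Rightarrow> complex \<Rightarrow> (complex \<Rightarrow> complex) set" where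
  "eigenspace U L l = {f. f holomorphic_on U \<and> (\<forall>x. x \<notin> U \<longrightarrow> f x = 0) \<and> (\<forall>x\<in>U. op_apply L f x = l * f x)}"

lemma op_apply_upto: "op_order P \<le> n \<Longrightarrow> op_apply P f x = (\<Sum>i\<le>n. poly (op_coeff P i) x * (deriv ^^ i) f x)"
  using op_apply_altdef[of "op_poly P" n f x] by (simp add: op_order_def op_coeff_def)

lemma op_apply_d_power: "op_apply (op_d ^ j) h x = (deriv ^^ j) h x"
proof -
  have "op_apply (op_d ^ j) h x = (\<Sum>i\<le>j. poly (coeff (monom 1 j) i) x * (deriv ^^ i) h x)"
    by (simp only: op_d_power op_apply_altdef degree_monom_le)
  also have "\<dots> = (\<Sum>i\<le>j. if i = j then (deriv ^^ j) h x else 0)"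
    by (intro sum.cong) auto
  finally show ?thesis by simp
qed

lemma op_apply_cong_open:
  assumes "open U" "f holomorphic_on U" "\<And>y. y \<in> U \<Longrightarrow> f y = g y" "x \<in> U"
  shows "op_apply P f x = op_apply P g x"
proof -
  have "g holomorphic_on U" using assms(2,3) by (metis holomorphic_cong)
  hence "(deriv ^^ i) f x = (deriv ^^ i) g x" for i
    using assms by (intro higher_deriv_transform_within_open[of f U g]) auto
  thus ?thesis by (simp add: op_apply_def)
qed

lemma higher_deriv_lincomb:
  assumes "open U" "x \<in> U" "\<And>k. k \<in> A \<Longrightarrow> f k holomorphic_on U"
  shows "(deriv ^^ i) (\<lambda>x. \<Sum>k\<in>A. c k * f k x) x = (\<Sum>k\<in>A. c k * (deriv ^^ i) (f k) x)"
  using assms(3)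
proof (induction A rule: infinite_finite_induct)
  case (insert a A)
  have "(deriv ^^ i) (\<lambda>x. c a * f a x + (\<Sum>k\<in>A. c k * f k x)) x =
      (deriv ^^ i) (\<lambda>x. c a * f a x) x + (deriv ^^ i) (\<lambda>x. \<Sum>k\<in>A. c k * f k x) x"
    using assms insert.prems by (intro higher_deriv_add[of _ U]) (auto intro!: holomorphic_intros)
  thus ?case
    using insert assms higher_deriv_cmult[of "f a" U x i "c a"] by simp
qed simp_all

lemma op_apply_lincomb:
  assumes "open U" "x \<in> U" "\<And>k. k \<in> A \<Longrightarrow> f k holomorphic_on U"
  shows "op_apply P (\<lambda>x. \<Sum>k\<in>A. c k * f k x) x = (\<Sum>k\<in>A. c k * op_apply P (f k) x)"
proof -
  have "op_apply P (\<lambda>x. \<Sum>k\<in>A. c k * f k x) x =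
      (\<Sum>i\<le>op_order P. \<Sum>k\<in>A. c k * (poly (op_coeff P i) x * (deriv ^^ i) (f k) x))"
    unfolding op_apply_def
  proof (intro sum.cong refl)
    fix i
    have "(deriv ^^ i) (\<lambda>x. \<Sum>k\<in>A. c k * f k x) x = (\<Sum>k\<in>A. c k * (deriv ^^ i) (f k) x)"
      by (rule higher_deriv_lincomb) (fact assms)+
    thus "poly (op_coeff P i) x * (deriv ^^ i) (\<lambda>x. \<Sum>k\<in>A. c k * f k x) x =
        (\<Sum>k\<in>A. c k * (poly (op_coeff P i) x * (deriv ^^ i) (f k) x))"
      by (simp add: sum_distrib_left mult_ac)
  qed
  also have "\<dots> = (\<Sum>k\<in>A. c k * op_apply P (f k) x)"
    unfolding op_apply_def sum_distrib_left by (rule sum.swap)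
  finally show ?thesis .
qed

lemma lincomb2:
  assumes "open U" "x \<in> U" "f holomorphic_on U" "g holomorphic_on U"
  shows "(deriv ^^ i) (\<lambda>x. a * f x + b * g x) x = a * (deriv ^^ i) f x + b * (deriv ^^ i) g x"
    and "op_apply P (\<lambda>x. a * f x + b * g x) x = a * op_apply P f x + b * op_apply P g x"
proof -
  have "(if k then f else g) holomorphic_on U" for k using assms by simp
  note * = this assms(1,2)
  show "(deriv ^^ i) (\<lambda>x. a * f x + b * g x) x = a * (deriv ^^ i) f x + b * (deriv ^^ i) g x"
    using higher_deriv_lincomb[OF *(2,3), of UNIV "\<lambda>k. if k then f else g" i "\<lambda>k. if k then a else b"] *(1)
    by (simp add: UNIV_bool add.commute)
  show "op_apply P (\<lambda>x. a * f x + b * g x) x = a * op_apply P f x + b * op_apply P g x"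
    using op_apply_lincomb[OF *(2,3), of UNIV "\<lambda>k. if k then f else g" P "\<lambda>k. if k then a else b"] *(1)
    by (simp add: UNIV_bool add.commute)
qed

lemma op_apply_cmult:
  assumes "open U" "x \<in> U" "f holomorphic_on U"
  shows "op_apply P (\<lambda>x. c * f x) x = c * op_apply P f x"
  using lincomb2(2)[OF assms assms(3), of P c 0] by simp

lemma eigenspace_lincomb2:
  assumes "open U" "f \<in> eigenspace U L l" "g \<in> eigenspace U L l"
  shows "(\<lambda>x. a * f x + b * g x) \<in> eigenspace U L l"
  using assms lincomb2(2)[OF assms(1), of _ f g L a b]
  by (auto simp: eigenspace_def algebra_simps intro!: holomorphic_intros)

lemma op_apply_poly_at_op:
  assumes "open U" "f \<in> eigenspace U L l" "x \<in> U"
  shows "op_apply (poly_at_op p L) f x = poly p l * f x"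
  using assms(3)
proof (induction p arbitrary: x)
  case 0
  thus ?case by (simp add: zero_diffop_def)
next
  case (pCons c p)
  have f: "f holomorphic_on U" "\<And>x. x \<in> U \<Longrightarrow> op_apply L f x = l * f x"
    using assms(2) by (auto simp: eigenspace_def)
  have "op_apply (L * poly_at_op p L) f x = op_apply L (op_apply (poly_at_op p L) f) x"
    by (rule op_apply_mult[OF assms(1) f(1) pCons.prems])
  also have "\<dots> = op_apply L (\<lambda>x. poly p l * f x) x"
    using pCons by (intro op_apply_cong_open[OF assms(1) holomorphic_on_op_apply[OF assms(1) f(1)]]) auto
  also have "\<dots> = poly p l * (l * f x)"
    using op_apply_cmult[OF assms(1) pCons.prems f(1)] f(2)[OF pCons.prems] by simp
  finally have 1: "op_apply (L * poly_at_op p L) f x = poly p l * (l * f x)" .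
  have 2: "op_apply (op_const c) f x = c * f x"
    by (simp add: op_apply_def op_coeff_def)
  have 3: "op_apply (P + Q) f x = op_apply P f x + op_apply Q f x" for P Q
    using op_apply_add[of "op_poly P" "op_poly Q" f x] by (simp add: plus_diffop_def)
  show ?case unfolding poly_at_op_pCons 1 2 3 by (simp add: algebra_simps)
qed

lemma eigenspace_lincomb:
  assumes "open U" "\<And>k. k \<in> A \<Longrightarrow> f k \<in> eigenspace U L l"
  shows "(\<lambda>x. \<Sum>k\<in>A. c k * f k x) \<in> eigenspace U L l"
proof -
  have f: "f k holomorphic_on U" "\<And>x. x \<notin> U \<Longrightarrow> f k x = 0" "\<And>x. x \<in> U \<Longrightarrow> op_apply L (f k) x = l * f k x"
    if "k \<in> A" for k using assms(2)[OF that] by (auto simp: eigenspace_def)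
  have "op_apply L (\<lambda>x. \<Sum>k\<in>A. c k * f k x) x = l * (\<Sum>k\<in>A. c k * f k x)" if x: "x \<in> U" for x
    using f x by (subst op_apply_lincomb[OF assms(1) x]) (auto simp: sum_distrib_left intro!: sum.cong)
  moreover have "(\<lambda>x. \<Sum>k\<in>A. c k * f k x) holomorphic_on U"
    using f(1) by (intro holomorphic_intros) auto
  ultimately show ?thesis using f(2) by (simp add: eigenspace_def)
qed

context
  fixes L :: diffop and x0 :: complex and e :: real and n :: nat
  assumes e: "e > 0" and lead: "\<And>x. x \<in> ball x0 e \<Longrightarrow> poly (op_lead L) x \<noteq> 0"
    and n: "op_order L = n" "n > 0"
begin

private abbreviation U where "U \<equiv> ball x0 e"

lemma x0_in_ball: "x0 \<in> U"
  using e by simp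

text \<open>Differentiating \<open>L f = l f\<close> at \<open>x0\<close> allows one to solve for
  the highest derivative. The divisor is independent of \<open>l\<close>, so the coefficients stay
  polynomial in \<open>l\<close> and one choice serves all eigenvalues.\<close>

lemma higher_deriv_eigenfunction:
  "\<exists>p. \<forall>l. \<forall>f\<in>eigenspace U L l. (deriv ^^ k) f x0 = (\<Sum>i<n. poly (p i) l * (deriv ^^ i) f x0)"
proof (induction k rule: less_induct)
  case (less k)
  show ?case
  proof (cases "k < n")
    case True
    have "(\<Sum>i<n. poly (if i = k then 1 else 0) l * c i) = c k" for l and c :: "nat \<Rightarrow> complex"
    proof -
      have "(\<Sum>i<n. poly (if i = k then 1 else 0) l * c i) = (\<Sum>i<n. if i = k then c i else 0)"
        by (intro sum.cong) auto
      thus ?thesis using True by simp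
    qed
    note * = this[symmetric]
    show ?thesis by (intro exI[of _ "\<lambda>i. if i = k then 1 else 0"] allI ballI) (rule *)
  next
    case False
    define j where "j = k - n"
    have k: "k = n + j" "j < k" using False n by (auto simp: j_def)
    have "\<forall>k'. \<exists>p. k' < k \<longrightarrow> (\<forall>l. \<forall>f\<in>eigenspace U L l.
        (deriv ^^ k') f x0 = (\<Sum>i<n. poly (p i) l * (deriv ^^ i) f x0))"
      using less.IH by blast
    from choice[OF this] obtain p where p: "\<And>k' l f. k' < k \<Longrightarrow> f \<in> eigenspace U L l \<Longrightarrow>
        (deriv ^^ k') f x0 = (\<Sum>i<n. poly (p k' i) l * (deriv ^^ i) f x0)"
      by blast
    define Q where "Q = op_d ^ j * L"
    have L0: "L \<noteq> 0" using n by auto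
    have "op_d \<noteq> 0" by (metis op_order_0 op_order_d zero_neq_one)
    hence oQ: "op_order Q = k" using L0 n by (simp add: Q_def op_order_mult op_order_power k)
    have lQ: "op_lead Q = op_lead L" by (simp add: Q_def op_lead_mult op_lead_power)
    define c where "c i = poly (op_coeff Q i) x0" for i
    have ck: "c k \<noteq> 0" using lead[OF x0_in_ball] oQ lQ by (simp add: c_def op_lead_def)
    note d = op_apply_d_power[of j _ x0]
    have "(deriv ^^ k) f x0 = (\<Sum>i<n. poly (smult (1 / c k) ([:0, 1:] * p j i - (\<Sum>k'<k. smult (c k') (p k' i)))) l * (deriv ^^ i) f x0)"
      if f: "f \<in> eigenspace U L l" for l f
    proof -
      have hf: "f holomorphic_on U" using f by (simp add: eigenspace_def)
      have "op_apply Q f x0 = (deriv ^^ j) (op_apply L f) x0"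
        unfolding Q_def using op_apply_mult[OF open_ball hf x0_in_ball] d by simp
      also have "\<dots> = (deriv ^^ j) (\<lambda>x. l * f x) x0"
        using hf f holomorphic_on_op_apply[OF open_ball hf] x0_in_ball
        by (intro higher_deriv_transform_within_open[of _ U]) (auto simp: eigenspace_def intro!: holomorphic_intros)
      also have "\<dots> = l * (deriv ^^ j) f x0"
        using hf x0_in_ball by (intro higher_deriv_cmult[of _ U]) auto
      finally have "(\<Sum>i<k. c i * (deriv ^^ i) f x0) + c k * (deriv ^^ k) f x0 = l * (deriv ^^ j) f x0"
        using op_apply_upto[of Q k f x0] oQ by (simp add: c_def lessThan_Suc_atMost[symmetric])
      hence "(deriv ^^ k) f x0 = (1 / c k) * (l * (deriv ^^ j) f x0 - (\<Sum>k'<k. c k' * (deriv ^^ k') f x0))"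
        using ck by (simp add: field_simps)
      also have "(\<Sum>k'<k. c k' * (deriv ^^ k') f x0) = (\<Sum>i<n. (\<Sum>k'<k. c k' * poly (p k' i) l) * (deriv ^^ i) f x0)"
      proof -
        have "(\<Sum>k'<k. c k' * (deriv ^^ k') f x0) = (\<Sum>k'<k. \<Sum>i<n. c k' * poly (p k' i) l * (deriv ^^ i) f x0)"
          by (intro sum.cong refl, subst p[OF _ f]) (auto simp: sum_distrib_left mult.assoc)
        thus ?thesis unfolding sum_distrib_right by (subst (asm) sum.swap)
      qed
      also have "(deriv ^^ j) f x0 = (\<Sum>i<n. poly (p j i) l * (deriv ^^ i) f x0)"
        using p[OF k(2) f] .
      finally show ?thesis
        by (simp add: poly_sum sum_distrib_left sum_subtractf[symmetric] algebra_simps)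
    qed
    thus ?thesis by (intro exI[of _ "\<lambda>i. smult (1 / c k) ([:0, 1:] * p j i - (\<Sum>k'<k. smult (c k') (p k' i)))"]) blast
  qed
qed

text \<open>The first \<open>n\<close> derivatives at the centre determine all others, and the
  identity theorem applies because the disc is connected.\<close>

lemma eigenfunction_unique:
  assumes f: "f \<in> eigenspace U L l" and g: "g \<in> eigenspace U L l"
    and fg: "\<And>i. i < n \<Longrightarrow> (deriv ^^ i) f x0 = (deriv ^^ i) g x0"
  shows "f = g"
proof
  fix x
  show "f x = g x"
  proof (cases "x \<in> U")
    case False
    thus ?thesis using f g by (simp add: eigenspace_def)
  next
    case True
    have hol: "f holomorphic_on U" "g holomorphic_on U" using f g by (auto simp: eigenspace_def)
    have "(deriv ^^ k) f x0 = (deriv ^^ k) g x0" for k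
    proof -
      obtain p where "\<And>l f. f \<in> eigenspace U L l \<Longrightarrow> (deriv ^^ k) f x0 = (\<Sum>i<n. poly (p i) l * (deriv ^^ i) f x0)"
        using higher_deriv_eigenfunction[of k] by blast
      thus ?thesis using f g fg by simp
    qed
    hence "(deriv ^^ k) (\<lambda>x. f x - g x) x0 = 0" for k
      using higher_deriv_diff[OF hol open_ball x0_in_ball] by simp
    hence "f x - g x = 0"
      using hol x0_in_ball True by (intro holomorphic_fun_eq_0_on_connected[of "\<lambda>x. f x - g x" U x0])
        (auto intro!: holomorphic_intros)
    thus ?thesis by simp
  qed
qed

text \<open>The equation becomes its companion system, where \<open>u\<close> lists the coefficients
  of \<open>L - l\<close>. The leading coefficient has no zero in the disc, so the matrix is
  holomorphic there.\<close>

lemma eigenfunction_exists: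
  "\<exists>f\<in>eigenspace U L l. \<forall>i<n. (deriv ^^ i) f x0 = v i"
proof -
  define u where "u i = (if i = 0 then op_coeff L i - [:l:] else op_coeff L i)" for i
  define a where "a i j x = (if Suc i < n then (if j = Suc i then 1 else 0) else - poly (u j) x / poly (op_lead L) x)" for i j x
  have "a i j holomorphic_on U" for i j
    unfolding a_def using lead by (cases "Suc i < n") (auto intro!: holomorphic_intros)
  then obtain y where y: "\<And>i. i < n \<Longrightarrow> y i holomorphic_on U" "\<And>i. i < n \<Longrightarrow> y i x0 = v i"
     "\<And>i x. i < n \<Longrightarrow> x \<in> U \<Longrightarrow> deriv (y i) x = (\<Sum>j<n. a i j x * y j x)"
    using linear_system_solution[of n a x0 e v] e by blast
  have step: "deriv (y i) x = y (Suc i) x" if "Suc i < n" "x \<in> U" for i x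
  proof -
    have "deriv (y i) x = (\<Sum>j<n. a i j x * y j x)" using y(3) that by simp
    also have "\<dots> = (\<Sum>j<n. if j = Suc i then y j x else 0)"
      by (intro sum.cong) (use that in \<open>auto simp: a_def\<close>)
    finally have "deriv (y i) x = (\<Sum>j<n. if j = Suc i then y j x else 0)" .
    thus ?thesis using that by simp
  qed
  define f where "f x = (if x \<in> U then y 0 x else 0)" for x
  have hf: "f holomorphic_on U"
    using y(1)[of 0] n by (subst holomorphic_cong[OF refl, of _ _ "y 0"]) (auto simp: f_def)
  have df: "(deriv ^^ i) f x = y i x" if "i < n" "x \<in> U" for i x
    using that
  proof (induction i arbitrary: x)
    case (Suc i)
    have "eventually (\<lambda>x. (deriv ^^ i) f x = y i x) (nhds x)"
      using Suc eventually_nhds_in_open[of U x] by (auto elim!: eventually_mono)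
    hence "deriv ((deriv ^^ i) f) x = deriv (y i) x" by (intro deriv_cong_ev) auto
    thus ?case using step[of i x] Suc.prems by simp
  qed (simp add: f_def)
  have dn: "(deriv ^^ n) f x = - (\<Sum>j<n. poly (u j) x * (deriv ^^ j) f x) / poly (op_lead L) x" if x: "x \<in> U" for x
  proof -
    obtain m where m: "n = Suc m" using n by (cases n) auto
    have "eventually (\<lambda>x. (deriv ^^ m) f x = y m x) (nhds x)"
      using x df[of m] m eventually_nhds_in_open[of U x] by (auto elim!: eventually_mono)
    hence "deriv ((deriv ^^ m) f) x = deriv (y m) x" by (intro deriv_cong_ev) auto
    also have "\<dots> = (\<Sum>j<n. - poly (u j) x / poly (op_lead L) x * y j x)"
      using y(3)[of m x] x m by (simp add: a_def)
    also have "\<dots> = - (\<Sum>j<n. poly (u j) x * (deriv ^^ j) f x) / poly (op_lead L) x"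
      using df x by (simp add: sum_negf[symmetric] sum_divide_distrib)
    finally show ?thesis by (simp add: m)
  qed
  have "op_apply L f x = l * f x" if x: "x \<in> U" for x
  proof -
    have "op_apply L f x = (\<Sum>j<n. poly (op_coeff L j) x * (deriv ^^ j) f x) + poly (op_lead L) x * (deriv ^^ n) f x"
      using n by (simp add: op_apply_def op_lead_def lessThan_Suc_atMost[symmetric])
    also have "poly (op_lead L) x * (deriv ^^ n) f x = - (\<Sum>j<n. poly (u j) x * (deriv ^^ j) f x)"
      using dn[OF x] lead[OF x] by simp
    also have "(\<Sum>j<n. poly (op_coeff L j) x * (deriv ^^ j) f x) + \<dots> = (\<Sum>j<n. if j = 0 then l * f x else 0)"
      unfolding sum_negf[symmetric] sum.distrib[symmetric]
      by (intro sum.cong) (auto simp: u_def algebra_simps)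
    finally show ?thesis using n by simp
  qed
  hence "f \<in> eigenspace U L l" using hf by (auto simp: eigenspace_def f_def)
  moreover have "(deriv ^^ i) f x0 = v i" if "i < n" for i
    using df[OF that x0_in_ball] y(2)[OF that] by simp
  ultimately show ?thesis by blast
qed

section \<open>The action of \<open>M\<close> on an eigenspace of \<open>L\<close>\<close>

context
  fixes M :: diffop and F :: "complex poly"
  assumes comm: "L * M = M * L" and sq: "M\<^sup>2 = poly_at_op F L"
begin

text \<open>Elements of \<open>eigenspace\<close> vanish outside the disc, whereas
  \<open>op_apply M f\<close> is not controlled on the boundary circle. The cut-off makes
  \<open>M\<close> an endomorphism of the eigenspace.\<close>

definition restr :: "(complex \<Rightarrow> complex) \<Rightarrow> complex \<Rightarrow> complex" where
  "restr f = (\<lambda>x. if x \<in> U then op_apply M f x else 0)"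

lemma restr_eigenspace:
  assumes f: "f \<in> eigenspace U L l"
  shows "restr f \<in> eigenspace U L l" "restr (restr f) = (\<lambda>x. poly F l * f x)"
proof -
  have hf: "f holomorphic_on U" and lf: "\<And>x. x \<in> U \<Longrightarrow> op_apply L f x = l * f x"
    using f by (auto simp: eigenspace_def)
  note hM = holomorphic_on_op_apply[OF open_ball hf]
  have hr: "restr f holomorphic_on U"
    using hM[of M] by (subst holomorphic_cong[OF refl, of _ _ "op_apply M f"]) (auto simp: restr_def)
  have r: "op_apply P (restr f) x = op_apply (P * M) f x" if x: "x \<in> U" for P x
  proof -
    have "op_apply P (restr f) x = op_apply P (op_apply M f) x"
      using hr x by (intro op_apply_cong_open[of U]) (auto simp: restr_def)
    thus ?thesis using op_apply_mult[OF open_ball hf x] by simp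
  qed
  have "op_apply L (restr f) x = l * restr f x" if x: "x \<in> U" for x
  proof -
    have "op_apply L (restr f) x = op_apply (M * L) f x"
      using r[OF x] comm by simp
    also have "\<dots> = op_apply M (op_apply L f) x"
      by (rule op_apply_mult[OF open_ball hf x])
    also have "\<dots> = op_apply M (\<lambda>x. l * f x) x"
      using hM[of L] lf x by (intro op_apply_cong_open[of U]) auto
    also have "\<dots> = l * op_apply M f x"
      by (rule op_apply_cmult[OF open_ball x hf])
    finally show ?thesis using x by (simp add: restr_def)
  qed
  thus "restr f \<in> eigenspace U L l"
    using hr by (simp add: eigenspace_def) (simp add: restr_def)
  have "restr (restr f) x = poly F l * f x" for x
  proof (cases "x \<in> U")
    case True
    have "restr (restr f) x = op_apply (M\<^sup>2) f x"
      using r[OF True, of M] True by (simp add: restr_def[of "restr f"] power2_eq_square)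
    thus ?thesis unfolding sq using op_apply_poly_at_op[OF open_ball f True] by simp
  next
    case False
    thus ?thesis using f by (simp add: restr_def eigenspace_def)
  qed
  thus "restr (restr f) = (\<lambda>x. poly F l * f x)" by auto
qed

lemma common_eigenfunctions_iff:
  "f \<in> common_eigenfunctions U L M l m \<longleftrightarrow> f \<in> eigenspace U L l \<and> restr f = (\<lambda>x. m * f x)"
  by (auto simp: common_eigenfunctions_def eigenspace_def restr_def fun_eq_iff)

text \<open>For \<open>i < n\<close> this is the matrix of \<open>M\<close> in the coordinates given
  by the first \<open>n\<close> derivatives at \<open>x0\<close>. Since its entries are polynomials
  in \<open>l\<close>, so is its trace.\<close>

lemma restr_matrix:
  "\<exists>A. \<forall>l. \<forall>f\<in>eigenspace U L l. \<forall>i. (deriv ^^ i) (restr f) x0 = (\<Sum>j<n. poly (A i j) l * (deriv ^^ j) f x0)"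
proof -
  have "\<forall>k. \<exists>p. \<forall>l. \<forall>f\<in>eigenspace U L l. (deriv ^^ k) f x0 = (\<Sum>i<n. poly (p i) l * (deriv ^^ i) f x0)"
    using higher_deriv_eigenfunction by blast
  from choice[OF this] obtain p where p: "\<And>k l f. f \<in> eigenspace U L l \<Longrightarrow>
      (deriv ^^ k) f x0 = (\<Sum>i<n. poly (p k i) l * (deriv ^^ i) f x0)"
    by blast
  define A where "A i j = (\<Sum>k\<le>op_order (op_d ^ i * M). smult (poly (op_coeff (op_d ^ i * M) k) x0) (p k j))" for i j
  have "(deriv ^^ i) (restr f) x0 = (\<Sum>j<n. poly (A i j) l * (deriv ^^ j) f x0)"
    if f: "f \<in> eigenspace U L l" for l f i
  proof -
    have hf: "f holomorphic_on U" using f by (simp add: eigenspace_def)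
    have hr: "restr f holomorphic_on U" using restr_eigenspace(1)[OF f] by (simp add: eigenspace_def)
    have "(deriv ^^ i) (restr f) x0 = (deriv ^^ i) (op_apply M f) x0"
      using hr holomorphic_on_op_apply[OF open_ball hf] x0_in_ball
      by (intro higher_deriv_transform_within_open[of _ U]) (auto simp: restr_def)
    also have "\<dots> = op_apply (op_d ^ i * M) f x0"
      using op_apply_mult[OF open_ball hf x0_in_ball] by (simp add: op_apply_d_power)
    also have "\<dots> = (\<Sum>k\<le>op_order (op_d ^ i * M). \<Sum>j<n. poly (op_coeff (op_d ^ i * M) k) x0 * (poly (p k j) l * (deriv ^^ j) f x0))"
      unfolding op_apply_def sum_distrib_left[symmetric] p[OF f, symmetric] ..
    also have "\<dots> = (\<Sum>j<n. poly (A i j) l * (deriv ^^ j) f x0)"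
      by (subst sum.swap) (simp add: A_def poly_sum sum_distrib_right mult.assoc)
    finally show ?thesis .
  qed
  thus ?thesis by blast
qed

text \<open>The trace of the projection \<open>(M + m) / (2 m)\<close> of the kernel of \<open>L - l\<close> onto the kernel of
  \<open>M - m\<close> is the dimension of the latter.\<close>

lemma trace_restr:
  assumes A: "\<And>f i. f \<in> eigenspace U L l \<Longrightarrow>
      (deriv ^^ i) (restr f) x0 = (\<Sum>j<n. poly (A i j) l * (deriv ^^ j) f x0)"
    and m: "m\<^sup>2 = poly F l" "m \<noteq> 0"
  defines "d \<equiv> cfun.dim (common_eigenfunctions U L M l m)"
  shows "poly (\<Sum>i<n. A i i) l = (2 * of_nat d - of_nat n) * m" and "d \<le> n"
proof -
  let ?E = "eigenspace U L l" and ?V = "common_eigenfunctions U L M l m"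
  define co where "co i f = (deriv ^^ i) f x0" for i and f :: "complex \<Rightarrow> complex"
  have "\<forall>k. \<exists>f. f \<in> ?E \<and> (\<forall>i<n. co i f = (if i = k then 1 else 0))"
    unfolding co_def using eigenfunction_exists[of l "\<lambda>i. if i = k then 1 else 0" for k] by blast
  \<comment> \<open>\<open>\<phi>\<close> is the basis of the eigenspace dual to the coordinates
    \<open>co\<close>.\<close>
  from choice[OF this] obtain \<phi> where \<phi>: "\<And>k. \<phi> k \<in> ?E" "\<And>k i. i < n \<Longrightarrow> co i (\<phi> k) = (if i = k then 1 else 0)"
    by blast
  have hol: "f holomorphic_on U" if "f \<in> ?E" for f using that by (simp add: eigenspace_def)
  have co_sum: "co i (\<lambda>x. \<Sum>k\<in>B. c k * f k x) = (\<Sum>k\<in>B. c k * co i (f k))" if "\<And>k. k \<in> B \<Longrightarrow> f k \<in> ?E"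
    for i c and f :: "'k \<Rightarrow> complex \<Rightarrow> complex" and B
    unfolding co_def using that hol by (intro higher_deriv_lincomb[OF open_ball x0_in_ball]) auto
  have expand: "f = (\<lambda>x. \<Sum>k<n. co k f * \<phi> k x)" if f: "f \<in> ?E" for f
  proof (rule eigenfunction_unique[OF f])
    show "(\<lambda>x. \<Sum>k<n. co k f * \<phi> k x) \<in> ?E" by (rule eigenspace_lincomb) (auto simp: \<phi>)
    fix i assume i: "i < n"
    have "co i (\<lambda>x. \<Sum>k<n. co k f * \<phi> k x) = (\<Sum>k<n. if k = i then co i f else 0)"
      unfolding co_sum[of "{..<n}" \<phi>, OF \<phi>(1)] using \<phi>(2)[OF i] by (intro sum.cong) auto
    thus "(deriv ^^ i) f x0 = (deriv ^^ i) (\<lambda>x. \<Sum>k<n. co k f * \<phi> k x) x0"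
      using i by (simp add: co_def)
  qed
  obtain B where B: "B \<subseteq> ?V" "cfun.independent B" "?V \<subseteq> cfun.span B" "card B = d"
    unfolding d_def by (rule cfun.basis_exists)
  have "B \<subseteq> cfun.span (\<phi> ` {..<n})"
  proof
    fix b assume "b \<in> B"
    hence bE: "b \<in> ?E" using B(1) common_eigenfunctions_iff by blast
    have eq: "b = (\<Sum>k<n. (\<lambda>x. co k b * \<phi> k x))"
      by (rule trans[OF expand[OF bE]]) (simp add: fun_eq_iff sum_fun_apply)
    have "(\<Sum>k<n. (\<lambda>x. co k b * \<phi> k x)) \<in> cfun.span (\<phi> ` {..<n})"
      by (intro cfun.span_sum cfun.span_scale cfun.span_base) auto
    thus "b \<in> cfun.span (\<phi> ` {..<n})" by (subst eq)
  qed
  hence fB: "finite B \<and> card B \<le> card (\<phi> ` {..<n})"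
    using cfun.independent_span_bound[of "\<phi> ` {..<n}" B] B(2) by auto
  thus "d \<le> n" using card_image_le[of "{..<n}" \<phi>] B(4) by simp
  have BE: "b \<in> ?E" if "b \<in> B" for b using that B(1) common_eigenfunctions_iff by blast
  define \<pi> where "\<pi> f = (\<lambda>x. 1 / (2 * m) * restr f x + 1 / 2 * f x)" for f
  have \<pi>E: "\<pi> f \<in> ?E" if "f \<in> ?E" for f
    unfolding \<pi>_def using that restr_eigenspace(1)[OF that] by (intro eigenspace_lincomb2) auto
  have restr_lin: "restr (\<lambda>x. a * f x + b * g x) = (\<lambda>x. a * restr f x + b * restr g x)" if "f \<in> ?E" "g \<in> ?E" for a b f g
    using lincomb2(2)[OF open_ball _ hol[OF that(1)] hol[OF that(2)]] by (auto simp: restr_def fun_eq_iff)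
  have \<pi>V: "\<pi> f \<in> ?V" if f: "f \<in> ?E" for f
  proof -
    have "restr (\<pi> f) = (\<lambda>x. 1 / (2 * m) * (poly F l * f x) + 1 / 2 * restr f x)"
      unfolding \<pi>_def using restr_lin[OF restr_eigenspace(1)[OF f] f] restr_eigenspace(2)[OF f] by (simp only:)
    also have "\<dots> = (\<lambda>x. m * \<pi> f x)"
      using m(2) unfolding m(1)[symmetric] by (auto simp: \<pi>_def fun_eq_iff field_simps power2_eq_square)
    finally show ?thesis using \<pi>E[OF f] by (simp add: common_eigenfunctions_iff)
  qed
  have "\<forall>k. \<exists>c. \<pi> (\<phi> k) = (\<lambda>x. \<Sum>b\<in>B. c b * b x)"
  proof
    fix k
    have "\<pi> (\<phi> k) \<in> cfun.span B" using \<pi>V[OF \<phi>(1)] B(3) by blast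
    then obtain c where "\<pi> (\<phi> k) = (\<Sum>b\<in>B. (\<lambda>x. c b * b x))"
      using cfun.span_finite[of B] fB by auto
    thus "\<exists>c. \<pi> (\<phi> k) = (\<lambda>x. \<Sum>b\<in>B. c b * b x)"
      by (intro exI[of _ c]) (simp add: fun_eq_iff sum_fun_apply)
  qed
  from choice[OF this] obtain C where C: "\<And>k. \<pi> (\<phi> k) = (\<lambda>x. \<Sum>b\<in>B. C k b * b x)" by blast
  \<comment> \<open>The projection \<open>\<pi>\<close> fixes each basis vector \<open>b\<close>, so
    \<open>b\<close> occurs in the expansion of \<open>\<pi> b\<close> with coefficient 1.\<close>
  have one: "(\<Sum>i<n. co i b * C i b) = 1" if b: "b \<in> B" for b
  proof -
    have bE: "b \<in> ?E" and rb: "restr b = (\<lambda>x. m * b x)"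
      using b B(1) common_eigenfunctions_iff by blast+
    have r: "restr b = (\<lambda>x. \<Sum>k<n. co k b * restr (\<phi> k) x)"
    proof
      fix x
      have "restr b x = restr (\<lambda>x. \<Sum>k<n. co k b * \<phi> k x) x" using expand[OF bE] by simp
      also have "\<dots> = (\<Sum>k<n. co k b * restr (\<phi> k) x)"
        unfolding restr_def using op_apply_lincomb[OF open_ball, of x x0 e "{..<n}" \<phi> M "\<lambda>k. co k b"] hol \<phi>(1)
        by (cases "x \<in> U") auto
      finally show "restr b x = (\<Sum>k<n. co k b * restr (\<phi> k) x)" .
    qed
    have "b x = (\<Sum>b'\<in>B. (\<Sum>i<n. co i b * C i b') * b' x)" for x
    proof -
      have "b x = 1 / (2 * m) * restr b x + 1 / 2 * b x" using m(2) by (simp add: rb)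
      also have "\<dots> = 1 / (2 * m) * (\<Sum>k<n. co k b * restr (\<phi> k) x) + 1 / 2 * (\<Sum>k<n. co k b * \<phi> k x)"
        using fun_cong[OF r, of x] fun_cong[OF expand[OF bE], of x] by simp
      also have "\<dots> = (\<Sum>k<n. co k b * \<pi> (\<phi> k) x)"
        by (simp add: \<pi>_def sum_distrib_left sum.distrib[symmetric] algebra_simps)
      also have "\<dots> = (\<Sum>k<n. \<Sum>b'\<in>B. co k b * C k b' * b' x)"
        unfolding C by (simp add: sum_distrib_left mult.assoc)
      also have "\<dots> = (\<Sum>b'\<in>B. (\<Sum>i<n. co i b * C i b') * b' x)"
        by (subst sum.swap) (simp add: sum_distrib_right)
      finally show ?thesis .
    qed
    note eq = this
    have "(\<Sum>b'\<in>B. ((\<Sum>i<n. co i b * C i b') - (if b' = b then 1 else 0)) * b' x) = 0" for x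
    proof -
      have "(\<Sum>b'\<in>B. (if b' = b then 1 else 0) * b' x) = (\<Sum>b'\<in>B. if b' = b then b x else 0)"
        by (intro sum.cong) auto
      thus ?thesis using eq[of x] b fB by (simp add: left_diff_distrib sum_subtractf)
    qed
    hence "(\<Sum>b'\<in>B. (\<lambda>x. ((\<Sum>i<n. co i b * C i b') - (if b' = b then 1 else 0)) * b' x)) = 0"
      by (simp add: fun_eq_iff sum_fun_apply)
    from cfun.independentD[OF B(2) conjunct1[OF fB] order_refl this b] show ?thesis by simp
  qed
  \<comment> \<open>The trace of \<open>\<pi>\<close> is evaluated twice: here as a sum over the
    basis \<open>B\<close> of its image, and afterwards through the diagonal entries of
    \<open>A\<close>.\<close>
  have "(\<Sum>i<n. co i (\<pi> (\<phi> i))) = (\<Sum>i<n. \<Sum>b\<in>B. C i b * co i b)"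
    unfolding C using co_sum[of B "\<lambda>b. b"] BE by simp
  also have "\<dots> = (\<Sum>b\<in>B. \<Sum>i<n. co i b * C i b)"
    by (subst sum.swap) (simp add: mult.commute)
  also have "\<dots> = of_nat d" using one B(4) by simp
  finally have tr: "(\<Sum>i<n. co i (\<pi> (\<phi> i))) = of_nat d" .
  have "co i (\<pi> (\<phi> i)) = 1 / (2 * m) * (poly (A i i) l + m)" if i: "i < n" for i
  proof -
    have "co i (\<pi> (\<phi> i)) = 1 / (2 * m) * co i (restr (\<phi> i)) + 1 / 2 * co i (\<phi> i)"
      unfolding \<pi>_def co_def
      using \<phi>(1) by (intro lincomb2(1)[OF open_ball x0_in_ball]) (auto intro!: hol restr_eigenspace)
    also have "co i (restr (\<phi> i)) = (\<Sum>j<n. poly (A i j) l * co j (\<phi> i))"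
      unfolding co_def by (rule A[OF \<phi>(1)])
    also have "\<dots> = (\<Sum>j<n. if j = i then poly (A i i) l else 0)"
      using \<phi>(2) by (intro sum.cong) auto
    finally show ?thesis using i m(2) \<phi>(2)[OF i, of i] by (simp add: field_simps)
  qed
  hence "1 / (2 * m) * (poly (\<Sum>i<n. A i i) l + of_nat n * m) = of_nat d"
    using tr by (simp add: poly_sum sum_divide_distrib[symmetric] sum.distrib)
  thus "poly (\<Sum>i<n. A i i) l = (2 * of_nat d - of_nat n) * m"
    using m(2) by (simp add: field_simps)
qed

lemma dim_common_eigenfunctions:
  assumes F: "odd (degree F)" and m: "m\<^sup>2 = poly F l" "m \<noteq> 0"
  shows "2 * cfun.dim (common_eigenfunctions U L M l m) = n"
proof -
  obtain A where A: "\<And>l f i. f \<in> eigenspace U L l \<Longrightarrow>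
      (deriv ^^ i) (restr f) x0 = (\<Sum>j<n. poly (A i j) l * (deriv ^^ j) f x0)"
    using restr_matrix by blast
  define T where "T = (\<Sum>i<n. A i i)"
  define k where "k d = (2 * of_nat d - of_nat n :: complex)" for d :: nat
  have F0: "F \<noteq> 0" using F by auto
  \<comment> \<open>The dimension \<open>d\<close> might vary with the point, but it is one of
    \<open>0, ..., n\<close>. So the product over all candidates vanishes identically, and then one
    factor does; the factor \<open>F\<close> covers the points with \<open>m = 0\<close>.\<close>
  have T: "\<exists>d\<le>n. T\<^sup>2 = smult ((k d)\<^sup>2) F"
  proof -
    have "poly (F * (\<Prod>d\<le>n. T\<^sup>2 - smult ((k d)\<^sup>2) F)) l = 0" for l
    proof (cases "poly F l = 0")
      case False
      define m where "m = csqrt (poly F l)"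
      have m: "m\<^sup>2 = poly F l" "m \<noteq> 0" using False by (auto simp: m_def)
      define d where "d = cfun.dim (common_eigenfunctions U L M l m)"
      have "poly T l = k d * m" "d \<le> n"
        using trace_restr[OF A m] by (auto simp: T_def k_def d_def)
      moreover have "(k d * m)\<^sup>2 = (k d)\<^sup>2 * poly F l" using m by (simp add: power_mult_distrib)
      ultimately show ?thesis by (auto simp: poly_prod intro!: prod_zero bexI[of _ d])
    qed simp
    hence "F * (\<Prod>d\<le>n. T\<^sup>2 - smult ((k d)\<^sup>2) F) = 0" by (metis poly_all_0_iff_0)
    thus ?thesis using F0 by auto
  qed
  then obtain d where d: "T\<^sup>2 = smult ((k d)\<^sup>2) F" by blast
  have "T = 0"
  proof (rule ccontr)
    assume T0: "T \<noteq> 0"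
    hence "k d \<noteq> 0" using d by auto
    hence "2 * degree T = degree F"
      using arg_cong[OF d, of degree] T0 by (simp add: degree_power_eq)
    thus False using F by presburger
  qed
  hence "2 * of_nat (cfun.dim (common_eigenfunctions U L M l m)) - of_nat n = (0 :: complex)"
    using trace_restr(1)[OF A m] m(2) by (auto simp: T_def)
  hence "of_nat (2 * cfun.dim (common_eigenfunctions U L M l m)) = (of_nat n :: complex)" by simp
  thus ?thesis by (simp only: of_nat_eq_iff)
qed

end

end

text \<open>The exceptional points are those with \<open>m = 0\<close>, where the projection
  \<open>(M + m) / (2 m)\<close> is undefined; there is one for each zero of
  \<open>F\<close>.\<close>

theorem has_rank_hyperelliptic:
  assumes comm: "L * M = M * L" and sq: "M\<^sup>2 = poly_at_op F L"
    and F: "odd (degree F)" and L: "op_order L = 2 * k" "k > 0"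
  shows "has_rank L M k"
  unfolding has_rank_def
proof (intro exI[of _ "(\<lambda>l. (l, 0)) ` {l. poly F l = 0}"] conjI allI impI; (elim conjE)?)
  have "F \<noteq> 0" using F by auto
  thus "finite ((\<lambda>l. (l, 0)) ` {l. poly F l = 0})" by (intro finite_imageI finite_roots)
  fix x0 e
  assume e: "e > 0" and lead: "\<forall>x\<in>ball x0 e. poly (op_lead L) x \<noteq> 0 \<and> poly (op_lead M) x \<noteq> 0"
  have C: "spectral_curve L M = {(l, m). m\<^sup>2 = poly F l}"
    using spectral_curve_hyperelliptic[OF sq _ F] L by simp
  show "\<forall>(l, m)\<in>spectral_curve L M - (\<lambda>l. (l, 0)) ` {l. poly F l = 0}.
      cfun.dim (common_eigenfunctions (ball x0 e) L M l m) = k"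
  proof clarify
    fix l m assume lm: "(l, m) \<in> spectral_curve L M" "(l, m) \<notin> (\<lambda>l. (l, 0)) ` {l. poly F l = 0}"
    hence m: "m\<^sup>2 = poly F l" "m \<noteq> 0" by (auto simp: C)
    have "2 * cfun.dim (common_eigenfunctions (ball x0 e) L M l m) = 2 * k"
      using dim_common_eigenfunctions[OF e _ L(1) _ comm sq F m] lead L(2) by simp
    thus "cfun.dim (common_eigenfunctions (ball x0 e) L M l m) = k" by simp
  qed
qed

subsection \<open>Differential polynomials in the coefficients\<close>

text \<open>Repeated differentiation of \<open>u\<close> leads to a polynomial of degree one, from
  which \<open>x\<close> and then every polynomial is obtained.\<close>

lemma diff_polys_everything:
  assumes u: "u \<in> U" "degree u > 0"
  shows "p \<in> diff_polys U"
proof -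
  define v where "v = (pderiv ^^ (degree u - 1)) u"
  have "degree ((pderiv ^^ k) u) = degree u - k" for k
    by (induction k) (simp_all add: degree_pderiv)
  hence dv: "degree v = 1" using u(2) by (simp add: v_def)
  define c0 c1 where "c0 = coeff v 0" and "c1 = coeff v 1"
  have v: "v = [:c0, c1:]"
    using dv by (intro poly_eqI) (auto simp: c0_def c1_def coeff_pCons coeff_eq_0 split: nat.split)
  have c1: "c1 \<noteq> 0" using dv v by auto
  have "[:1 / c1:] * (v + [:- c0:]) \<in> diff_polys U"
    unfolding v_def by (intro diff_polys.intros u)
  also have "[:1 / c1:] * (v + [:- c0:]) = [:0, 1:]" using c1 by (simp add: v)
  finally have x: "[:0, 1:] \<in> diff_polys U" .
  show ?thesis
  proof (induction p)
    case 0
    show ?case using diff_polys.const[of 0] by simp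
  next
    case (pCons c p)
    have "[:c:] + [:0, 1:] * p \<in> diff_polys U"
      by (intro diff_polys.add diff_polys.mult diff_polys.const x pCons)
    thus ?case by simp
  qed
qed

subsection \<open>The operator \<open>L\<close>\<close>

lemma op_coeff_d_power: "op_coeff (op_d ^ j) i = (if i = j then 1 else 0)"
  by (simp add: op_d_power op_coeff_def)

lemma op_coeff_mult_left: "op_coeff (op_mult u * P) i = u * op_coeff P i"
  by (simp add: op_coeff_def op_mult_def symbol_comp_pCons)

lemma op_coeff_sum: "op_coeff (sum f A) i = (\<Sum>x\<in>A. op_coeff (f x) i)"
  by (induction A rule: infinite_finite_induct) simp_all

lemma op_coeff_\<iota>: "op_coeff (\<iota> p) i = [:coeff p i:]"
proof -
  have "op_coeff (\<iota> p) i = (\<Sum>j\<le>degree p. smult (coeff p j) (if i = j then 1 else 0))"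
    unfolding poly_at_op_def op_coeff_sum op_coeff_const_mult op_d_power
    by (intro sum.cong) (auto simp: op_coeff_def)
  also have "\<dots> = (\<Sum>j\<le>degree p. if j = i then [:coeff p i:] else 0)"
    by (intro sum.cong) (auto simp: one_pCons)
  finally show ?thesis by (simp add: coeff_eq_0)
qed

definition cheb_inner :: "nat \<Rightarrow> complex \<Rightarrow> complex \<Rightarrow> diffop" where
  "cheb_inner r a b = op_const a * poly_at_op (cheb r) op_d - op_x ^ 2 * op_d ^ 2 - 3 * op_x * op_d
     + op_x ^ 2 + op_const b"

lemma cheb_op_altdef:
  "cheb_op g r a b = (cheb_inner r a b)\<^sup>2 - op_const (a * of_nat (r ^ 2 * g * (g + 1))) * \<iota> (cheb r)"
  by (simp add: cheb_op_def cheb_inner_def)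

lemma op_coeff_cheb_inner:
  "op_coeff (cheb_inner r a b) i = [:a * coeff (cheb r) i:] +
     (if i = 0 then [:b, 0, 1:] else if i = 1 then [:0, - 3:] else if i = 2 then [:0, 0, - 1:] else 0)"
proof -
  have x2: "op_x\<^sup>2 = op_mult [:0, 0, 1:]"
    by (rule diffop.expand) (simp add: op_x_def op_mult_def symbol_comp_pCons power2_eq_square)
  have x3: "3 * op_x = op_mult [:0, 3:]"
    by (rule diffop.expand) (simp add: op_x_def op_mult_def symbol_comp_pCons op_const_numeral[symmetric])
  note d = op_coeff_d_power[of _ i]
  have m: "op_coeff (op_mult u) i = (if i = 0 then u else 0)" for u
    by (simp add: op_mult_def op_coeff_def coeff_pCons split: nat.split)
  show ?thesis
    unfolding cheb_inner_def x2 x3 op_const_def[of b]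
    using d[of 1] by (simp add: op_coeff_mult_left op_coeff_\<iota> d m one_pCons)
qed

lemma op_order_lead_eqI:
  assumes "\<And>i. i > n \<Longrightarrow> op_coeff P i = 0" "op_coeff P n = u" "u \<noteq> 0"
  shows "op_order P = n" "op_lead P = u"
proof -
  have "degree (op_poly P) = n"
    using assms by (intro antisym degree_le le_degree) (auto simp: op_coeff_def)
  thus "op_order P = n" "op_lead P = u" using assms by (auto simp: op_order_def op_lead_def)
qed

lemma cheb_inner_order:
  assumes "r \<ge> 1" "a \<noteq> 0"
  shows "op_order (cheb_inner r a b) = max 2 r"
    and "r > 2 \<Longrightarrow> op_lead (cheb_inner r a b) = [:a * 2 ^ (r - 1):]"
proof -
  have z: "coeff (cheb r) i = 0" if "i > r" for i
    using that degree_cheb[of r] by (simp add: coeff_eq_0)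
  have top: "coeff (cheb r) r = 2 ^ (r - 1)"
    using coeff_cheb_top[of "r - 1"] assms(1) by simp
  \<comment> \<open>For \<open>r \<le> 2\<close> the term \<open>- x^2 (d/dx)^2\<close> determines
    the order. If \<open>r = 2\<close>, the Chebyshev part only adds a constant to its coefficient,
    so the coefficient of \<open>x^2\<close> is the one to test.\<close>
  have nz: "op_coeff (cheb_inner r a b) (max 2 r) \<noteq> 0"
  proof (cases "r \<le> 2")
    case True
    hence "coeff (op_coeff (cheb_inner r a b) (max 2 r)) 2 \<noteq> 0"
      by (simp add: op_coeff_cheb_inner max_def numeral_2_eq_2)
    thus ?thesis by (metis coeff_0)
  next
    case False
    thus ?thesis using assms top by (simp add: op_coeff_cheb_inner max_def)
  qed
  have z': "op_coeff (cheb_inner r a b) i = 0" if "i > max 2 r" for i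
    using that z[of i] by (simp add: op_coeff_cheb_inner)
  show "op_order (cheb_inner r a b) = max 2 r"
    by (rule op_order_lead_eqI(1)[OF z' refl nz])
  show "op_lead (cheb_inner r a b) = [:a * 2 ^ (r - 1):]" if "r > 2"
    using op_order_lead_eqI(2)[OF z' refl nz] that top by (simp add: op_coeff_cheb_inner max_def)
qed

lemma op_order_\<iota>_cheb: "op_order (\<iota> (cheb r)) = r"
proof -
  have "cheb r \<noteq> 0" using coeff_cheb_top[of "r - 1"] by (cases r) auto
  thus ?thesis using op_order_poly_at_op(1)[of op_d "cheb r"] by (simp add: degree_cheb)
qed

lemma op_order_mult_le: "op_order (P * Q) \<le> op_order P + op_order Q"
  by (cases "P = 0 \<or> Q = 0") (auto simp: op_order_mult)

lemma cheb_op_order: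
  assumes "r \<ge> 1" "a \<noteq> 0"
  shows "op_order (cheb_op g r a b) = 2 * max 2 r"
    and "r > 2 \<Longrightarrow> op_lead (cheb_op g r a b) = [:a * 2 ^ (r - 1):]\<^sup>2"
proof -
  let ?N = "cheb_inner r a b"
  have oN: "op_order ?N = max 2 r" by (rule cheb_inner_order(1)[OF assms])
  hence "?N \<noteq> 0" by auto
  hence oN2: "op_order (?N\<^sup>2) = 2 * max 2 r" by (simp add: op_order_power oN)
  have "op_order (op_const c * \<iota> (cheb r)) < op_order (?N\<^sup>2)" for c
    using op_order_mult_le[of "op_const c" "\<iota> (cheb r)"] oN2 assms(1) by (simp add: op_order_\<iota>_cheb)
  note * = op_order_diff_less[OF this]
  show "op_order (cheb_op g r a b) = 2 * max 2 r"
    unfolding cheb_op_altdef * by (rule oN2)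
  show "r > 2 \<Longrightarrow> op_lead (cheb_op g r a b) = [:a * 2 ^ (r - 1):]\<^sup>2"
    unfolding cheb_op_altdef * op_lead_power by (subst cheb_inner_order(2)[OF assms]) simp_all
qed

text \<open>By parity \<open>T_r\<close> has no term of order \<open>r - 1\<close>, and for
  \<open>r > 3\<close> the terms with \<open>x\<close> have order at most \<open>r - 2\<close>. The
  inner factor is thus \<open>op_d ^ r\<close> up to order \<open>r - 2\<close>, and its square is
  \<open>op_d ^ (2 * r)\<close> up to order \<open>2 * r - 2\<close>.\<close>

lemma cheb_op_subleading:
  assumes r: "r > 3" and a: "a = 1 / 2 ^ (r - 1)"
  shows "op_coeff (cheb_op g r a b) (2 * r - 1) = 0"
proof -
  define N where "N = cheb_inner r a b"
  define Q where "Q = N - op_d ^ r"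
  have top: "coeff (cheb r) r = 2 ^ (r - 1)"
    using coeff_cheb_top[of "r - 1"] r by simp
  have z: "op_coeff Q i = 0" if i: "i > r - 2" for i
  proof (cases "i > r")
    case True
    hence "coeff (cheb r) i = 0" using degree_cheb[of r] by (simp add: coeff_eq_0)
    thus ?thesis using True r by (simp add: Q_def N_def op_coeff_cheb_inner op_coeff_d_power)
  next
    case False
    hence "i = r \<or> i = r - 1" using i by auto
    moreover have "coeff (cheb r) (r - 1) = 0" using r by (intro coeff_cheb_parity) auto
    ultimately show ?thesis using r top a
      by (auto simp: Q_def N_def op_coeff_cheb_inner op_coeff_d_power one_pCons)
  qed
  have oQ: "op_order Q \<le> r - 2"
    unfolding op_order_def using z by (intro degree_le) (simp add: op_coeff_def)
  have od: "op_order (op_d ^ k) = k" for k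
    by (simp add: op_d_power op_order_def degree_monom_eq)
  define E where "E = op_d ^ r * Q + Q * op_d ^ r + Q * Q - op_const (a * of_nat (r ^ 2 * g * (g + 1))) * \<iota> (cheb r)"
  have L: "cheb_op g r a b = op_d ^ (2 * r) + E"
  proof -
    have "N = op_d ^ r + Q" by (simp add: Q_def)
    thus ?thesis unfolding cheb_op_altdef N_def[symmetric] E_def
      by (simp add: power2_eq_square algebra_simps mult_2_right power_add)
  qed
  have "op_order E \<le> 2 * r - 2"
    unfolding E_def diff_conv_add_uminus
    using oQ op_order_mult_le[of "op_d ^ r" Q] op_order_mult_le[of Q "op_d ^ r"] op_order_mult_le[of Q Q]
      op_order_mult_le[of "op_const (a * of_nat (r ^ 2 * g * (g + 1)))" "\<iota> (cheb r)"] r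
    by (intro op_order_add_le) (simp_all add: od op_order_\<iota>_cheb)
  hence "op_coeff E (2 * r - 1) = 0"
    using r by (simp add: op_order_def op_coeff_def coeff_eq_0)
  thus ?thesis using r by (simp add: L op_coeff_d_power)
qed

text \<open>The term of order zero in the square of the inner factor is the sum of
  \<open>n i\<close> times the \<open>i\<close>-th derivative of \<open>n 0\<close>, and only
  \<open>i = 0\<close> yields \<open>x^4\<close>. The subtracted Chebyshev term adds a
  constant.\<close>

lemma cheb_op_nonconstant:
  shows "degree (op_coeff (cheb_op g r a b) 0) > 0"
proof -
  define n where "n i = op_coeff (cheb_inner r a b) i" for i
  have n0: "n 0 = [:a * coeff (cheb r) 0 + b, 0, 1:]"
    by (simp add: n_def op_coeff_cheb_inner)
  have deg: "degree (n i) \<le> 2" for i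
    unfolding n_def op_coeff_cheb_inner by (intro degree_add_le) auto
  have "coeff ((deriv_comp ^^ i) q) 0 = (pderiv ^^ i) (coeff q 0)" for i q
    by (induction i) (simp_all add: coeff_deriv_comp)
  hence "op_coeff ((cheb_inner r a b)\<^sup>2) 0 = (\<Sum>i\<le>op_order (cheb_inner r a b). n i * (pderiv ^^ i) (n 0))"
    by (simp add: power2_eq_square op_coeff_def symbol_comp_def coeff_sum op_order_def n_def)
  moreover have "coeff (n i * (pderiv ^^ i) (n 0)) 4 = (if i = 0 then 1 else 0)" for i
  proof (cases "i = 0")
    case True
    thus ?thesis by (simp add: n0 numeral_eq_Suc)
  next
    case False
    have "degree ((pderiv ^^ i) u) = degree u - i" for u :: "complex poly"
      by (induction i) (simp_all add: degree_pderiv)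
    hence "degree ((pderiv ^^ i) (n 0)) \<le> 1" using False by (simp add: n0)
    hence "degree (n i * (pderiv ^^ i) (n 0)) < 4"
      using deg[of i] degree_mult_le[of "n i" "(pderiv ^^ i) (n 0)"] by linarith
    thus ?thesis using False by (simp add: coeff_eq_0)
  qed
  ultimately have "coeff (op_coeff ((cheb_inner r a b)\<^sup>2) 0) 4 = 1"
    by (simp add: coeff_sum)
  hence "coeff (op_coeff (cheb_op g r a b) 0) 4 = 1"
    by (simp add: cheb_op_altdef op_coeff_\<iota> numeral_eq_Suc)
  thus ?thesis using le_degree[of "op_coeff (cheb_op g r a b) 0" 4] by simp
qed

section \<open>The commuting pair and the final statement\<close>

lemma cheb_op_commuting_pair:
  assumes r: "r \<ge> 1" and a: "a \<noteq> 0" and L: "L = cheb_op g r a b"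
  shows "\<exists>\<alpha> M. op_order M = (2 * g + 1) * max 2 r \<and> commutator L M = 0 \<and>
    M ^ 2 = L ^ (2 * g + 1) + (\<Sum>i\<le>2 * g. op_const (\<alpha> i) * L ^ i) \<and>
    spectral_curve L M = {(l, m). m ^ 2 = l ^ (2 * g + 1) + (\<Sum>i\<le>2 * g. \<alpha> i * l ^ i)} \<and>
    has_rank L M (max 2 r) \<and> has_genus (spectral_curve L M) g \<and>
    (op_lead L = 1 \<longrightarrow> op_lead M = 1)"
proof -
  obtain M0 \<alpha> where M0: "commutator L M0 = 0"
    "M0 ^ 2 = L ^ (2 * g + 1) + (\<Sum>i\<le>2 * g. op_const (\<alpha> i) * L ^ i)"
    using cheb_op_square_root[of r a L g b] r a L by auto
  \<comment> \<open>If \<open>L\<close> is monic, the leading coefficient of a square root is 1 or -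
    1; the sign is chosen to make \<open>M\<close> monic as well.\<close>
  define M where "M = (if op_lead M0 = - 1 then - M0 else M0)"
  have comm: "commutator L M = 0" using M0(1) by (auto simp: M_def commutator_def)
  have sq: "M ^ 2 = L ^ (2 * g + 1) + (\<Sum>i\<le>2 * g. op_const (\<alpha> i) * L ^ i)"
    using M0(2) by (auto simp: M_def)
  define F where "F = monom 1 (2 * g + 1) + (\<Sum>i\<le>2 * g. monom (\<alpha> i) i)"
  have small: "degree (\<Sum>i\<le>2 * g. monom (\<alpha> i) i) < degree (monom (1 :: complex) (2 * g + 1))"
    by (rule le_less_trans[of _ "2 * g"]) (auto intro!: degree_le simp: coeff_sum degree_monom_eq)
  have degF: "degree F = 2 * g + 1"
    unfolding F_def degree_add_eq_left[OF small] by (simp add: degree_monom_eq)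
  hence F0: "F \<noteq> 0" and odd: "odd (degree F)" by auto
  have mono: "poly_at_op (monom c i) L = op_const c * L ^ i" for c i
    by (induction i) (simp_all add: monom_0 monom_Suc poly_at_op_pCons op_const_left_commute)
  have "poly_at_op (sum f A) L = (\<Sum>i\<in>A. poly_at_op (f i) L)" for f :: "nat \<Rightarrow> complex poly" and A
    by (induction A rule: infinite_finite_induct) (simp_all add: poly_at_op_add)
  note sum = this
  have sqF: "M\<^sup>2 = poly_at_op F L"
    unfolding sq F_def poly_at_op_add sum mono by simp
  have polyF: "poly F l = l ^ (2 * g + 1) + (\<Sum>i\<le>2 * g. \<alpha> i * l ^ i)" for l
    by (simp add: F_def poly_monom poly_sum)
  \<comment> \<open>The value \<open>max 2 r\<close> treats both cases at once: for
    \<open>r = 1\<close> the order is 4, which is why the rank is then 2.\<close>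
  have oL: "op_order L = 2 * max 2 r" unfolding L by (rule cheb_op_order(1)[OF r a])
  hence L0: "op_order L > 0" by simp
  have LM: "L * M = M * L" using comm by (simp add: commutator_def)
  have curve: "spectral_curve L M = hyper_curve F"
    unfolding hyper_curve_def by (rule spectral_curve_hyperelliptic[OF sqF L0 odd])
  have "M \<noteq> 0"
  proof
    assume "M = 0"
    hence "op_lead (poly_at_op F L) = 0" using sqF by (simp add: power2_eq_square)
    thus False using F0 L0 by (auto simp: op_order_poly_at_op(2)[OF L0 F0])
  qed
  hence "2 * op_order M = (2 * g + 1) * (2 * max 2 r)"
    using arg_cong[OF sqF, of op_order] by (simp add: op_order_power op_order_poly_at_op(1)[OF L0 F0] degF oL)
  hence "op_order M = (2 * g + 1) * max 2 r" by simp
  moreover note comm sq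
  moreover have "spectral_curve L M = {(l, m). m ^ 2 = l ^ (2 * g + 1) + (\<Sum>i\<le>2 * g. \<alpha> i * l ^ i)}"
    unfolding curve hyper_curve_def polyF ..
  moreover have "has_rank L M (max 2 r)"
    by (rule has_rank_hyperelliptic[OF LM sqF odd oL]) simp
  moreover have "has_genus (spectral_curve L M) g"
    unfolding curve by (rule has_genus_hyper_curve[OF degF])
  moreover have "op_lead L = 1 \<longrightarrow> op_lead M = 1"
  proof
    assume that: "op_lead L = 1"
    have "(op_lead M)\<^sup>2 = smult (lead_coeff F) 1"
      unfolding op_lead_power[symmetric] sqF by (simp add: op_order_poly_at_op(2)[OF L0 F0] that)
    moreover have "lead_coeff F = 1"
      by (simp only: degF) (simp add: F_def coeff_sum)
    ultimately have "op_lead M = 1 \<or> op_lead M = - 1" by (simp add: power2_eq_1_iff one_pCons[symmetric])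
    thus "op_lead M = 1" by (auto simp: M_def split: if_splits)
  qed
  ultimately show ?thesis by (intro exI[of _ \<alpha>] exI[of _ M] conjI)
qed

theorem mainTheorem1:
  fixes g r :: nat and a b :: complex and L :: diffop
  assumes "g \<ge> 1" and "r \<ge> 1" and "a \<noteq> 0"
    and L: "L = cheb_op g r a b"
  shows
    "(r > 1 \<longrightarrow>
        op_order L = 2 * r \<and>
        (\<exists>(\<alpha> :: nat \<Rightarrow> complex) M.
           op_order M = (2 * g + 1) * r \<and>
           commutator L M = 0 \<and>
           M ^ 2 = L ^ (2 * g + 1) + (\<Sum>i\<le>2 * g. op_const (\<alpha> i) * L ^ i) \<and>
           spectral_curve L M = {(l, m). m ^ 2 = l ^ (2 * g + 1) + (\<Sum>i\<le>2 * g. \<alpha> i * l ^ i)} \<and>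
           has_rank L M r \<and>
           has_genus (spectral_curve L M) g \<and>
           (\<forall>i. op_coeff M i \<in> diff_polys (range (op_coeff L))) \<and>
           (r > 3 \<and> a = 1 / 2 ^ (r - 1) \<longrightarrow> standard_canonical_form L M)))
     \<and>
     (r = 1 \<longrightarrow>
        (\<exists>(\<alpha> :: nat \<Rightarrow> complex) M.
           commutator L M = 0 \<and>
           M ^ 2 = L ^ (2 * g + 1) + (\<Sum>i\<le>2 * g. op_const (\<alpha> i) * L ^ i) \<and>
           has_rank L M 2 \<and>
           has_genus (spectral_curve L M) g))"
proof -
  obtain \<alpha> M where M: "op_order M = (2 * g + 1) * max 2 r" "commutator L M = 0"
    "M ^ 2 = L ^ (2 * g + 1) + (\<Sum>i\<le>2 * g. op_const (\<alpha> i) * L ^ i)"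
    "spectral_curve L M = {(l, m). m ^ 2 = l ^ (2 * g + 1) + (\<Sum>i\<le>2 * g. \<alpha> i * l ^ i)}"
    "has_rank L M (max 2 r)" "has_genus (spectral_curve L M) g"
    and lead: "op_lead L = 1 \<longrightarrow> op_lead M = 1"
    using cheb_op_commuting_pair[OF assms(2,3) L] by (elim exE conjE)
  have order: "op_order L = 2 * max 2 r" unfolding L by (rule cheb_op_order(1)[OF assms(2,3)])
  \<comment> \<open>The coefficient of \<open>L\<close> at index 0 is nonconstant and by itself
    generates all polynomials.\<close>
  have coeffs: "\<forall>i. op_coeff M i \<in> diff_polys (range (op_coeff L))"
    using diff_polys_everything[OF rangeI[of "op_coeff L" 0]] cheb_op_nonconstant[of g r a b] by (simp add: L)
  have canonical: "standard_canonical_form L M" if "r > 3 \<and> a = 1 / 2 ^ (r - 1)"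
  proof -
    have "op_lead L = 1"
      using cheb_op_order(2)[OF assms(2,3), of g b] that by (simp add: L one_pCons power2_eq_square)
    moreover have "op_coeff L (op_order L - 1) = 0"
      using cheb_op_subleading[of r a g b] that order by (simp add: L max_def)
    ultimately show ?thesis using lead by (simp add: standard_canonical_form_def)
  qed
  show ?thesis
  proof (intro conjI impI)
    assume "r > 1"
    hence mx: "max 2 r = r" by simp
    show "op_order L = 2 * r" using order unfolding mx .
    show "\<exists>(\<alpha> :: nat \<Rightarrow> complex) M.
           op_order M = (2 * g + 1) * r \<and>
           commutator L M = 0 \<and>
           M ^ 2 = L ^ (2 * g + 1) + (\<Sum>i\<le>2 * g. op_const (\<alpha> i) * L ^ i) \<and>
           spectral_curve L M = {(l, m). m ^ 2 = l ^ (2 * g + 1) + (\<Sum>i\<le>2 * g. \<alpha> i * l ^ i)} \<and>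
           has_rank L M r \<and>
           has_genus (spectral_curve L M) g \<and>
           (\<forall>i. op_coeff M i \<in> diff_polys (range (op_coeff L))) \<and>
           (r > 3 \<and> a = 1 / 2 ^ (r - 1) \<longrightarrow> standard_canonical_form L M)"
      using canonical by (intro exI[of _ \<alpha>] exI[of _ M] conjI M[unfolded mx] coeffs impI)
  next
    assume "r = 1"
    hence mx: "max 2 r = 2" by simp
    show "\<exists>(\<alpha> :: nat \<Rightarrow> complex) M.
           commutator L M = 0 \<and>
           M ^ 2 = L ^ (2 * g + 1) + (\<Sum>i\<le>2 * g. op_const (\<alpha> i) * L ^ i) \<and>
           has_rank L M 2 \<and>
           has_genus (spectral_curve L M) g"
      by (intro exI[of _ \<alpha>] exI[of _ M] conjI M[unfolded mx])
  qed
qed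

end
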